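(* Let $\Omega\subset\mathbb{R}^3$ be a bounded Lipschitz domain with a connected complement and let $\mathbf{x}_0\in\partial\Omega$. Suppose that $\Omega\cap B_{r_0}(\mathbf{x}_0)=\mathcal{K}^{r_0}_{\mathbf{x}_0}\cap B_{r_0}(\mathbf{x}_0)$ for some $r_0\in\mathbb{R}_+$, where $\mathcal{K}^{r_0}_{\mathbf{x}_0}$ is a conical corner with apex $\mathbf{x}_0$. Let $\mathbf{J}_1$ (electric source) and $\mathbf{J}_2$ (magnetic source) both be supported in $\Omega$ and satisfy $\mathbf{J}_1,\mathbf{J}_2\in C^\alpha(\overline{\mathcal{K}^{r_0}_{\mathbf{x}_0}})^3$. Consider the electromagnetic source scattering problem generated by $\mathbf{J}_1,\mathbf{J}_2$. If $\mathbf{J}_1$ and $\mathbf{J}_2$ are non-radiating, namely the far-field patterns satisfy $\mathbf{E}_\infty=\mathbf{H}_\infty\equiv\mathbf{0}$, then $$\mathbf{J}_1(\mathbf{x}_0)=\mathbf{J}_2(\mathbf{x}_0)=\mathbf{0}.$$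
   Context: Conical corner: for $\mathbf{x}_0\in\mathbb{R}^3$, $\mathbf{a}\in\mathbb{S}^2$ and $\theta_0\in(0,\pi/2)$, let $\mathcal{K}_{\mathbf{x}_0,\theta_0}=\{\mathbf{x}_0+r\tilde{\mathbf{x}} : r>0,\ \tilde{\mathbf{x}}\in\mathbb{S}^2,\ \text{the angle between } \tilde{\mathbf{x}} \text{ and } \mathbf{a} \text{ lies in } [0,\theta_0)\}$ (the convex circular cone with apex $\mathbf{x}_0$, axis $\mathbf{a}$, opening angle $2\theta_0<\pi$), and $\mathcal{K}^{r_0}_{\mathbf{x}_0}=\mathcal{K}_{\mathbf{x}_0,\theta_0}\cap B_{r_0}(\mathbf{x}_0)$, where $B_{r_0}(\mathbf{x}_0)=\{|\mathbf{x}-\mathbf{x}_0|<r_0\}$. Here $\alpha\in(0,1)$. Source scattering problem: $\omega,\varepsilon_0,\mu_0\in\mathbb{R}_+$ are fixed, $k=\omega\sqrt{\varepsilon_0\mu_0}$, and $\mathbf{J}_1,\mathbf{J}_2:\mathbb{R}^3\to\mathbb{C}^3$ are supported in $\Omega$ with $\mathbf{J}_j|_\Omega\in L^2(\Omega;\mathbb{C}^3)$. $(\mathbf{E},\mathbf{H})\in H_{\mathrm{loc}}(\mathrm{curl},\mathbb{R}^3)^2$ is the unique solution of $$\nabla\wedge\mathbf{E}-\mathrm{i}\omega\mu_0\mathbf{H}=\mathbf{J}_1,\quad \nabla\wedge\mathbf{H}+\mathrm{i}\omega\varepsilon_0\mathbf{E}=\mathbf{J}_2\ \text{ in }\mathbb{R}^3,\qquad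 \lim_{|\mathbf{x}|\to\infty}|\mathbf{x}|\left(\mu_0^{1/2}\mathbf{H}\times\tfrac{\mathbf{x}}{|\mathbf{x}|}-\varepsilon_0^{1/2}\mathbf{E}\right)=0$$ (uniformly in all directions). The far-field patterns $\mathbf{E}_\infty,\mathbf{H}_\infty$ on $\mathbb{S}^2$ are defined by $(\mathbf{E},\mathbf{H})(\mathbf{x})=\frac{e^{\mathrm{i}k|\mathbf{x}|}}{|\mathbf{x}|}(\mathbf{E}_\infty,\mathbf{H}_\infty)(\hat{\mathbf{x}})+\mathcal{O}(|\mathbf{x}|^{-2})$, $\hat{\mathbf{x}}=\mathbf{x}/|\mathbf{x}|$. The value $\mathbf{J}_j(\mathbf{x}_0)$ is that of the Hölder continuous function on $\overline{\mathcal{K}^{r_0}_{\mathbf{x}_0}}$. *)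

theory Defs
  imports "HOL-Analysis.Analysis"
begin

text \<open>
  A bounded domain is Lipschitz if near each boundary point it is the strict epigraph of a
  Lipschitz function in a suitable orthonormal frame.  The frame is represented by its last vector
  \<open>\<nu>\<close> alone: the height of \<open>x\<close> is \<open>x \<bullet> \<nu>\<close>, and the graph function \<open>\<gamma>\<close>
  lives on the hyperplane orthogonal to \<open>\<nu>\<close>.
\<close>

definition bounded_lipschitz_domain :: "'a::euclidean_space set \<Rightarrow> bool" where
  "bounded_lipschitz_domain \<Omega> \<longleftrightarrow>
     open \<Omega> \<and> connected \<Omega> \<and> \<Omega> \<noteq> {} \<and> bounded \<Omega> \<and>
     (\<forall>p\<in>frontier \<Omega>. \<exists>\<nu> \<gamma> L r.
        norm \<nu> = 1 \<and> r > 0 \<and> L-lipschitz_on {y. y \<bullet> \<nu> = 0} \<gamma> \<and>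
        \<Omega> \<inter> ball p r = {x \<in> ball p r. x \<bullet> \<nu> > (\<gamma> (x - (x \<bullet> \<nu>) *\<^sub>R \<nu>) :: real)})"

definition circular_cone :: "real ^ 3 \<Rightarrow> real ^ 3 \<Rightarrow> real \<Rightarrow> (real ^ 3) set" where
  "circular_cone x0 a \<theta>0 =
     {x0 + r *\<^sub>R y | r y. r > 0 \<and> y \<in> sphere 0 1 \<and> arccos (y \<bullet> a) \<in> {0..<\<theta>0}}"

definition truncated_cone :: "real ^ 3 \<Rightarrow> real ^ 3 \<Rightarrow> real \<Rightarrow> real \<Rightarrow> (real ^ 3) set" where
  "truncated_cone x0 a \<theta>0 r0 = circular_cone x0 a \<theta>0 \<inter> ball x0 r0"

definition holder_on ::
  "real \<Rightarrow> 'a::metric_space set \<Rightarrow> ('a \<Rightarrow> 'b::real_normed_vector) \<Rightarrow> bool" where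
  "holder_on \<alpha> S g \<longleftrightarrow>
     (\<exists>C. \<forall>x\<in>S. \<forall>y\<in>S. norm (g x - g y) \<le> C * dist x y powr \<alpha>)"

text \<open>
  Square integrable fields are determined only almost everywhere, so membership of \<open>J\<close> in
  \<open>C\<^sup>\<alpha>(closure S)\<close> means that \<open>J\<close> agrees almost everywhere on \<open>S\<close> with a Hoelder continuous
  function \<open>g\<close> on \<open>closure S\<close>.  The value of \<open>J\<close> at a point of \<open>closure S\<close> is that of \<open>g\<close>.
\<close>

definition holder_representative ::
  "real \<Rightarrow> (real ^ 3) set \<Rightarrow> (real ^ 3 \<Rightarrow> complex ^ 3) \<Rightarrow> (real ^ 3 \<Rightarrow> complex ^ 3) \<Rightarrow> bool" where
  "holder_representative \<alpha> S J g \<longleftrightarrow>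
     holder_on \<alpha> (closure S) g \<and> (AE x in lebesgue. x \<in> S \<longrightarrow> J x = g x)"

definition cross3_complex :: "complex ^ 3 \<Rightarrow> complex ^ 3 \<Rightarrow> complex ^ 3" where
  "cross3_complex u v =
     vector [u$2 * v$3 - u$3 * v$2, u$3 * v$1 - u$1 * v$3, u$1 * v$2 - u$2 * v$1]"

text \<open>The product below is bilinear, without complex conjugation.\<close>

definition dot_complex :: "complex ^ 3 \<Rightarrow> complex ^ 3 \<Rightarrow> complex" where
  "dot_complex u v = (\<Sum>i\<in>UNIV. u$i * v$i)"

definition complexify :: "real ^ 3 \<Rightarrow> complex ^ 3" where
  "complexify x = (\<chi> i. complex_of_real (x$i))"

definition partial_deriv :: "3 \<Rightarrow> (real ^ 3 \<Rightarrow> complex ^ 3) \<Rightarrow> real ^ 3 \<Rightarrow> complex ^ 3" where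
  "partial_deriv i f x = frechet_derivative f (at x) (axis i 1)"

text \<open>
  All iterated partial derivatives exist and are Frechet differentiable (hence continuous)
  everywhere, i.e. the field is of class \<open>C\<^sup>\<infinity>\<close>.
\<close>

definition smooth_field :: "(real ^ 3 \<Rightarrow> complex ^ 3) \<Rightarrow> bool" where
  "smooth_field f \<longleftrightarrow> (\<forall>is x. foldr partial_deriv is f differentiable (at x))"

definition test_field :: "(real ^ 3 \<Rightarrow> complex ^ 3) \<Rightarrow> bool" where
  "test_field \<phi> \<longleftrightarrow> smooth_field \<phi> \<and> compact (closure {x. \<phi> x \<noteq> 0})"

definition classical_curl :: "(real ^ 3 \<Rightarrow> complex ^ 3) \<Rightarrow> real ^ 3 \<Rightarrow> complex ^ 3" where
  "classical_curl f x = vector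
     [partial_deriv 2 f x $ 3 - partial_deriv 3 f x $ 2,
      partial_deriv 3 f x $ 1 - partial_deriv 1 f x $ 3,
      partial_deriv 1 f x $ 2 - partial_deriv 2 f x $ 1]"

definition L2_on :: "(real ^ 3) set \<Rightarrow> (real ^ 3 \<Rightarrow> complex ^ 3) \<Rightarrow> bool" where
  "L2_on S f \<longleftrightarrow>
     set_borel_measurable lebesgue S f \<and> set_integrable lebesgue S (\<lambda>x. (norm (f x))\<^sup>2)"

definition L2_loc :: "(real ^ 3 \<Rightarrow> complex ^ 3) \<Rightarrow> bool" where
  "L2_loc f \<longleftrightarrow> (\<forall>K. compact K \<longrightarrow> L2_on K f)"

definition has_weak_curl ::
  "(real ^ 3 \<Rightarrow> complex ^ 3) \<Rightarrow> (real ^ 3 \<Rightarrow> complex ^ 3) \<Rightarrow> bool" where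
  "has_weak_curl U F \<longleftrightarrow>
     (\<forall>\<phi>. test_field \<phi> \<longrightarrow>
        (LINT x|lebesgue. dot_complex (U x) (classical_curl \<phi> x)) =
        (LINT x|lebesgue. dot_complex (F x) (\<phi> x)))"

text \<open>
  Membership in \<open>H\<^sub>l\<^sub>o\<^sub>c(curl, \<real>\<^sup>3)\<close>, with the distributional curl (unique up to null sets)
  as second argument.
\<close>

definition H_loc_curl ::
  "(real ^ 3 \<Rightarrow> complex ^ 3) \<Rightarrow> (real ^ 3 \<Rightarrow> complex ^ 3) \<Rightarrow> bool" where
  "H_loc_curl U F \<longleftrightarrow> L2_loc U \<and> L2_loc F \<and> has_weak_curl U F"

text \<open>
  The limit is uniform in all directions.  It and the far-field expansion below are imposed almost
  everywhere, so that they do not depend on the representatives of the fields.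
\<close>

definition silver_mueller ::
  "real \<Rightarrow> real \<Rightarrow> (real ^ 3 \<Rightarrow> complex ^ 3) \<Rightarrow> (real ^ 3 \<Rightarrow> complex ^ 3) \<Rightarrow> bool" where
  "silver_mueller \<epsilon>0 \<mu>0 E H \<longleftrightarrow>
     (\<forall>e>0. \<exists>R. AE x in lebesgue. norm x > R \<longrightarrow>
        norm (norm x *\<^sub>R (sqrt \<mu>0 *\<^sub>R cross3_complex (H x) (complexify (x /\<^sub>R norm x))
                        - sqrt \<epsilon>0 *\<^sub>R E x)) < e)"

definition source_scattering_solution ::
  "real \<Rightarrow> real \<Rightarrow> real \<Rightarrow> (real ^ 3 \<Rightarrow> complex ^ 3) \<Rightarrow> (real ^ 3 \<Rightarrow> complex ^ 3) \<Rightarrow>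
   (real ^ 3 \<Rightarrow> complex ^ 3) \<Rightarrow> (real ^ 3 \<Rightarrow> complex ^ 3) \<Rightarrow> bool" where
  "source_scattering_solution \<omega> \<epsilon>0 \<mu>0 J1 J2 E H \<longleftrightarrow>
     (\<exists>curlE curlH. H_loc_curl E curlE \<and> H_loc_curl H curlH \<and>
        (AE x in lebesgue. curlE x - (\<i> * of_real (\<omega> * \<mu>0)) *s H x = J1 x) \<and>
        (AE x in lebesgue. curlH x + (\<i> * of_real (\<omega> * \<epsilon>0)) *s E x = J2 x)) \<and>
     silver_mueller \<epsilon>0 \<mu>0 E H"

definition wave_number :: "real \<Rightarrow> real \<Rightarrow> real \<Rightarrow> real" where
  "wave_number \<omega> \<epsilon>0 \<mu>0 = \<omega> * sqrt (\<epsilon>0 * \<mu>0)"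

text \<open>\<open>Uinf\<close> matters only on the unit sphere, where it is determined up to a null set.\<close>

definition far_field_pattern ::
  "real \<Rightarrow> (real ^ 3 \<Rightarrow> complex ^ 3) \<Rightarrow> (real ^ 3 \<Rightarrow> complex ^ 3) \<Rightarrow> bool" where
  "far_field_pattern k U Uinf \<longleftrightarrow>
     (\<exists>C R. AE x in lebesgue. norm x > R \<longrightarrow>
        norm (U x - (exp (\<i> * of_real (k * norm x)) / of_real (norm x)) *s Uinf (x /\<^sub>R norm x))
          \<le> C / (norm x)\<^sup>2)"

end

theory Submission imports Defs begin

text \<open>
  The far fields vanish, so \<open>E\<close> and \<open>H\<close> decay like \<open>|x|^(-2)\<close>, and off \<open>\<Omega>\<close> each of their components is a
  weak solution of the Helmholtz equation.  The moments of such a solution \<open>v\<close> against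
  \<open>Q (x - p) g (|x - p|\<^sup>2)\<close>, with \<open>Q\<close> a monomial of degree \<open>d\<close>, obey modulo moments of degree \<open>d - 2\<close> a
  spherical Bessel equation in \<open>|x - p|\<^sup>2\<close>, which variation of parameters solves explicitly.  So all
  moments vanish when \<open>v\<close> vanishes near \<open>p\<close> (unique continuation) or when \<open>v\<close> decays (Rellich), and
  neither regularity theory nor spherical harmonics are needed.  Hence \<open>E\<close> and \<open>H\<close> vanish outside \<open>\<Omega>\<close>
  near \<open>x\<^sub>0\<close>.  Testing Maxwell's equations with truncated waves \<open>exp (\<zeta> \<bullet> (x - x\<^sub>0))\<close>, \<open>\<zeta> \<bullet> \<zeta> = - k\<^sup>2\<close>,
  whose decay rate \<open>t\<close> in the cone tends to infinity, then leaves \<open>(J(x\<^sub>0) \<bullet> \<rho>) C = 0\<close> after rescaling by \<open>t\<close>, where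
  \<open>\<rho> = - a + \<i> b\<close> for any unit vector \<open>b \<bottom> a\<close> and \<open>C\<close> is the Laplace transform of the cone at \<open>\<rho>\<close>, whose
  real part is computed and positive.
\<close>

section \<open>Smooth functions\<close>

text \<open>The fields are only locally square integrable, so no point value or trace is at hand:
  every vanishing statement holds almost everywhere, and derivatives always fall on test functions.
  The radial equation is solvable for every right-hand side \<open>g\<close>, but in general its
  solution can be made to vanish only on one side of the support of \<open>g\<close>. The other side
  must be cut off, and the two uniqueness results differ in why the cut is harmless. Near a centre
  where \<open>v\<close> is zero it costs nothing. At infinity it leaves an error of size
  \<open>|x|^(-d-2)\<close> on a shell \<open>N \<le> |x|^2 \<le> 2 N\<close>; against a monomial of
  degree \<open>d\<close>, the decay \<open>|x|^(-2)\<close> of \<open>v\<close> and a volume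
  \<open>N^(3/2)\<close> this is \<open>O(N^(-1/2))\<close>. Zeros must then be carried to the
  corner although connectedness is given for \<open>- \<Omega>\<close> and not for
  \<open>- closure \<Omega>\<close>; the Lipschitz charts bridge the boundary. At the corner the
  zero exterior fields encode both transmission conditions, so no boundary term appears. The dual
  amplitude of the test wave is \<open>O(1/t)\<close>, which isolates one current at a time;
  exchanging the roles of the two fields gives the other.\<close>

primrec Ck_on :: "nat \<Rightarrow> 'a::euclidean_space set \<Rightarrow> ('a \<Rightarrow> 'b::real_normed_vector) \<Rightarrow> bool" where
  "Ck_on 0 S f = True"
| "Ck_on (Suc n) S f \<longleftrightarrow> (\<forall>x\<in>S. f differentiable (at x)) \<and>
     (\<forall>b\<in>Basis. Ck_on n S (\<lambda>x. frechet_derivative f (at x) b))"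

text \<open>\<open>Ck_on n\<close> demands n-fold Frechet differentiability without continuity of
  the last derivative; over all \<open>n\<close> nothing is lost. Recursing over the directions in
  \<open>Basis\<close> keeps every derivative in the codomain of the function itself.\<close>

definition smooth_on :: "'a::euclidean_space set \<Rightarrow> ('a \<Rightarrow> 'b::real_normed_vector) \<Rightarrow> bool" where
  "smooth_on S f \<longleftrightarrow> (\<forall>n. Ck_on n S f)"

lemma Ck_on_cong:
  assumes "open S" "\<And>x. x \<in> S \<Longrightarrow> f x = g x"
  shows "Ck_on n S f \<longleftrightarrow> Ck_on n S g"
  using assms(2)
proof (induction n arbitrary: f g)
  case (Suc n)
  have D: "(f has_derivative D) (at x) \<longleftrightarrow> (g has_derivative D) (at x)" if "x \<in> S" for x D
    using has_derivative_transform_within_open[OF _ assms(1) that, of f D UNIV g]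
      has_derivative_transform_within_open[OF _ assms(1) that, of g D UNIV f] Suc.prems by auto
  have 1: "f differentiable (at x) \<longleftrightarrow> g differentiable (at x)" if "x \<in> S" for x
    using D[OF that] by (auto simp: differentiable_def)
  have 2: "frechet_derivative f (at x) b = frechet_derivative g (at x) b" if "x \<in> S" for x b
    using D[OF that] by (simp add: frechet_derivative_def)
  show ?case
    using 1 2 Suc.IH[of "\<lambda>x. frechet_derivative f (at x) _" "\<lambda>x. frechet_derivative g (at x) _"] by simp
qed auto

lemma Ck_on_subset: "Ck_on n S f \<Longrightarrow> T \<subseteq> S \<Longrightarrow> Ck_on n T f"
  by (induction n arbitrary: f) auto

lemma Ck_on_Un: "Ck_on n S f \<Longrightarrow> Ck_on n T f \<Longrightarrow> Ck_on n (S \<union> T) f"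
  by (induction n arbitrary: f) auto

lemma Ck_on_SucD: "Ck_on (Suc n) S f \<Longrightarrow> Ck_on n S f"
  by (induction n arbitrary: f) auto

lemma Ck_on_SucI:
  assumes "open S" "\<And>x. x \<in> S \<Longrightarrow> (f has_derivative f' x) (at x)"
    "\<And>b. b \<in> Basis \<Longrightarrow> Ck_on n S (\<lambda>x. f' x b)"
  shows "Ck_on (Suc n) S f"
proof -
  have "frechet_derivative f (at x) = f' x" if "x \<in> S" for x
    using assms(2)[OF that] frechet_derivative_at by metis
  then show ?thesis
    using assms Ck_on_cong[OF assms(1), of "\<lambda>x. frechet_derivative f (at x) _" "\<lambda>x. f' x _" n]
    by (auto simp: differentiable_def)
qed

lemma Ck_on_SucE:
  assumes "Ck_on (Suc n) S f"
  obtains f' where "\<And>x. x \<in> S \<Longrightarrow> (f has_derivative f' x) (at x)"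
    "\<And>b. b \<in> Basis \<Longrightarrow> Ck_on n S (\<lambda>x. f' x b)"
  using assms that[of "\<lambda>x. frechet_derivative f (at x)"] by (auto simp: frechet_derivative_works)

lemma Ck_on_const [simp]: "Ck_on n S (\<lambda>x. c)"
  by (induction n arbitrary: c) (auto)

lemma Ck_on_linear:
  assumes "bounded_linear f" "open S" shows "Ck_on n S f"
proof (cases n)
  case (Suc m)
  show ?thesis unfolding Suc
    by (rule Ck_on_SucI[where f'="\<lambda>x. f"]) (use assms bounded_linear_imp_has_derivative in auto)
qed auto

lemma Ck_on_add:
  assumes "open S" shows "Ck_on n S f \<Longrightarrow> Ck_on n S g \<Longrightarrow> Ck_on n S (\<lambda>x. f x + g x)"
proof (induction n arbitrary: f g)
  case (Suc n)
  obtain f' where f': "\<And>x. x \<in> S \<Longrightarrow> (f has_derivative f' x) (at x)"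
    "\<And>b. b \<in> Basis \<Longrightarrow> Ck_on n S (\<lambda>x. f' x b)" using Ck_on_SucE[OF Suc.prems(1)] by metis
  obtain g' where g': "\<And>x. x \<in> S \<Longrightarrow> (g has_derivative g' x) (at x)"
    "\<And>b. b \<in> Basis \<Longrightarrow> Ck_on n S (\<lambda>x. g' x b)" using Ck_on_SucE[OF Suc.prems(2)] by metis
  show ?case
    by (rule Ck_on_SucI[OF assms, where f'="\<lambda>x b. f' x b + g' x b"])
       (use f' g' Suc.IH in \<open>auto intro: has_derivative_add\<close>)
qed auto

lemma Ck_on_bounded_linear:
  assumes "bounded_linear L" "open S" shows "Ck_on n S f \<Longrightarrow> Ck_on n S (\<lambda>x. L (f x))"
proof (induction n arbitrary: f)
  case (Suc n)
  obtain f' where f': "\<And>x. x \<in> S \<Longrightarrow> (f has_derivative f' x) (at x)"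
    "\<And>b. b \<in> Basis \<Longrightarrow> Ck_on n S (\<lambda>x. f' x b)" using Ck_on_SucE[OF Suc.prems(1)] by metis
  show ?case
    by (rule Ck_on_SucI[OF assms(2), where f'="\<lambda>x b. L (f' x b)"])
       (erule bounded_linear.has_derivative[OF assms(1) f'(1)] Suc.IH[OF f'(2)])+
qed auto

lemma Ck_on_bilinear:
  assumes "bounded_bilinear P" "open S"
  shows "Ck_on n S f \<Longrightarrow> Ck_on n S g \<Longrightarrow> Ck_on n S (\<lambda>x. P (f x) (g x))"
proof (induction n arbitrary: f g)
  case (Suc n)
  obtain f' where f': "\<And>x. x \<in> S \<Longrightarrow> (f has_derivative f' x) (at x)"
    "\<And>b. b \<in> Basis \<Longrightarrow> Ck_on n S (\<lambda>x. f' x b)" using Ck_on_SucE[OF Suc.prems(1)] by metis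
  obtain g' where g': "\<And>x. x \<in> S \<Longrightarrow> (g has_derivative g' x) (at x)"
    "\<And>b. b \<in> Basis \<Longrightarrow> Ck_on n S (\<lambda>x. g' x b)" using Ck_on_SucE[OF Suc.prems(2)] by metis
  show ?case
    by (rule Ck_on_SucI[OF assms(2), where f'="\<lambda>x b. P (f x) (g' x b) + P (f' x b) (g x)"])
       (use f' g' Suc.IH Suc.prems[THEN Ck_on_SucD] in
         \<open>auto intro!: Ck_on_add[OF assms(2)] bounded_bilinear.FDERIV[OF assms(1)]\<close>)
qed auto

lemmas Ck_on_mult = Ck_on_bilinear[OF bounded_bilinear_mult]
lemmas Ck_on_scaleR = Ck_on_bilinear[OF bounded_bilinear_scaleR]

lemma Ck_on_minus: "open S \<Longrightarrow> Ck_on n S f \<Longrightarrow> Ck_on n S (\<lambda>x. - f x)"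
  by (rule Ck_on_bounded_linear[of uminus]) (auto intro: bounded_linear_minus bounded_linear_ident)

lemma Ck_on_diff: "open S \<Longrightarrow> Ck_on n S f \<Longrightarrow> Ck_on n S g \<Longrightarrow> Ck_on n S (\<lambda>x. f x - g x)"
  using Ck_on_add[of S n f "\<lambda>x. - g x"] Ck_on_minus by auto

lemma Ck_on_sum:
  assumes "open S" "\<And>i. i \<in> I \<Longrightarrow> Ck_on n S (f i)" shows "Ck_on n S (\<lambda>x. \<Sum>i\<in>I. f i x)"
  using assms(2) by (induction I rule: infinite_finite_induct) (auto intro: Ck_on_add[OF assms(1)])

lemma Ck_on_prod:
  fixes f :: "'i \<Rightarrow> 'a::euclidean_space \<Rightarrow> 'b::{real_normed_algebra,comm_ring_1}"
  assumes "open S" "\<And>i. i \<in> I \<Longrightarrow> Ck_on n S (f i)" shows "Ck_on n S (\<lambda>x. \<Prod>i\<in>I. f i x)"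
  using assms(2) by (induction I rule: infinite_finite_induct) (auto intro: Ck_on_mult[OF assms(1)])

lemma Ck_on_power:
  fixes f :: "'a::euclidean_space \<Rightarrow> 'b::{real_normed_algebra,comm_ring_1}"
  assumes "open S" "Ck_on n S f" shows "Ck_on n S (\<lambda>x. f x ^ m)"
  by (induction m) (auto intro: Ck_on_mult assms)

text \<open>The derivative contains \<open>h' (q x) 1\<close>, again a composition with
  \<open>q\<close> but of a different outer function; hence the induction with \<open>h\<close>
  arbitrary. A real-valued inner function covers radial functions and rescaled cutoffs.\<close>

lemma Ck_on_compose:
  fixes h :: "real \<Rightarrow> 'b::real_normed_vector" and q :: "'a::euclidean_space \<Rightarrow> real"
  assumes "open S" "q ` S \<subseteq> T"
  shows "Ck_on n S q \<Longrightarrow> Ck_on n T h \<Longrightarrow> Ck_on n S (\<lambda>x. h (q x))"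
proof (induction n arbitrary: h)
  case (Suc n)
  obtain q' where q': "\<And>x. x \<in> S \<Longrightarrow> (q has_derivative q' x) (at x)"
    "\<And>b. b \<in> Basis \<Longrightarrow> Ck_on n S (\<lambda>x. q' x b)" using Ck_on_SucE[OF Suc.prems(1)] by metis
  obtain h' where h': "\<And>x. x \<in> T \<Longrightarrow> (h has_derivative h' x) (at x)"
    "Ck_on n T (\<lambda>x. h' x 1)" using Ck_on_SucE[OF Suc.prems(2)] by (metis Basis_real_def singletonI)
  have lin: "h' (q x) t = t *\<^sub>R h' (q x) 1" if "x \<in> S" for x t
  proof -
    have "linear (h' (q x))" using h'(1)[of "q x"] assms(2) that has_derivative_linear by blast
    then show ?thesis using linear.scaleR[of "h' (q x)" t 1] by simp
  qed
  show ?case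
  proof (rule Ck_on_SucI[OF assms(1), where f'="\<lambda>x b. q' x b *\<^sub>R h' (q x) 1"])
    fix x assume x: "x \<in> S"
    have "((\<lambda>x. h (q x)) has_derivative (\<lambda>b. h' (q x) (q' x b))) (at x)"
      using diff_chain_at[OF q'(1)[OF x] h'(1)] x assms(2) by (auto simp: o_def)
    then show "((\<lambda>x. h (q x)) has_derivative (\<lambda>b. q' x b *\<^sub>R h' (q x) 1)) (at x)"
      by (rule has_derivative_eq_rhs) (rule ext, rule lin[OF x])
  next
    fix b :: 'a assume "b \<in> Basis"
    then show "Ck_on n S (\<lambda>x. q' x b *\<^sub>R h' (q x) 1)"
      using q' h' Suc by (intro Ck_on_scaleR[OF assms(1)] Suc.IH) (auto intro: Ck_on_SucD[OF Suc.prems(1)])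
  qed
qed auto

lemma Ck_on_inverse:
  fixes f :: "'a::euclidean_space \<Rightarrow> 'b::real_normed_field"
  assumes "open S" "\<And>x. x \<in> S \<Longrightarrow> f x \<noteq> 0"
  shows "Ck_on n S f \<Longrightarrow> Ck_on n S (\<lambda>x. inverse (f x))"
proof (induction n)
  case (Suc n)
  obtain f' where f': "\<And>x. x \<in> S \<Longrightarrow> (f has_derivative f' x) (at x)"
    "\<And>b. b \<in> Basis \<Longrightarrow> Ck_on n S (\<lambda>x. f' x b)" using Ck_on_SucE[OF Suc.prems(1)] by metis
  show ?case
    using f' assms Suc.IH Ck_on_SucD[OF Suc.prems]
    by (intro Ck_on_SucI[OF assms(1), where f'="\<lambda>x b. - (inverse (f x) * f' x b * inverse (f x))"]
        Ck_on_minus Ck_on_mult) (auto intro: has_derivative_inverse)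
qed auto

lemma Ck_on_divide:
  fixes f :: "'a::euclidean_space \<Rightarrow> 'b::real_normed_field"
  assumes "open S" "\<And>x. x \<in> S \<Longrightarrow> g x \<noteq> 0" "Ck_on n S f" "Ck_on n S g"
  shows "Ck_on n S (\<lambda>x. f x / g x)"
  unfolding divide_inverse using assms by (intro Ck_on_mult Ck_on_inverse) auto

lemma Ck_on_exp:
  fixes f :: "'a::euclidean_space \<Rightarrow> complex"
  assumes "open S"
  shows "Ck_on n S f \<Longrightarrow> Ck_on n S (\<lambda>x. exp (f x))"
proof (induction n)
  case (Suc n)
  obtain f' where f': "\<And>x. x \<in> S \<Longrightarrow> (f has_derivative f' x) (at x)"
    "\<And>b. b \<in> Basis \<Longrightarrow> Ck_on n S (\<lambda>x. f' x b)" using Ck_on_SucE[OF Suc.prems(1)] by metis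
  have "((\<lambda>x. exp (f x)) has_derivative (\<lambda>b. exp (f x) * f' x b)) (at x)" if "x \<in> S" for x
    using diff_chain_at[OF f'(1)[OF that] DERIV_exp[of "f x", unfolded has_field_derivative_def]]
    by (auto simp: o_def)
  then show ?case
    using f' assms Suc.IH Ck_on_SucD[OF Suc.prems]
    by (intro Ck_on_SucI[OF assms(1), where f'="\<lambda>x b. exp (f x) * f' x b"] Ck_on_mult) auto
qed auto

lemma Ck_on_real_SucI:
  fixes f :: "real \<Rightarrow> 'b::real_normed_vector"
  assumes "open S" "\<And>x. x \<in> S \<Longrightarrow> (f has_vector_derivative f' x) (at x)" "Ck_on n S f'"
  shows "Ck_on (Suc n) S f"
  using assms by (intro Ck_on_SucI[where f'="\<lambda>x t. t *\<^sub>R f' x"]) (auto simp: has_vector_derivative_def)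

lemma smooth_onD: "smooth_on S f \<Longrightarrow> Ck_on n S f" by (simp add: smooth_on_def)

lemma smooth_on_const [simp, intro]: "smooth_on S (\<lambda>x. c)" by (simp add: smooth_on_def)
lemma smooth_on_add: "open S \<Longrightarrow> smooth_on S f \<Longrightarrow> smooth_on S g \<Longrightarrow> smooth_on S (\<lambda>x. f x + g x)"
  by (simp add: smooth_on_def Ck_on_add)
lemma smooth_on_minus: "open S \<Longrightarrow> smooth_on S f \<Longrightarrow> smooth_on S (\<lambda>x. - f x)"
  by (simp add: smooth_on_def Ck_on_minus)
lemma smooth_on_diff: "open S \<Longrightarrow> smooth_on S f \<Longrightarrow> smooth_on S g \<Longrightarrow> smooth_on S (\<lambda>x. f x - g x)"
  by (simp add: smooth_on_def Ck_on_diff)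
lemma smooth_on_mult:
  fixes f :: "'a::euclidean_space \<Rightarrow> 'b::real_normed_algebra"
  shows "open S \<Longrightarrow> smooth_on S f \<Longrightarrow> smooth_on S g \<Longrightarrow> smooth_on S (\<lambda>x. f x * g x)"
  by (simp add: smooth_on_def Ck_on_mult)
lemma smooth_on_sum: "open S \<Longrightarrow> (\<And>i. i \<in> I \<Longrightarrow> smooth_on S (f i)) \<Longrightarrow> smooth_on S (\<lambda>x. \<Sum>i\<in>I. f i x)"
  by (simp add: smooth_on_def Ck_on_sum)
lemma smooth_on_prod:
  fixes f :: "'i \<Rightarrow> 'a::euclidean_space \<Rightarrow> 'b::{real_normed_algebra,comm_ring_1}"
  shows "open S \<Longrightarrow> (\<And>i. i \<in> I \<Longrightarrow> smooth_on S (f i)) \<Longrightarrow> smooth_on S (\<lambda>x. \<Prod>i\<in>I. f i x)"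
  by (simp add: smooth_on_def Ck_on_prod)
lemma smooth_on_power:
  fixes f :: "'a::euclidean_space \<Rightarrow> 'b::{real_normed_algebra,comm_ring_1}"
  shows "open S \<Longrightarrow> smooth_on S f \<Longrightarrow> smooth_on S (\<lambda>x. f x ^ m)"
  by (simp add: smooth_on_def Ck_on_power)
lemma smooth_on_divide:
  fixes f :: "'a::euclidean_space \<Rightarrow> 'b::real_normed_field"
  shows "open S \<Longrightarrow> smooth_on S f \<Longrightarrow> smooth_on S g \<Longrightarrow> (\<And>x. x \<in> S \<Longrightarrow> g x \<noteq> 0) \<Longrightarrow> smooth_on S (\<lambda>x. f x / g x)"
  by (simp add: smooth_on_def Ck_on_divide)
lemma smooth_on_exp:
  fixes f :: "'a::euclidean_space \<Rightarrow> complex"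
  shows "open S \<Longrightarrow> smooth_on S f \<Longrightarrow> smooth_on S (\<lambda>x. exp (f x))"
  by (simp add: smooth_on_def Ck_on_exp)
lemma smooth_on_linear: "bounded_linear f \<Longrightarrow> open S \<Longrightarrow> smooth_on S f"
  by (simp add: smooth_on_def Ck_on_linear)
lemma smooth_on_bounded_linear: "bounded_linear L \<Longrightarrow> open S \<Longrightarrow> smooth_on S f \<Longrightarrow> smooth_on S (\<lambda>x. L (f x))"
  by (simp add: smooth_on_def Ck_on_bounded_linear)
lemma smooth_on_compose:
  fixes h :: "real \<Rightarrow> 'b::real_normed_vector" and q :: "'a::euclidean_space \<Rightarrow> real"
  shows "open S \<Longrightarrow> q ` S \<subseteq> T \<Longrightarrow> smooth_on S q \<Longrightarrow> smooth_on T h \<Longrightarrow> smooth_on S (\<lambda>x. h (q x))"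
  using Ck_on_compose unfolding smooth_on_def by blast
lemma smooth_on_cong: "open S \<Longrightarrow> (\<And>x. x \<in> S \<Longrightarrow> f x = g x) \<Longrightarrow> smooth_on S f \<longleftrightarrow> smooth_on S g"
  unfolding smooth_on_def using Ck_on_cong by blast
lemma smooth_on_subset: "smooth_on S f \<Longrightarrow> T \<subseteq> S \<Longrightarrow> smooth_on T f"
  unfolding smooth_on_def using Ck_on_subset by blast
lemma smooth_on_Un: "smooth_on S f \<Longrightarrow> smooth_on T f \<Longrightarrow> smooth_on (S \<union> T) f"
  unfolding smooth_on_def using Ck_on_Un by blast
lemma smooth_on_id: "open S \<Longrightarrow> smooth_on S (\<lambda>x. x)"
  by (simp add: smooth_on_linear)

lemma smooth_on_differentiable: "smooth_on S f \<Longrightarrow> x \<in> S \<Longrightarrow> f differentiable (at x)"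
  using smooth_onD[of S f "Suc 0"] by simp

lemma smooth_on_frechet: 
  assumes "smooth_on S f" "b \<in> Basis" shows "smooth_on S (\<lambda>x. frechet_derivative f (at x) b)"
  unfolding smooth_on_def
proof
  fix n show "Ck_on n S (\<lambda>x. frechet_derivative f (at x) b)"
    using smooth_onD[OF assms(1), of "Suc n"] assms(2) by simp
qed

lemma smooth_on_real_derivI:
  fixes f :: "real \<Rightarrow> 'b::real_normed_vector"
  assumes "open S" "\<And>x. x \<in> S \<Longrightarrow> (f has_vector_derivative f' x) (at x)" "smooth_on S f'"
  shows "smooth_on S f"
  unfolding smooth_on_def
proof
  fix n show "Ck_on n S f"
    using Ck_on_real_SucI[OF assms(1,2) smooth_onD[OF assms(3)], THEN Ck_on_SucD] by blast
qed

lemma smooth_on_continuous_on: "smooth_on S f \<Longrightarrow> continuous_on S f"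
  by (intro continuous_at_imp_continuous_on ballI differentiable_imp_continuous_within smooth_on_differentiable)

lemma smooth_on_vector_derivative:
  fixes f :: "real \<Rightarrow> 'b::real_normed_vector"
  assumes "smooth_on S f" "open S"
  shows "smooth_on S (\<lambda>x. vector_derivative f (at x))"
    and "x \<in> S \<Longrightarrow> (f has_vector_derivative vector_derivative f (at x)) (at x)"
proof -
  show d: "x \<in> S \<Longrightarrow> (f has_vector_derivative vector_derivative f (at x)) (at x)" for x
    by (rule vector_derivative_works[THEN iffD1, OF smooth_on_differentiable[OF assms(1)]])
  have e: "vector_derivative f (at x) = frechet_derivative f (at x) 1" if "x \<in> S" for x
    by (simp add: frechet_derivative_eq_vector_derivative[OF smooth_on_differentiable[OF assms(1) that]])
  have "smooth_on S (\<lambda>x. frechet_derivative f (at x) 1)"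
    using smooth_on_frechet[OF assms(1), of 1] by simp
  then show "smooth_on S (\<lambda>x. vector_derivative f (at x))"
    by (rule smooth_on_cong[OF assms(2), THEN iffD1, rotated]) (rule e[symmetric])
qed

section \<open>A flat function and smooth cutoffs\<close>

lemma power_le_fact_exp: "0 \<le> (u::real) \<Longrightarrow> u ^ n \<le> fact n * exp u"
proof -
  assume u: "0 \<le> u"
  have "(\<Sum>i\<in>{n}. inverse (fact i) * u ^ i) \<le> (\<Sum>i. inverse (fact i) * u ^ i)"
    by (rule sum_le_suminf[OF summable_exp]) (use u in auto)
  then have "inverse (fact n) * u ^ n \<le> exp u" by (simp add: exp_def)
  then show ?thesis by (simp add: field_simps)
qed

text \<open>With the extra power \<open>m\<close> the family is closed under differentiation up to
  linear combinations, so one induction proves all members smooth; cutoffs and bumps are built from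
  \<open>m = 0\<close>.\<close>

definition flat :: "nat \<Rightarrow> real \<Rightarrow> real" where
  "flat m t = (if t \<le> 0 then 0 else exp (- inverse t) * inverse t ^ m)"

text \<open>From \<open>u^(m+2) \<le> (m+2)! e^u\<close> at \<open>u = 1/t\<close>. The two surplus
  powers are there because the difference quotient at 0 must tend to 0.\<close>

lemma flat_bound: "\<bar>flat m t\<bar> \<le> fact (m + 2) * t ^ 2"
proof (cases "t \<le> 0")
  case False
  have "inverse t ^ m * inverse t ^ 2 \<le> fact (m + 2) * exp (inverse t)"
    using power_le_fact_exp[of "inverse t" "m + 2"] False by (simp only: power_add) simp
  then have "inverse t ^ m \<le> fact (m + 2) * exp (inverse t) * t ^ 2"
    using False by (simp add: field_simps)
  then show ?thesis using False by (simp add: flat_def exp_minus field_simps)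
qed (simp add: flat_def)

lemma flat_deriv: "(flat m has_real_derivative flat (m + 2) t - real m * flat (m + 1) t) (at t)"
proof -
  consider "t < 0" | "t = 0" | "t > 0" by linarith
  then show ?thesis
  proof cases
    case 1
    have "((\<lambda>t. 0::real) has_real_derivative 0) (at t)" by simp
    then have "(flat m has_real_derivative 0) (at t)"
      by (rule has_field_derivative_transform_within_open[of _ _ _ "{..<0}"]) (use 1 in \<open>auto simp: flat_def\<close>)
    then show ?thesis using 1 by (simp add: flat_def)
  next
    case 2
    have "((\<lambda>h. flat m h / h) \<longlongrightarrow> 0) (at 0)"
    proof (rule Lim_null_comparison)
      show "\<forall>\<^sub>F h in at 0. norm (flat m h / h) \<le> fact (m + 2) * \<bar>h\<bar>"
      proof (rule eventually_at_filter[THEN iffD2], rule always_eventually, safe)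
        fix h :: real assume "h \<noteq> 0"
        have "\<bar>flat m h\<bar> / \<bar>h\<bar> \<le> fact (m + 2) * h^2 / \<bar>h\<bar>"
          by (rule divide_right_mono[OF flat_bound]) auto
        also have "\<dots> = fact (m + 2) * \<bar>h\<bar>"
        proof -
          have "h^2 = \<bar>h\<bar> * \<bar>h\<bar>" by (simp add: power2_eq_square)
          then show ?thesis using \<open>h \<noteq> 0\<close> by (simp del: abs_mult_self_eq)
        qed
        finally show "norm (flat m h / h) \<le> fact (m + 2) * \<bar>h\<bar>" by simp
      qed
      show "((\<lambda>h. fact (m + 2) * \<bar>h\<bar>) \<longlongrightarrow> (0::real)) (at 0)"
        by (auto intro!: tendsto_eq_intros)
    qed
    then show ?thesis unfolding has_field_derivative_iff using 2 by (simp add: flat_def)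
  next
    case 3
    have "((\<lambda>t. exp (- inverse t) * inverse t ^ m) has_real_derivative
       exp (- inverse t) * inverse t ^ (m+2) - real m * (exp (- inverse t) * inverse t ^ (m+1))) (at t)"
    proof -
      have i: "(inverse has_real_derivative - (inverse t ^ 2)) (at t)"
        using DERIV_inverse[of t UNIV] 3 by (simp add: numeral_2_eq_2)
      have "((\<lambda>t. exp (- inverse t)) has_real_derivative exp (- inverse t) * inverse t ^ 2) (at t)"
        using DERIV_fun_exp[OF DERIV_minus[OF i]] by simp
      from DERIV_mult[OF this DERIV_power[OF i, of m]] show ?thesis
        by (rule DERIV_cong) (cases m; simp add: algebra_simps power2_eq_square)
    qed
    then have "(flat m has_real_derivative
       exp (- inverse t) * inverse t ^ (m+2) - real m * (exp (- inverse t) * inverse t ^ (m+1))) (at t)"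
      by (rule has_field_derivative_transform_within_open[of _ _ _ "{0<..}"]) (use 3 in \<open>auto simp: flat_def\<close>)
    then show ?thesis using 3 by (simp add: flat_def)
  qed
qed

lemma smooth_flat: "smooth_on UNIV (flat m)"
  unfolding smooth_on_def
proof
  fix n show "Ck_on n UNIV (flat m)"
  proof (induction n arbitrary: m)
    case (Suc n)
    show ?case
      by (rule Ck_on_real_SucI[where f'="\<lambda>t. flat (m + 2) t - real m * flat (m + 1) t"])
         (auto intro!: Ck_on_diff Ck_on_mult Suc flat_deriv[unfolded has_real_derivative_iff_has_vector_derivative]
             simp del: add_2_eq_Suc' One_nat_def add_Suc_right)
  qed auto
qed

text \<open>The denominator of the quotient never vanishes: every \<open>t\<close> satisfies
  \<open>t > a\<close> or \<open>t < b\<close>, and \<open>flat 0\<close> is nonnegative.\<close>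

lemma smooth_cutoff:
  assumes "a < b"
  obtains \<eta> :: "real \<Rightarrow> real" where "smooth_on UNIV \<eta>" "\<And>t. t \<le> a \<Longrightarrow> \<eta> t = 0" "\<And>t. t \<ge> b \<Longrightarrow> \<eta> t = 1"
proof
  let ?\<eta> = "\<lambda>t. flat 0 (t - a) / (flat 0 (t - a) + flat 0 (b - t))"
  have nz: "flat 0 (t - a) + flat 0 (b - t) \<noteq> 0" for t
  proof -
    have nn: "flat 0 u \<ge> 0" and pos: "u > 0 \<Longrightarrow> flat 0 u > 0" for u
      by (simp_all add: flat_def)
    have "flat 0 (t - a) > 0 \<or> flat 0 (b - t) > 0"
      using assms pos[of "t - a"] pos[of "b - t"] by linarith
    then have "flat 0 (t - a) + flat 0 (b - t) > 0"
      using nn[of "t - a"] nn[of "b - t"] by linarith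
    then show ?thesis by simp
  qed
  show "smooth_on UNIV ?\<eta>"
  proof -
    have "smooth_on UNIV (\<lambda>t. flat 0 (q t))" if "smooth_on UNIV q" for q :: "real \<Rightarrow> real"
      by (rule smooth_on_compose[OF _ _ that smooth_flat]) auto
    then have "smooth_on UNIV (\<lambda>t. flat 0 (t - a))" "smooth_on UNIV (\<lambda>t. flat 0 (b - t))"
      by (auto intro!: smooth_on_diff smooth_on_id)
    then show ?thesis by (intro smooth_on_divide smooth_on_add nz) auto
  qed
  show "?\<eta> t = 0" if "t \<le> a" for t using that by (simp add: flat_def)
  show "?\<eta> t = 1" if "t \<ge> b" for t using that nz[of t] assms by (simp add: flat_def)
qed

section \<open>Partial derivatives of scalar functions\<close>

definition pd :: "3 \<Rightarrow> (real^3 \<Rightarrow> complex) \<Rightarrow> real^3 \<Rightarrow> complex" where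
  "pd j f x = frechet_derivative f (at x) (axis j 1)"

lemma pd_eqI: "(f has_derivative D) (at x) \<Longrightarrow> pd j f x = D (axis j 1)"
  unfolding pd_def using frechet_derivative_at by metis

lemma axis_Basis3: "axis (j::3) (1::real) \<in> Basis"
  by (simp add: axis_in_Basis_iff)

lemma smooth_on_pd: "smooth_on S f \<Longrightarrow> smooth_on S (pd j f)"
  unfolding pd_def[abs_def] by (rule smooth_on_frechet[OF _ axis_Basis3])

lemma smooth_frechet_works:
  "smooth_on UNIV f \<Longrightarrow> (f has_derivative frechet_derivative f (at x)) (at x)"
  using smooth_on_differentiable[of UNIV f x] frechet_derivative_works by blast

lemma pd_mult:
  assumes "smooth_on UNIV f" "smooth_on UNIV g"
  shows "pd j (\<lambda>x. f x * g x) = (\<lambda>x. f x * pd j g x + pd j f x * g x)"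
  using pd_eqI[OF has_derivative_mult[OF assms[THEN smooth_frechet_works]]] by (auto simp: pd_def)

lemma pd_add:
  assumes "smooth_on UNIV f" "smooth_on UNIV g"
  shows "pd j (\<lambda>x. f x + g x) = (\<lambda>x. pd j f x + pd j g x)"
  using pd_eqI[OF has_derivative_add[OF assms[THEN smooth_frechet_works]]] by (auto simp: pd_def)

lemma pd_cmult:
  assumes "smooth_on UNIV f"
  shows "pd j (\<lambda>x. c * f x) = (\<lambda>x. c * pd j f x)"
  using pd_eqI[OF has_derivative_mult_right[OF smooth_frechet_works[OF assms]]] by (auto simp: pd_def)

lemma pd_eq0_outside:
  assumes "open S" "\<And>x. x \<in> S \<Longrightarrow> f x = 0" "x \<in> S" shows "pd j f x = 0"
proof -
  have "((\<lambda>_. 0) has_derivative (\<lambda>_. 0)) (at x)" by simp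
  then have "(f has_derivative (\<lambda>_. 0)) (at x)"
    by (rule has_derivative_transform_within_open[OF _ assms(1,3)]) (use assms(2) in auto)
  from pd_eqI[OF this] show ?thesis by simp
qed

text \<open>A compact witness \<open>K\<close> replaces the closure of the nonzero set: it serves
  unchanged for derivatives and products.\<close>

definition test_fn :: "(real^3) set \<Rightarrow> (real^3 \<Rightarrow> complex) \<Rightarrow> bool" where
  "test_fn U f \<longleftrightarrow> smooth_on UNIV f \<and> (\<exists>K. compact K \<and> K \<subseteq> U \<and> (\<forall>x. x \<notin> K \<longrightarrow> f x = 0))"

section \<open>Symmetry of second derivatives\<close>

lemma has_real_derivative_along_line:
  fixes f :: "'a::euclidean_space \<Rightarrow> real"
  assumes "smooth_on UNIV f"
  shows "((\<lambda>s. f (a + s *\<^sub>R u)) has_real_derivative frechet_derivative f (at (a + s *\<^sub>R u)) u) (at s)"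
proof -
  have F: "(f has_derivative frechet_derivative f (at (a + s *\<^sub>R u))) (at (a + s *\<^sub>R u))"
    using smooth_on_differentiable[OF assms] frechet_derivative_works by blast
  have "((\<lambda>s. a + s *\<^sub>R u) has_derivative (\<lambda>t. t *\<^sub>R u)) (at s)"
    by (auto intro!: derivative_eq_intros)
  from diff_chain_at[OF this F] have
    "((\<lambda>s. f (a + s *\<^sub>R u)) has_derivative (\<lambda>t. frechet_derivative f (at (a + s *\<^sub>R u)) (t *\<^sub>R u))) (at s)"
    by (simp add: o_def)
  moreover have "frechet_derivative f (at (a + s *\<^sub>R u)) (t *\<^sub>R u)
      = frechet_derivative f (at (a + s *\<^sub>R u)) u * t" for t
    using linear.scaleR[OF has_derivative_linear[OF F], of t u] by simp
  ultimately show ?thesis by (simp add: has_field_derivative_def)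
qed

text \<open>The mean value theorem is applied twice: along \<open>u\<close> to the difference of
  \<open>f\<close> based at \<open>x + h v\<close> and at \<open>x\<close>, then along
  \<open>v\<close> to the resulting \<open>u\<close>-derivative. The second difference itself is
  symmetric in \<open>u\<close> and \<open>v\<close>, which is the point.\<close>

lemma second_difference_mvt:
  fixes f :: "'a::euclidean_space \<Rightarrow> real"
  assumes f: "smooth_on UNIV f" and u: "u \<in> Basis" and h: "h > 0"
  shows "\<exists>\<xi> \<eta>. 0 < \<xi> \<and> \<xi> < h \<and> 0 < \<eta> \<and> \<eta> < h \<and>
    f (x + h *\<^sub>R u + h *\<^sub>R v) - f (x + h *\<^sub>R u) - f (x + h *\<^sub>R v) + f x =
    h^2 * frechet_derivative (\<lambda>x. frechet_derivative f (at x) u) (at (x + \<xi> *\<^sub>R u + \<eta> *\<^sub>R v)) v"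
proof -
  let ?D = "\<lambda>x. frechet_derivative f (at x) u"
  let ?\<phi> = "\<lambda>s. f ((x + h *\<^sub>R v) + s *\<^sub>R u) - f (x + s *\<^sub>R u)"
  have "\<And>s. (?\<phi> has_real_derivative ?D ((x + h *\<^sub>R v) + s *\<^sub>R u) - ?D (x + s *\<^sub>R u)) (at s)"
    by (rule DERIV_diff; rule has_real_derivative_along_line[OF f])
  from MVT2[OF h this] obtain \<xi> where \<xi>: "0 < \<xi>" "\<xi> < h"
    "?\<phi> h - ?\<phi> 0 = h * (?D ((x + h *\<^sub>R v) + \<xi> *\<^sub>R u) - ?D (x + \<xi> *\<^sub>R u))" by auto
  have "\<And>t. ((\<lambda>t. ?D ((x + \<xi> *\<^sub>R u) + t *\<^sub>R v)) has_real_derivative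
      frechet_derivative ?D (at ((x + \<xi> *\<^sub>R u) + t *\<^sub>R v)) v) (at t)"
    by (rule has_real_derivative_along_line[OF smooth_on_frechet[OF f u]])
  from MVT2[OF h this] obtain \<eta> where \<eta>: "0 < \<eta>" "\<eta> < h"
    "?D ((x + \<xi> *\<^sub>R u) + h *\<^sub>R v) - ?D ((x + \<xi> *\<^sub>R u) + 0 *\<^sub>R v)
      = h * frechet_derivative ?D (at ((x + \<xi> *\<^sub>R u) + \<eta> *\<^sub>R v)) v" by auto
  have eqs: "x + h *\<^sub>R v + \<xi> *\<^sub>R u = x + \<xi> *\<^sub>R u + h *\<^sub>R v" "x + h *\<^sub>R v + h *\<^sub>R u = x + h *\<^sub>R u + h *\<^sub>R v"
    by (simp_all add: add_ac)
  have "f (x + h *\<^sub>R u + h *\<^sub>R v) - f (x + h *\<^sub>R u) - f (x + h *\<^sub>R v) + f x =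
    h^2 * frechet_derivative ?D (at (x + \<xi> *\<^sub>R u + \<eta> *\<^sub>R v)) v"
    using \<xi>(3)[unfolded eqs] \<eta>(3) by (simp add: power2_eq_square)
  with \<xi> \<eta> show ?thesis by blast
qed

text \<open>The quotient \<open>q u v\<close> is symmetric in its directions and tends to the mixed
  derivative in either order, by continuity of that derivative.\<close>

lemma second_derivative_symmetric:
  fixes f :: "'a::euclidean_space \<Rightarrow> real"
  assumes f: "smooth_on UNIV f" and u: "u \<in> Basis" and v: "v \<in> Basis"
  shows "frechet_derivative (\<lambda>x. frechet_derivative f (at x) u) (at x) v
       = frechet_derivative (\<lambda>x. frechet_derivative f (at x) v) (at x) u"
proof -
  let ?D = "\<lambda>u v x. frechet_derivative (\<lambda>x. frechet_derivative f (at x) u) (at x) v"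
  define q where "q u v = (\<lambda>n. (let h = inverse (real (Suc n)) in
    (f (x + h *\<^sub>R u + h *\<^sub>R v) - f (x + h *\<^sub>R u) - f (x + h *\<^sub>R v) + f x) / h^2))" for u v
  have lim: "q u v \<longlonglongrightarrow> ?D u v x" if u: "u \<in> Basis" and v: "v \<in> Basis" for u v
  proof -
    have "\<forall>n. \<exists>\<xi> \<eta>. 0 < \<xi> \<and> \<xi> < inverse (real (Suc n)) \<and> 0 < \<eta> \<and> \<eta> < inverse (real (Suc n)) \<and>
        q u v n = ?D u v (x + \<xi> *\<^sub>R u + \<eta> *\<^sub>R v)"
    proof
      fix n
      have "inverse (real (Suc n)) > 0" by simp
      from second_difference_mvt[OF f u this, of x v]
      show "\<exists>\<xi> \<eta>. 0 < \<xi> \<and> \<xi> < inverse (real (Suc n)) \<and> 0 < \<eta> \<and> \<eta> < inverse (real (Suc n)) \<and>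
        q u v n = ?D u v (x + \<xi> *\<^sub>R u + \<eta> *\<^sub>R v)"
        unfolding q_def Let_def by (metis (no_types, lifting) \<open>inverse (real (Suc n)) > 0\<close>
            less_numeral_extra(3) nonzero_mult_div_cancel_left power_not_zero)
    qed
    then obtain \<xi> \<eta> where xe: "\<And>n. 0 < \<xi> n" "\<And>n. \<xi> n < inverse (real (Suc n))" "\<And>n. 0 < \<eta> n"
      "\<And>n. \<eta> n < inverse (real (Suc n))" "\<And>n. q u v n = ?D u v (x + \<xi> n *\<^sub>R u + \<eta> n *\<^sub>R v)" by metis
    have l: "\<xi> \<longlonglongrightarrow> 0" "\<eta> \<longlonglongrightarrow> 0"
      by (rule tendsto_sandwich[OF _ _ tendsto_const LIMSEQ_inverse_real_of_nat];
          use xe in \<open>simp add: less_imp_le del: of_nat_Suc\<close>)+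
    have "(\<lambda>n. x + \<xi> n *\<^sub>R u + \<eta> n *\<^sub>R v) \<longlonglongrightarrow> x + 0 *\<^sub>R u + 0 *\<^sub>R v"
      by (intro tendsto_intros l)
    then have "(\<lambda>n. x + \<xi> n *\<^sub>R u + \<eta> n *\<^sub>R v) \<longlonglongrightarrow> x" by simp
    moreover have "isCont (?D u v) x"
      using smooth_on_continuous_on[OF smooth_on_frechet[OF smooth_on_frechet[OF f u] v]]
      by (simp add: continuous_on_eq_continuous_at)
    ultimately have "(\<lambda>n. ?D u v (x + \<xi> n *\<^sub>R u + \<eta> n *\<^sub>R v)) \<longlonglongrightarrow> ?D u v x"
      by (rule isCont_tendsto_compose[rotated])
    then show ?thesis by (simp add: xe(5)[symmetric])
  qed
  have "q v u = q u v" by (simp add: q_def Let_def add_ac diff_add_eq fun_eq_iff algebra_simps)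
  then show ?thesis using LIMSEQ_unique lim[OF u v] lim[OF v u] by metis
qed

text \<open>The mean value argument is real, so real and imaginary parts are treated separately,
  through a bounded linear \<open>L\<close>.\<close>

lemma pd_commute:
  assumes f: "smooth_on UNIV f" shows "pd i (pd j f) x = pd j (pd i f) x"
proof -
  have L: "L (pd i (pd j f) x) = L (pd j (pd i f) x)" if L: "bounded_linear L" for L :: "complex \<Rightarrow> real"
  proof -
    have c: "L (pd j g x) = frechet_derivative (\<lambda>x. L (g x)) (at x) (axis j 1)"
      if "smooth_on UNIV g" for g j x
      using frechet_derivative_at[OF bounded_linear.has_derivative[OF L smooth_frechet_works[OF that]]]
      by (simp add: pd_def fun_eq_iff)
    have "smooth_on UNIV (\<lambda>x. L (f x))" by (rule smooth_on_bounded_linear[OF L _ f]) simp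
    from second_derivative_symmetric[OF this axis_Basis3 axis_Basis3, of j x i]
    show ?thesis by (simp add: c f smooth_on_pd)
  qed
  show ?thesis using L[OF bounded_linear_Re] L[OF bounded_linear_Im] by (simp add: complex_eq_iff)
qed

section \<open>Test functions and weak curls\<close>

lemma test_fn_subset: "test_fn U f \<Longrightarrow> U \<subseteq> V \<Longrightarrow> test_fn V f"
  unfolding test_fn_def by blast

lemma test_fn_pd:
  assumes "test_fn U f" shows "test_fn U (pd j f)"
proof -
  obtain K where K: "smooth_on UNIV f" "compact K" "K \<subseteq> U" "\<And>x. x \<notin> K \<Longrightarrow> f x = 0"
    using assms by (auto simp: test_fn_def)
  have "pd j f x = 0" if "x \<notin> K" for x
    by (rule pd_eq0_outside[of "-K"]) (use K that compact_imp_closed in auto)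
  then show ?thesis using K by (auto simp: test_fn_def smooth_on_pd intro!: exI[of _ K])
qed

lemma test_fn_continuous: "test_fn U f \<Longrightarrow> continuous_on UNIV f"
  by (auto simp: test_fn_def intro: smooth_on_continuous_on)

lemma bounded_linear_vec_scale: "bounded_linear (\<lambda>c::complex. c *s (q::complex^3))"
  unfolding linear_conv_bounded_linear[symmetric]
  by (rule linearI) (auto simp: vec_eq_iff algebra_simps)

lemma smooth_field_if_smooth_on: "smooth_on UNIV \<phi> \<Longrightarrow> smooth_field \<phi>"
proof -
  have "foldr partial_deriv is \<phi> differentiable (at x)" if "smooth_on UNIV \<phi>" for "is" x \<phi>
    using that
  proof (induction "is" arbitrary: \<phi> rule: rev_induct)
    case (snoc j js)
    have "smooth_on UNIV (partial_deriv j \<phi>)"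
      using smooth_on_frechet[OF snoc.prems axis_Basis3] by (simp add: partial_deriv_def[abs_def])
    then show ?case using snoc.IH by simp
  qed (simp add: smooth_on_differentiable)
  then show "smooth_on UNIV \<phi> \<Longrightarrow> smooth_field \<phi>" by (auto simp: smooth_field_def)
qed

lemma test_field_scale:
  assumes "test_fn U f" shows "test_field (\<lambda>x. f x *s q)"
proof -
  obtain K where K: "smooth_on UNIV f" "compact K" "K \<subseteq> U" "\<And>x. x \<notin> K \<Longrightarrow> f x = 0"
    using assms by (auto simp: test_fn_def)
  have "closure {x. f x *s q \<noteq> 0} \<subseteq> K"
    using K(4) by (intro closure_minimal compact_imp_closed[OF K(2)]) (auto simp: vec_eq_iff)
  then have "compact (closure {x. f x *s q \<noteq> 0})"
    using compact_Int_closed[OF K(2) closed_closure] by (metis inf.absorb_iff2 )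
  moreover have "smooth_on UNIV (\<lambda>x. f x *s q)"
    by (rule smooth_on_bounded_linear[OF bounded_linear_vec_scale]) (use K in auto)
  ultimately show ?thesis by (auto simp: test_field_def smooth_field_if_smooth_on)
qed

lemma classical_curl_scale:
  assumes "smooth_on UNIV f"
  shows "classical_curl (\<lambda>x. f x *s q) x = cross3_complex (\<chi> j. pd j f x) q"
proof -
  have "partial_deriv j (\<lambda>x. f x *s q) x = pd j f x *s q" for j
  proof -
    have "((\<lambda>x. f x *s q) has_derivative (\<lambda>v. frechet_derivative f (at x) v *s q)) (at x)"
      by (rule bounded_linear.has_derivative[OF bounded_linear_vec_scale smooth_frechet_works[OF assms]])
    from frechet_derivative_at[OF this, symmetric] show ?thesis
      by (simp add: partial_deriv_def pd_def)
  qed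
  then show ?thesis by (simp add: classical_curl_def cross3_complex_def mult_ac)
qed

text \<open>Test fields of constant direction \<open>q\<close> suffice throughout: the curl of
  \<open>f q\<close> is the cross product of the gradient of \<open>f\<close> with \<open>q\<close>,
  and Maxwell's equations become identities about scalar test functions.\<close>

lemma weak_curl_scale:
  assumes "has_weak_curl U F" "test_fn V f"
  shows "(LINT x|lebesgue. dot_complex (U x) (cross3_complex (\<chi> j. pd j f x) q)) =
         (LINT x|lebesgue. dot_complex (F x) (f x *s q))"
proof -
  have "smooth_on UNIV f" using assms(2) by (simp add: test_fn_def)
  then show ?thesis
    using assms(1)[unfolded has_weak_curl_def, rule_format, OF test_field_scale[OF assms(2), of q]]
    by (simp add: classical_curl_scale)
qed

section \<open>Local integrability of square integrable fields\<close>

definition loc_integrable :: "('a::euclidean_space \<Rightarrow> complex) \<Rightarrow> bool" where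
  "loc_integrable v \<longleftrightarrow> v \<in> borel_measurable lebesgue \<and> (\<forall>K. compact K \<longrightarrow> set_integrable lebesgue K v)"

lemma L2_loc_measurable:
  assumes "L2_loc U" shows "U \<in> borel_measurable lebesgue"
proof -
  have "(\<lambda>x. indicator (cball 0 (real n)) x *\<^sub>R U x) \<in> borel_measurable lebesgue" for n
    using assms by (auto simp: L2_loc_def L2_on_def set_borel_measurable_def)
  moreover have "(\<lambda>n. indicator (cball 0 (real n)) x *\<^sub>R U x) \<longlonglongrightarrow> U x" for x
  proof (rule tendsto_eventually)
    obtain N where "norm x \<le> real N" using real_arch_simple by blast
    then have "\<And>n. n \<ge> N \<Longrightarrow> indicator (cball 0 (real n)) x *\<^sub>R U x = U x"
      by (auto simp: indicator_def)
    then show "\<forall>\<^sub>F n in sequentially. indicator (cball 0 (real n)) x *\<^sub>R U x = U x"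
      by (rule eventually_sequentiallyI)
  qed
  ultimately show ?thesis by (rule borel_measurable_LIMSEQ_metric)
qed

text \<open>On a compact set constants are integrable, and
  \<open>|u| \<le> 1 + |u|^2\<close>.\<close>

lemma L2_loc_nth:
  assumes "L2_loc U" shows "loc_integrable (\<lambda>x. U x $ j)"
proof -
  have m: "U \<in> borel_measurable lebesgue" by (rule L2_loc_measurable[OF assms])
  have mj: "(\<lambda>x. U x $ j) \<in> borel_measurable lebesgue"
    by (rule measurable_compose[OF m]) (intro borel_measurable_continuous_onI continuous_intros)
  have "set_integrable lebesgue K (\<lambda>x. U x $ j)" if K: "compact K" for K
  proof -
    have "set_integrable lebesgue K (\<lambda>x. (norm (U x))\<^sup>2)"
      using assms K by (auto simp: L2_loc_def L2_on_def)
    moreover have "set_integrable lebesgue K (\<lambda>x. 1::real)"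
      using lmeasurable_compact[OF K] by (auto simp: set_integrable_def fmeasurable_def intro!: integrable_real_indicator)
    ultimately have "set_integrable lebesgue K (\<lambda>x. 1 + (norm (U x))\<^sup>2)"
      by (intro set_integral_add)
    then show ?thesis unfolding set_integrable_def
    proof (rule Bochner_Integration.integrable_bound)
      show "(\<lambda>x. indicator K x *\<^sub>R U x $ j) \<in> borel_measurable lebesgue"
        using mj lmeasurable_compact[OF K] by (intro borel_measurable_scaleR borel_measurable_indicator) auto
      have "norm (U x $ j) \<le> 1 + (norm (U x))\<^sup>2" for x
      proof -
        have "norm (U x $ j) \<le> norm (U x)" by (rule Finite_Cartesian_Product.norm_nth_le)
        also have "\<dots> \<le> 1 + (norm (U x))\<^sup>2" using zero_le_power2[of "norm (U x) - 1/2"]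
          by (simp add: power2_eq_square algebra_simps)
        finally show ?thesis .
      qed
      then show "AE x in lebesgue. norm (indicator K x *\<^sub>R U x $ j)
           \<le> norm (indicator K x *\<^sub>R (1 + (norm (U x))\<^sup>2))"
        by (auto simp: indicator_def)
    qed
  qed
  with mj show ?thesis by (simp add: loc_integrable_def)
qed

lemma loc_integrable_mult:
  assumes "loc_integrable v" "continuous_on UNIV g" "compact K" "\<And>x. x \<notin> K \<Longrightarrow> g x = 0"
  shows "integrable lebesgue (\<lambda>x. v x * g x)"
proof -
  have "compact (g ` K)"
    by (rule compact_continuous_image[OF continuous_on_subset[OF assms(2)] assms(3)]) simp
  then have "\<exists>B. \<forall>x\<in>K. norm (g x) \<le> B" by (auto dest!: compact_imp_bounded simp: bounded_iff)
  then obtain B where B: "\<And>x. x \<in> K \<Longrightarrow> norm (g x) \<le> B" by blast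
  have "integrable lebesgue (\<lambda>x. B *\<^sub>R (indicator K x *\<^sub>R v x))"
    using assms(1,3) by (intro integrable_scaleR_right) (simp add: loc_integrable_def set_integrable_def)
  then show ?thesis
  proof (rule Bochner_Integration.integrable_bound)
    have "g \<in> borel_measurable lebesgue"
      using assms(2) by (intro measurable_completion) (simp add: borel_measurable_continuous_onI)
    then show "(\<lambda>x. v x * g x) \<in> borel_measurable lebesgue"
      using assms(1) by (intro borel_measurable_times) (simp_all add: loc_integrable_def)
    have "norm (v x * g x) \<le> norm (B *\<^sub>R (indicator K x *\<^sub>R v x))" for x
    proof (cases "x \<in> K")
      case True
      then have "norm (v x) * norm (g x) \<le> norm (v x) * B" using B by (intro mult_left_mono) auto
      moreover have "B \<ge> 0" using B[OF True] norm_ge_zero order_trans by blast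
      ultimately show ?thesis using True by (simp add: norm_mult mult.commute)
    qed (use assms in auto)
    then show "AE x in lebesgue. norm (v x * g x) \<le> norm (B *\<^sub>R (indicator K x *\<^sub>R v x))" by simp
  qed
qed

lemma loc_integrable_test:
  assumes "loc_integrable v" "test_fn U f" shows "integrable lebesgue (\<lambda>x. v x * f x)"
  using assms loc_integrable_mult test_fn_continuous[OF assms(2)] by (auto simp: test_fn_def)

section \<open>From Maxwell to Helmholtz\<close>

text \<open>The distributional form of \<open>curl curl = grad div - Laplacian\<close>. With
  \<open>I j\<close> and \<open>K j\<close> the components of \<open>E\<close> and \<open>H\<close>
  as functionals on test functions, the curl equations are linear relations, and the claim is
  algebra once \<open>E\<close> is known to be divergence free.\<close>

lemma maxwell_helmholtz:
  fixes E H :: "real^3 \<Rightarrow> complex^3" and \<alpha> \<beta> :: complex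
  assumes E: "\<And>j. loc_integrable (\<lambda>x. E x $ j)" and H: "\<And>j. loc_integrable (\<lambda>x. H x $ j)"
    and mE: "\<And>f q. test_fn U f \<Longrightarrow> (LINT x|lebesgue. dot_complex (E x) (cross3_complex (\<chi> j. pd j f x) q))
        = \<alpha> * (LINT x|lebesgue. dot_complex (H x) (f x *s q))"
    and mH: "\<And>f q. test_fn U f \<Longrightarrow> (LINT x|lebesgue. dot_complex (H x) (cross3_complex (\<chi> j. pd j f x) q))
        = \<beta> * (LINT x|lebesgue. dot_complex (E x) (f x *s q))"
    and nz: "\<alpha> \<noteq> 0" "\<beta> \<noteq> 0" and f: "test_fn U f"
  shows "(LINT x|lebesgue. E x $ i * ((\<Sum>j\<in>UNIV. pd j (pd j f) x) + \<alpha> * \<beta> * f x)) = 0"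
proof -
  define I where "I j g = (LINT x|lebesgue. E x $ j * g x)" for j g
  define K where "K j g = (LINT x|lebesgue. H x $ j * g x)" for j g
  note td = test_fn_pd
  have iE: "integrable lebesgue (\<lambda>x. E x $ j * g x)" if "test_fn U g" for j g
    by (rule loc_integrable_test[OF E that])
  have iH: "integrable lebesgue (\<lambda>x. H x $ j * g x)" if "test_fn U g" for j g
    by (rule loc_integrable_test[OF H that])
  have E1: "I 2 (pd 3 g) - I 3 (pd 2 g) = \<alpha> * K 1 g" and E2: "I 3 (pd 1 g) - I 1 (pd 3 g) = \<alpha> * K 2 g"
    and E3: "I 1 (pd 2 g) - I 2 (pd 1 g) = \<alpha> * K 3 g" if g: "test_fn U g" for g
    using mE[OF g, of "axis 1 1"] mE[OF g, of "axis 2 1"] mE[OF g, of "axis 3 1"]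
    by (simp_all add: dot_complex_def cross3_complex_def sum_3 axis_def I_def K_def iE iH g td)
  have H1: "K 2 (pd 3 g) - K 3 (pd 2 g) = \<beta> * I 1 g" and H2: "K 3 (pd 1 g) - K 1 (pd 3 g) = \<beta> * I 2 g"
    and H3: "K 1 (pd 2 g) - K 2 (pd 1 g) = \<beta> * I 3 g" if g: "test_fn U g" for g
    using mH[OF g, of "axis 1 1"] mH[OF g, of "axis 2 1"] mH[OF g, of "axis 3 1"]
    by (simp_all add: dot_complex_def cross3_complex_def sum_3 axis_def I_def K_def iE iH g td)
  have comm: "pd i (pd j g) = pd j (pd i g)" if "test_fn U g" for i j g
    using pd_commute[of g i j] that by (auto simp: test_fn_def)
  \<comment> \<open>The weak form of \<open>div curl H = 0\<close>: the equations for
    \<open>H\<close> are tested with \<open>pd 1 g\<close>, \<open>pd 2 g\<close>,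
    \<open>pd 3 g\<close>, the mixed derivatives cancel in pairs, and \<open>\<beta>\<close> is
    nonzero.\<close>
  have div: "I 1 (pd 1 g) + I 2 (pd 2 g) + I 3 (pd 3 g) = 0" if g: "test_fn U g" for g
  proof -
    have "\<beta> * (I 1 (pd 1 g) + I 2 (pd 2 g) + I 3 (pd 3 g)) = 0"
      using H1[OF td[OF g, of 1]] H2[OF td[OF g, of 2]] H3[OF td[OF g, of 3]]
      unfolding comm[OF g, of 2 1] comm[OF g, of 3 1] comm[OF g, of 3 2] by algebra
    then show ?thesis using nz by simp
  qed
  note c = comm[OF f, of 2 1] comm[OF f, of 3 1] comm[OF f, of 3 2]
  have lap: "I i (pd 1 (pd 1 f)) + I i (pd 2 (pd 2 f)) + I i (pd 3 (pd 3 f)) + \<alpha> * \<beta> * I i f = 0" for i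
  proof -
    note e = E1[OF td[OF f]] E2[OF td[OF f]] E3[OF td[OF f]]
    consider "i = 1" | "i = 2" | "i = 3" using exhaust_3 by blast
    then show ?thesis
    proof cases
      case 1
      have "\<alpha> * \<beta> * I 1 f = \<alpha> * K 2 (pd 3 f) - \<alpha> * K 3 (pd 2 f)"
        using H1[OF f] by (simp add: algebra_simps)
      then show ?thesis using div[OF td[OF f, of 1]] unfolding 1 e[symmetric] c by algebra
    next
      case 2
      have "\<alpha> * \<beta> * I 2 f = \<alpha> * K 3 (pd 1 f) - \<alpha> * K 1 (pd 3 f)"
        using H2[OF f] by (simp add: algebra_simps)
      then show ?thesis using div[OF td[OF f, of 2]] unfolding 2 e[symmetric] c by algebra
    next
      case 3
      have "\<alpha> * \<beta> * I 3 f = \<alpha> * K 1 (pd 2 f) - \<alpha> * K 2 (pd 1 f)"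
        using H3[OF f] by (simp add: algebra_simps)
      then show ?thesis using div[OF td[OF f, of 3]] unfolding 3 e[symmetric] c by algebra
    qed
  qed
  have "(LINT x|lebesgue. E x $ i * ((\<Sum>j\<in>UNIV. pd j (pd j f) x) + \<alpha> * \<beta> * f x))
      = (LINT x|lebesgue. E x $ i * pd 1 (pd 1 f) x + E x $ i * pd 2 (pd 2 f) x
         + E x $ i * pd 3 (pd 3 f) x + \<alpha> * \<beta> * (E x $ i * f x))"
    by (simp add: sum_3 algebra_simps)
  also have "\<dots> = 0"
    using lap[of i] unfolding I_def by (simp add: iE f td)
  finally show ?thesis .
qed

section \<open>Radial moments\<close>

text \<open>A polynomial, unlike the distance itself, so that smooth functions of it are smooth also
  at the centre \<open>p\<close>.\<close>

definition sqd :: "real^3 \<Rightarrow> real^3 \<Rightarrow> real" where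
  "sqd p x = (norm (x - p))\<^sup>2"

definition monom3 :: "real^3 \<Rightarrow> (3 \<Rightarrow> nat) \<Rightarrow> real^3 \<Rightarrow> complex" where
  "monom3 p e x = (\<Prod>i\<in>UNIV. complex_of_real (x $ i - p $ i) ^ e i)"

definition vd :: "(real \<Rightarrow> complex) \<Rightarrow> real \<Rightarrow> complex" where
  "vd h s = vector_derivative h (at s)"

text \<open>The radial part of \<open>Laplacian + \<kappa>\<close> next to a homogeneous factor of
  degree \<open>d\<close>, in the variable \<open>s = |x - p|^2\<close>; \<open>6 + 4 d\<close> is
  \<open>2 (n + 2 d)\<close> in dimension \<open>n = 3\<close>. In \<open>r = sqrt s\<close>, and up
  to conjugation with \<open>r^d\<close>, it is the spherical Bessel operator.\<close>

definition bessel_op :: "complex \<Rightarrow> nat \<Rightarrow> (real \<Rightarrow> complex) \<Rightarrow> real \<Rightarrow> complex" where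
  "bessel_op \<kappa> d h s = 4 * of_real s * vd (vd h) s + (6 + 4 * of_nat d) * vd h s + \<kappa> * h s"

definition test1 :: "real set \<Rightarrow> (real \<Rightarrow> complex) \<Rightarrow> bool" where
  "test1 I h \<longleftrightarrow> smooth_on UNIV h \<and> (\<exists>K. compact K \<and> K \<subseteq> I \<and> (\<forall>s. s \<notin> K \<longrightarrow> h s = 0))"

lemma smooth_on_vd: "smooth_on S h \<Longrightarrow> open S \<Longrightarrow> smooth_on S (vd h)"
  unfolding vd_def[abs_def] by (rule smooth_on_vector_derivative)

lemma has_vd: "smooth_on S h \<Longrightarrow> open S \<Longrightarrow> x \<in> S \<Longrightarrow> (h has_vector_derivative vd h x) (at x)"
  unfolding vd_def by (rule smooth_on_vector_derivative(2))

lemma sqd_sum: "sqd p x = (\<Sum>i\<in>UNIV. (x $ i - p $ i)^2)"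
  by (simp add: sqd_def norm_vec_def L2_set_def sum_nonneg)

lemma smooth_coord_real: "smooth_on UNIV (\<lambda>x::real^3. x $ i - p $ i)"
  by (rule smooth_on_diff[OF open_UNIV smooth_on_linear[OF bounded_linear_vec_nth open_UNIV] smooth_on_const])

lemma smooth_sqd: "smooth_on UNIV (sqd p)"
  unfolding sqd_sum[abs_def]
  by (intro smooth_on_sum smooth_on_power smooth_coord_real) auto

lemma smooth_radial: "smooth_on UNIV h \<Longrightarrow> smooth_on UNIV (\<lambda>x. h (sqd p x))"
  by (rule smooth_on_compose[OF _ _ smooth_sqd]) auto

lemma smooth_coord: "smooth_on UNIV (\<lambda>x::real^3. complex_of_real (x $ i - p $ i))"
  by (rule smooth_on_bounded_linear[OF bounded_linear_of_real open_UNIV smooth_coord_real])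

lemma smooth_monom3: "smooth_on UNIV (monom3 p e)"
  unfolding monom3_def[abs_def] by (intro smooth_on_prod smooth_on_power smooth_coord) auto

lemma pd_radial:
  assumes "smooth_on UNIV h"
  shows "pd j (\<lambda>x. h (sqd p x)) = (\<lambda>x. 2 * of_real (x $ j - p $ j) * vd h (sqd p x))"
proof
  fix x
  have q: "(sqd p has_derivative (\<lambda>v. 2 * ((x - p) \<bullet> v))) (at x)"
    unfolding sqd_def[abs_def] power2_norm_eq_inner
    by (auto intro!: derivative_eq_intros simp: inner_commute)
  have h: "(h has_derivative (\<lambda>t. t *\<^sub>R vd h (sqd p x))) (at (sqd p x))"
    using has_vd[OF assms] by (simp add: has_vector_derivative_def)
  show "pd j (\<lambda>x. h (sqd p x)) x = 2 * of_real (x $ j - p $ j) * vd h (sqd p x)"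
    using pd_eqI[OF diff_chain_at[OF q h, unfolded o_def], of j]
    by (simp add: inner_axis scaleR_conv_of_real)
qed

lemma pd_coord_power: "pd j (\<lambda>x. complex_of_real (x $ i - p $ i) ^ n) x
    = (if i = j then of_nat n * complex_of_real (x $ i - p $ i) ^ (n - 1) else 0)"
proof -
  have "((\<lambda>x. complex_of_real (x $ i - p $ i)) has_derivative (\<lambda>v. of_real (v $ i))) (at x)"
  proof -
    have "((\<lambda>x. x $ i - p $ i) has_derivative (\<lambda>v. v $ i - 0)) (at x)"
      by (rule has_derivative_diff[OF bounded_linear_imp_has_derivative[OF bounded_linear_vec_nth]]) simp
    from bounded_linear.has_derivative[OF bounded_linear_of_real this] show ?thesis by simp
  qed
  from pd_eqI[OF has_derivative_power[OF this, of n], of j] show ?thesis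
    by (auto simp: axis_def)
qed

lemma pd_monom3: "pd j (monom3 p e) = (\<lambda>x. of_nat (e j) * monom3 p (e(j := e j - 1)) x)"
proof
  fix x
  have sm: "smooth_on UNIV (\<lambda>x. complex_of_real (x $ i - p $ i) ^ n)" for i n
    by (intro smooth_on_power smooth_coord) auto
  have m: "monom3 p e = (\<lambda>x. complex_of_real (x $ 1 - p $ 1) ^ e 1 *
     (complex_of_real (x $ 2 - p $ 2) ^ e 2 * complex_of_real (x $ 3 - p $ 3) ^ e 3))" for e
    unfolding monom3_def UNIV_3 by (rule ext) simp
  consider "j = 1" | "j = 2" | "j = 3" using exhaust_3 by blast
  then show "pd j (monom3 p e) x = of_nat (e j) * monom3 p (e(j := e j - 1)) x"
    unfolding m by cases (simp_all add: pd_mult sm smooth_on_mult pd_coord_power del: of_real_diff)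
qed

text \<open>Summed over \<open>j\<close> this is Euler's identity for a homogeneous polynomial. For
  \<open>e j = 0\<close> the truncated exponent is harmless, since the factor
  \<open>of_nat (e j)\<close> is zero.\<close>

lemma monom3_euler: "of_real (x $ j - p $ j) * (of_nat (e j) * monom3 p (e(j := e j - 1)) x) = of_nat (e j) * monom3 p e x"
proof (cases "e j")
  case (Suc n)
  have "monom3 p e x = of_real (x $ j - p $ j) * monom3 p (e(j := n)) x"
    unfolding monom3_def by (subst (1 2) prod.remove[of UNIV j]) (auto simp: Suc intro!: prod.cong)
  then show ?thesis by (simp add: Suc mult_ac)
qed simp

text \<open>Both derivatives falling on \<open>h\<close> give \<open>4 s h''\<close>, the Laplacian
  of \<open>sqd\<close> contributes \<open>6 h'\<close>, and the cross terms contribute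
  \<open>4 d h'\<close> by Euler's identity. Both derivatives falling on the monomial leave the
  terms of degree \<open>d - 2\<close>.\<close>

lemma laplace_monom3_radial:
  assumes h: "smooth_on UNIV h"
  shows "(\<Sum>j\<in>UNIV. pd j (pd j (\<lambda>x. monom3 p e x * h (sqd p x))) x) + \<kappa> * (monom3 p e x * h (sqd p x))
    = monom3 p e x * bessel_op \<kappa> (\<Sum>j\<in>UNIV. e j) h (sqd p x)
      + (\<Sum>j\<in>UNIV. of_nat (e j * (e j - 1)) * (monom3 p (e(j := e j - 2)) x * h (sqd p x)))"
proof -
  let ?y = "\<lambda>j x. complex_of_real (x $ j - p $ j)"
  have y1: "pd j (\<lambda>x. 2 * ?y j x) = (\<lambda>x. 2)" for j
    using pd_coord_power[of j j p 1] pd_cmult[OF smooth_coord, of j 2 j p] by (simp add: fun_eq_iff)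
  have sy: "smooth_on UNIV (\<lambda>x. 2 * ?y j x)" for j
    by (intro smooth_on_mult smooth_coord) auto
  have A: "pd j (\<lambda>x. monom3 p e x * h (sqd p x)) =
     (\<lambda>x. monom3 p e x * ((2 * ?y j x) * vd h (sqd p x)) + pd j (monom3 p e) x * h (sqd p x))" for j
    by (simp add: pd_mult smooth_monom3 smooth_radial h pd_radial)
  have B: "pd j (pd j (\<lambda>x. monom3 p e x * h (sqd p x))) x =
     monom3 p e x * ((2 * ?y j x) * (2 * ?y j x * vd (vd h) (sqd p x)) + 2 * vd h (sqd p x))
     + pd j (monom3 p e) x * ((2 * ?y j x) * vd h (sqd p x))
     + (pd j (monom3 p e) x * (2 * ?y j x * vd h (sqd p x)) + pd j (pd j (monom3 p e)) x * h (sqd p x))" for j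
    unfolding A
    by (subst pd_add, (intro smooth_on_mult smooth_monom3 smooth_radial smooth_on_vd smooth_on_pd sy h open_UNIV)+,
        subst pd_mult, (intro smooth_on_mult smooth_monom3 smooth_radial smooth_on_vd smooth_on_pd sy h open_UNIV)+,
        subst pd_mult, (intro smooth_on_mult smooth_monom3 smooth_radial smooth_on_vd smooth_on_pd sy h open_UNIV)+,
        subst pd_mult, (intro smooth_on_mult smooth_monom3 smooth_radial smooth_on_vd smooth_on_pd sy h open_UNIV)+)
       (simp only: y1 pd_radial[OF smooth_on_vd[OF h open_UNIV]] pd_radial[OF h])
  have C: "pd j (pd j (monom3 p e)) x = of_nat (e j * (e j - 1)) * monom3 p (e(j := e j - 2)) x" for j
    using pd_cmult[OF smooth_monom3, of j "of_nat (e j)" p "e(j := e j - 1)"]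
    by (simp add: pd_monom3 numeral_2_eq_2 mult_ac)
  have eu: "pd j (monom3 p e) x * (2 * ?y j x * z) = 2 * of_nat (e j) * z * monom3 p e x" for j z
  proof -
    have "pd j (monom3 p e) x * (2 * ?y j x * z)
        = 2 * z * (?y j x * (of_nat (e j) * monom3 p (e(j := e j - 1)) x))"
      unfolding pd_monom3 by (simp only: mult_ac)
    then show ?thesis unfolding monom3_euler by (simp only: mult_ac)
  qed
  have s: "complex_of_real (sqd p x) = (\<Sum>j\<in>UNIV. ?y j x * ?y j x)"
    by (simp add: sqd_sum power2_eq_square)
  show ?thesis
    unfolding B C eu bessel_op_def s by (simp add: sum_3 algebra_simps)
qed

section \<open>Radial test functions and the induction over moments\<close>

lemma compact_sqd_preimage:
  assumes "compact K" shows "compact {x. sqd p x \<in> K}"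
proof -
  obtain B where B: "\<And>s. s \<in> K \<Longrightarrow> \<bar>s\<bar> \<le> B"
    using compact_imp_bounded[OF assms] by (auto simp: bounded_iff)
  have "x \<in> cball p (max 1 B)" if "sqd p x \<in> K" for x
  proof -
    have "norm (x - p) \<le> max 1 B"
    proof (cases "norm (x - p) \<le> 1")
      case False
      then have "norm (x - p) \<le> (norm (x - p))^2" 
        using mult_right_mono[of 1 "norm (x - p)" "norm (x - p)"] by (simp add: power2_eq_square)
      then show ?thesis using B[OF that] by (simp add: sqd_def)
    qed simp
    then show ?thesis by (simp add: dist_norm norm_minus_commute)
  qed
  then have "bounded {x. sqd p x \<in> K}" by (meson bounded_cball bounded_subset mem_Collect_eq subsetI)
  moreover have "closed {x. sqd p x \<in> K}"
    using continuous_closed_vimage[OF compact_imp_closed[OF assms], of "sqd p"]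
      smooth_on_continuous_on[OF smooth_sqd]
    by (simp add: vimage_def continuous_on_eq_continuous_at)
  ultimately show ?thesis by (simp add: compact_eq_bounded_closed)
qed

lemma test_fn_monom3_radial:
  assumes "test1 I h" shows "test_fn {x. sqd p x \<in> I} (\<lambda>x. monom3 p e x * h (sqd p x))"
proof -
  obtain K where K: "smooth_on UNIV h" "compact K" "K \<subseteq> I" "\<And>s. s \<notin> K \<Longrightarrow> h s = 0"
    using assms by (auto simp: test1_def)
  then show ?thesis unfolding test_fn_def
    by (auto intro!: exI[of _ "{x. sqd p x \<in> K}"] compact_sqd_preimage smooth_on_mult smooth_monom3 smooth_radial)
qed

lemma vd_eq0_outside:
  assumes "closed K" "\<And>s. s \<notin> K \<Longrightarrow> h s = 0" "s \<notin> K" shows "vd h s = 0"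
proof -
  have "((\<lambda>_. 0) has_vector_derivative 0) (at s)" by simp
  then have "(h has_vector_derivative 0) (at s)"
    by (rule has_vector_derivative_transform_within_open[of _ _ _ "-K"]) (use assms in auto)
  then show ?thesis by (simp add: vd_def vector_derivative_at)
qed

lemma test1_vd: assumes "test1 I h" shows "test1 I (vd h)"
proof -
  obtain K where K: "smooth_on UNIV h" "compact K" "K \<subseteq> I" "\<And>s. s \<notin> K \<Longrightarrow> h s = 0"
    using assms by (auto simp: test1_def)
  show ?thesis unfolding test1_def
    using K vd_eq0_outside[OF compact_imp_closed[OF K(2)] K(4)] by (auto intro: smooth_on_vd)
qed

lemma test1_mult: "test1 I h \<Longrightarrow> smooth_on UNIV g \<Longrightarrow> test1 I (\<lambda>s. g s * h s)"
  unfolding test1_def by (auto intro: smooth_on_mult)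

lemma test1_add: assumes "test1 I h" "test1 I g" shows "test1 I (\<lambda>s. h s + g s)"
proof -
  obtain K where K: "smooth_on UNIV h" "compact K" "K \<subseteq> I" "\<And>s. s \<notin> K \<Longrightarrow> h s = 0"
    using assms by (auto simp: test1_def)
  obtain L where L: "smooth_on UNIV g" "compact L" "L \<subseteq> I" "\<And>s. s \<notin> L \<Longrightarrow> g s = 0"
    using assms by (auto simp: test1_def)
  have "h s + g s = 0" if "s \<notin> K \<union> L" for s using K(4) L(4) that by simp
  then show ?thesis unfolding test1_def
    using K L smooth_on_add compact_Un by (metis Un_least open_UNIV)
qed

lemma test1_bessel: assumes "test1 I h" shows "test1 I (bessel_op \<kappa> d h)"
proof -
  have "smooth_on UNIV (\<lambda>s. 4 * complex_of_real s)"
    by (intro smooth_on_mult smooth_on_bounded_linear[OF bounded_linear_of_real] smooth_on_id) auto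
  then show ?thesis
    unfolding bessel_op_def[abs_def] by (intro test1_add test1_mult test1_vd assms) auto
qed

text \<open>The hypothesis \<open>solve\<close> is the common core of the two uniqueness results:
  the radial equation need hold only up to an error that is small against \<open>v\<close> itself.
  The induction on the degree keeps \<open>e\<close> and \<open>g\<close> arbitrary, because moments
  of lower degree occur with the solution \<open>h\<close> in place of \<open>g\<close>.\<close>

lemma radial_moments_zero:
  fixes v :: "real^3 \<Rightarrow> complex" and \<kappa> :: complex
  assumes v: "loc_integrable v"
    and helm: "\<And>f. test_fn {x. sqd p x \<in> I} f \<Longrightarrow>
       (LINT x|lebesgue. v x * ((\<Sum>j\<in>UNIV. pd j (pd j f) x) + \<kappa> * f x)) = 0"
    and solve: "\<And>e g \<epsilon>. test1 I g \<Longrightarrow> \<epsilon> > 0 \<Longrightarrow> \<exists>h. test1 I h \<and>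
       norm (LINT x|lebesgue. v x * (monom3 p e x * (bessel_op \<kappa> (\<Sum>j\<in>UNIV. e j) h (sqd p x) - g (sqd p x)))) < \<epsilon>"
    and g: "test1 I g"
  shows "(LINT x|lebesgue. v x * (monom3 p e x * g (sqd p x))) = 0"
  using g
proof (induction "\<Sum>j\<in>UNIV. e j" arbitrary: e g rule: less_induct)
  case less
  have int: "integrable lebesgue (\<lambda>x. v x * (monom3 p e x * h (sqd p x)))" if "test1 I h" for e h
    by (rule loc_integrable_test[OF v test_fn_monom3_radial[OF that]])
  have L0: "(LINT x|lebesgue. v x * (monom3 p e x * bessel_op \<kappa> (\<Sum>j\<in>UNIV. e j) h (sqd p x))) = 0"
    if h: "test1 I h" for h
  proof -
    \<comment> \<open>For \<open>e j < 2\<close> the coefficient vanishes, so the truncated exponent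
      does no harm; otherwise the degree has dropped by two and the induction hypothesis applies
      with \<open>h\<close> as weight.\<close>
    have lower: "(LINT x|lebesgue. of_nat (e j * (e j - 1)) * (v x * (monom3 p (e(j := e j - 2)) x * h (sqd p x)))) = 0" for j
    proof (cases "e j \<ge> 2")
      case True
      have "(\<Sum>i\<in>UNIV. (e(j := e j - 2)) i) < (\<Sum>i\<in>UNIV. e i)"
        by (rule sum_strict_mono_ex1) (use True in \<open>auto intro!: exI[of _ j]\<close>)
      from less.hyps[of "e(j := e j - 2)", OF this h] show ?thesis
        by (simp del: fun_upd_apply)
    next
      case False
      then have "e j * (e j - 1) = 0" by (cases "e j") auto
      then show ?thesis by simp
    qed
    have "0 = (LINT x|lebesgue. v x * ((\<Sum>j\<in>UNIV. pd j (pd j (\<lambda>x. monom3 p e x * h (sqd p x))) x)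
        + \<kappa> * (monom3 p e x * h (sqd p x))))"
      using helm[OF test_fn_monom3_radial[OF h, of p e]] by simp
    also have "\<dots> = (LINT x|lebesgue. v x * (monom3 p e x * bessel_op \<kappa> (\<Sum>j\<in>UNIV. e j) h (sqd p x))
      + (\<Sum>j\<in>UNIV. of_nat (e j * (e j - 1)) * (v x * (monom3 p (e(j := e j - 2)) x * h (sqd p x)))))"
      using h by (subst laplace_monom3_radial) (auto simp: test1_def distrib_left sum_distrib_left mult_ac)
    also have "\<dots> = (LINT x|lebesgue. v x * (monom3 p e x * bessel_op \<kappa> (\<Sum>j\<in>UNIV. e j) h (sqd p x)))"
    proof (subst Bochner_Integration.integral_add)
      show "integrable lebesgue (\<lambda>x. \<Sum>j\<in>UNIV. of_nat (e j * (e j - 1)) * (v x * (monom3 p (e(j := e j - 2)) x * h (sqd p x))))"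
        by (intro Bochner_Integration.integrable_sum integrable_mult_right int h)
      have "(LINT x|lebesgue. (\<Sum>j\<in>UNIV. of_nat (e j * (e j - 1)) * (v x * (monom3 p (e(j := e j - 2)) x * h (sqd p x))))) = 0"
        by (subst Bochner_Integration.integral_sum, intro integrable_mult_right int h) (simp only: lower sum.neutral_const)
      then show "(LINT x|lebesgue. v x * (monom3 p e x * bessel_op \<kappa> (\<Sum>j\<in>UNIV. e j) h (sqd p x))) +
        (LINT x|lebesgue. (\<Sum>j\<in>UNIV. of_nat (e j * (e j - 1)) * (v x * (monom3 p (e(j := e j - 2)) x * h (sqd p x))))) =
        (LINT x|lebesgue. v x * (monom3 p e x * bessel_op \<kappa> (\<Sum>j\<in>UNIV. e j) h (sqd p x)))" by simp
    qed (intro int test1_bessel h)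
    finally show ?thesis by simp
  qed
  have "norm (LINT x|lebesgue. v x * (monom3 p e x * g (sqd p x))) < \<epsilon>" if "\<epsilon> > 0" for \<epsilon>
  proof -
    obtain h where h: "test1 I h" and
      s: "norm (LINT x|lebesgue. v x * (monom3 p e x * (bessel_op \<kappa> (\<Sum>j\<in>UNIV. e j) h (sqd p x) - g (sqd p x)))) < \<epsilon>"
      using solve[OF less.prems \<open>\<epsilon> > 0\<close>] by blast
    have "(LINT x|lebesgue. v x * (monom3 p e x * (bessel_op \<kappa> (\<Sum>j\<in>UNIV. e j) h (sqd p x) - g (sqd p x))))
      = - (LINT x|lebesgue. v x * (monom3 p e x * g (sqd p x)))"
      using L0[OF h] by (simp add: right_diff_distrib int less.prems test1_bessel h)
    then show ?thesis using s by simp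
  qed
  then show ?case by (metis norm_le_zero_iff not_le order_less_irrefl)
qed

section \<open>The radial equation\<close>

text \<open>The derivatives of \<open>exp (\<i> * \<sigma> * sqrt s) / sqrt s\<close> with respect to \<open>s = r\<^sup>2\<close>; these are,
  up to powers of \<open>r\<close>, the spherical Hankel functions.\<close>

definition rsqrt :: "complex \<Rightarrow> complex" where "rsqrt z = inverse (csqrt z)"

fun hankel :: "real \<Rightarrow> nat \<Rightarrow> complex \<Rightarrow> complex" where
  "hankel \<sigma> 0 z = exp (\<i> * of_real \<sigma> * csqrt z) * rsqrt z"
| "hankel \<sigma> (Suc 0) z = exp (\<i> * of_real \<sigma> * csqrt z) * (\<i> * of_real \<sigma> / 2 * rsqrt z ^ 2 - rsqrt z ^ 3 / 2)"
| "hankel \<sigma> (Suc (Suc n)) z = - ((6 + 4 * of_nat n) * hankel \<sigma> (Suc n) z + of_real (\<sigma>^2) * hankel \<sigma> n z) * (rsqrt z ^ 2 / 4)"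

lemma rsqrt_deriv:
  assumes "z \<notin> \<real>\<^sub>\<le>\<^sub>0" shows "(rsqrt has_field_derivative - (rsqrt z ^ 3) / 2) (at z)"
proof -
  have nz: "csqrt z \<noteq> 0" using assms by auto
  have "(rsqrt has_field_derivative - (inverse (csqrt z) * inverse (2 * csqrt z) * inverse (csqrt z))) (at z)"
    unfolding rsqrt_def[abs_def] by (rule DERIV_inverse'[OF has_field_derivative_csqrt[OF assms] nz])
  then show ?thesis using nz by (simp add: rsqrt_def field_simps power3_eq_cube)
qed

text \<open>The third clause of \<open>hankel\<close> is the Bessel equation of degree
  \<open>n\<close>, solved for the second derivative. Differentiating that equation raises its
  degree by one, so the recursion is consistent with differentiation; \<open>alg\<close> is this
  computation.\<close>

lemma hankel_deriv:
  assumes z: "z \<notin> \<real>\<^sub>\<le>\<^sub>0" shows "(hankel \<sigma> n has_field_derivative hankel \<sigma> (Suc n) z) (at z)"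
proof -
  have nz: "csqrt z \<noteq> 0" using z by auto
  let ?E = "\<lambda>z. exp (\<i> * of_real \<sigma> * csqrt z)"
  note dU = rsqrt_deriv[OF z]
  have dE: "(?E has_field_derivative ?E z * (\<i> * of_real \<sigma> / 2 * rsqrt z)) (at z)"
    using DERIV_fun_exp[OF DERIV_cmult[OF has_field_derivative_csqrt[OF z], of "\<i> * of_real \<sigma>"]] nz
    by (simp add: rsqrt_def field_simps)
  have d2: "((\<lambda>z. rsqrt z ^ 2) has_field_derivative - (rsqrt z ^ 4)) (at z)"
    using DERIV_power[OF dU, of 2] by (simp add: eval_nat_numeral algebra_simps)
  have d3: "((\<lambda>z. rsqrt z ^ 3) has_field_derivative - (3/2 * rsqrt z ^ 5)) (at z)"
    using DERIV_power[OF dU, of 3] by (simp add: eval_nat_numeral algebra_simps)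
  show ?thesis
  proof (induction n rule: induct_nat_012)
    case 0
    have "(hankel \<sigma> 0 has_field_derivative ?E z * (\<i> * of_real \<sigma> / 2 * rsqrt z) * rsqrt z
        + - (rsqrt z ^ 3) / 2 * ?E z) (at z)"
    proof -
      have "hankel \<sigma> 0 = (\<lambda>z. ?E z * rsqrt z)" by (rule ext) simp
      then show ?thesis using DERIV_mult[OF dE dU] by simp
    qed
    then show ?case by (rule DERIV_cong) (simp add: algebra_simps power2_eq_square)
  next
    case 1
    have "(hankel \<sigma> (Suc 0) has_field_derivative ?E z * (\<i> * of_real \<sigma> / 2 * rsqrt z) *
        (\<i> * of_real \<sigma> / 2 * rsqrt z ^ 2 - rsqrt z ^ 3 / 2)
        + (\<i> * of_real \<sigma> / 2 * - (rsqrt z ^ 4) - - (3/2 * rsqrt z ^ 5) / 2) * ?E z) (at z)"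
    proof -
      have "hankel \<sigma> (Suc 0) = (\<lambda>z. ?E z * (\<i> * of_real \<sigma> / 2 * rsqrt z ^ 2 - rsqrt z ^ 3 / 2))"
        by (rule ext) simp
      then show ?thesis
        by (simp only:) (rule DERIV_mult[OF dE DERIV_diff[OF DERIV_cmult[OF d2] DERIV_cdivide[OF d3]]])
    qed
    then show ?case
      by (rule DERIV_cong) (simp add: algebra_simps eval_nat_numeral)
  next
    case (ge2 n)
    have "(hankel \<sigma> (Suc (Suc n)) has_field_derivative
       - ((6 + 4 * of_nat n) * hankel \<sigma> (Suc (Suc n)) z + of_real (\<sigma>^2) * hankel \<sigma> (Suc n) z) * (rsqrt z ^ 2 / 4)
       + - (rsqrt z ^ 4) / 4 * - ((6 + 4 * of_nat n) * hankel \<sigma> (Suc n) z + of_real (\<sigma>^2) * hankel \<sigma> n z)) (at z)"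
    proof -
      have "hankel \<sigma> (Suc (Suc n)) = (\<lambda>z. - ((6 + 4 * of_nat n) * hankel \<sigma> (Suc n) z
          + of_real (\<sigma>^2) * hankel \<sigma> n z) * (rsqrt z ^ 2 / 4))"
        by (rule ext) simp
      then show ?thesis
        using DERIV_mult[OF DERIV_minus[OF DERIV_add[OF DERIV_cmult[OF ge2(2)] DERIV_cmult[OF ge2(1)]]]
          DERIV_cdivide[OF d2]]
        by (simp only:)
    qed
    then show ?case
    proof (rule DERIV_cong)
      have alg: "- ((6 + 4 * N) * (- ((6 + 4 * N) * y1 + K * y0) * (u ^ 2 / 4)) + K * y1) * (u ^ 2 / 4)
          + - (u ^ 4) / 4 * - ((6 + 4 * N) * y1 + K * y0)
        = - ((6 + 4 * (1 + N)) * (- ((6 + 4 * N) * y1 + K * y0) * (u ^ 2 / 4)) + K * y1) * (u ^ 2 / 4)"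
        for N y0 y1 K u :: complex by (simp add: field_simps eval_nat_numeral)
      show "- ((6 + 4 * of_nat n) * hankel \<sigma> (Suc (Suc n)) z + of_real (\<sigma>^2) * hankel \<sigma> (Suc n) z) * (rsqrt z ^ 2 / 4)
       + - (rsqrt z ^ 4) / 4 * - ((6 + 4 * of_nat n) * hankel \<sigma> (Suc n) z + of_real (\<sigma>^2) * hankel \<sigma> n z)
       = hankel \<sigma> (Suc (Suc (Suc n))) z"
        unfolding hankel.simps(3)[of \<sigma> "Suc n"] hankel.simps(3)[of \<sigma> n] of_nat_Suc by (rule alg)
    qed
  qed
qed

definition hk :: "real \<Rightarrow> nat \<Rightarrow> real \<Rightarrow> complex" where
  "hk \<sigma> n s = hankel \<sigma> n (of_real s)"

lemma hk_deriv: "s > 0 \<Longrightarrow> (hk \<sigma> n has_vector_derivative hk \<sigma> (Suc n) s) (at s)"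
  unfolding hk_def[abs_def] by (rule has_vector_derivative_real_field, rule hankel_deriv)
    (simp add: complex_nonpos_Reals_iff)

lemma smooth_hk: "smooth_on {0<..} (hk \<sigma> n)"
  unfolding smooth_on_def
proof
  fix m show "Ck_on m {0<..} (hk \<sigma> n)"
  proof (induction m arbitrary: n)
    case (Suc m)
    show ?case by (rule Ck_on_real_SucI[where f'="hk \<sigma> (Suc n)"]) (auto intro: hk_deriv Suc)
  qed simp
qed

lemma rsqrt_of_real: "s > 0 \<Longrightarrow> rsqrt (of_real s) = of_real (inverse (sqrt s))"
  by (simp add: rsqrt_def csqrt_of_real_nonneg)

lemma hk_ode:
  assumes "s > 0"
  shows "4 * of_real s * hk \<sigma> (Suc (Suc n)) s + (6 + 4 * of_nat n) * hk \<sigma> (Suc n) s + of_real (\<sigma>^2) * hk \<sigma> n s = 0"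
proof -
  have "complex_of_real s * rsqrt (of_real s) ^ 2 = 1"
  proof -
    have "complex_of_real (sqrt s) ^ 2 = of_real s" using assms by (simp flip: of_real_power)
    then show ?thesis using assms by (simp add: rsqrt_of_real power_inverse)
  qed
  then have *: "4 * complex_of_real s * (x * (rsqrt (of_real s) ^ 2 / 4)) = x" for x
    by (simp add: algebra_simps)
  show ?thesis unfolding hk_def hankel.simps(3) * by simp
qed

lemma norm_exp_csqrt: "s > 0 \<Longrightarrow> norm (exp (\<i> * complex_of_real \<sigma> * csqrt (of_real s))) = 1"
  by (simp add: csqrt_of_real_nonneg)

text \<open>Each differentiation in \<open>s = r^2\<close> gains a factor \<open>1/r\<close>, since
  the derivative of the oscillating exponential with respect to \<open>s\<close> is
  \<open>O(1/r)\<close>. In the recursion the term with \<open>hk \<sigma> n\<close> decides the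
  rate; the other one is smaller by a power, absorbed for \<open>s \<ge> 1\<close>.\<close>

lemma hk_bound: "\<exists>C\<ge>0. \<forall>s\<ge>1. norm (hk \<sigma> n s) \<le> C * inverse (sqrt s) ^ Suc n"
proof (induction n rule: induct_nat_012)
  case 0
  show ?case
    by (rule exI[of _ 1]) (auto simp: hk_def norm_mult norm_exp_csqrt rsqrt_of_real simp del: of_real_inverse)
next
  case 1
  have "norm (hk \<sigma> 1 s) \<le> (\<bar>\<sigma>\<bar> / 2 + 1 / 2) * inverse (sqrt s) ^ 2" if s: "s \<ge> 1" for s
  proof -
    let ?u = "inverse (sqrt s)"
    have u: "0 \<le> ?u" "?u \<le> 1" using s by (auto simp: inverse_le_1_iff)
    have "norm (hk \<sigma> 1 s) = norm (\<i> * of_real \<sigma> / 2 * of_real ?u ^ 2 - of_real ?u ^ 3 / 2)"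
      using s by (simp add: hk_def norm_mult norm_exp_csqrt rsqrt_of_real del: of_real_inverse)
    also have "\<dots> \<le> norm (\<i> * of_real \<sigma> / 2 * complex_of_real ?u ^ 2) + norm (complex_of_real ?u ^ 3 / 2)"
      by (rule norm_triangle_ineq4)
    also have "\<dots> = \<bar>\<sigma>\<bar> / 2 * ?u ^ 2 + ?u ^ 3 / 2"
      using u by (simp add: norm_mult norm_divide norm_power del: of_real_inverse)
    also have "?u ^ 3 \<le> ?u ^ 2" using u by (intro power_decreasing) auto
    finally show ?thesis by (simp add: algebra_simps)
  qed
  then show ?case by (intro exI[of _ "\<bar>\<sigma>\<bar> / 2 + 1 / 2"]) (auto simp: numeral_2_eq_2)
next
  case (ge2 n)
  obtain C D where C: "C \<ge> 0" "\<And>s. s \<ge> 1 \<Longrightarrow> norm (hk \<sigma> n s) \<le> C * inverse (sqrt s) ^ Suc n"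
    and D: "D \<ge> 0" "\<And>s. s \<ge> 1 \<Longrightarrow> norm (hk \<sigma> (Suc n) s) \<le> D * inverse (sqrt s) ^ Suc (Suc n)"
    using ge2 by blast
  have "norm (hk \<sigma> (Suc (Suc n)) s) \<le> ((6 + 4 * real n) * D + \<sigma>^2 * C) * inverse (sqrt s) ^ Suc (Suc (Suc n))"
    if s: "s \<ge> 1" for s
  proof -
    let ?u = "inverse (sqrt s)"
    have u: "0 \<le> ?u" "?u \<le> 1" using s by (auto simp: inverse_le_1_iff)
    have "norm (hk \<sigma> (Suc (Suc n)) s) =
      norm ((6 + 4 * of_nat n) * hk \<sigma> (Suc n) s + of_real (\<sigma>^2) * hk \<sigma> n s) * (?u ^ 2 / 4)"
      using s u by (simp add: hk_def norm_mult norm_divide norm_power rsqrt_of_real norm_minus_commute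
          del: of_real_inverse of_real_power flip: norm_minus_cancel[of "_ + _"])
    also have "\<dots> \<le> ((6 + 4 * real n) * (D * ?u ^ Suc (Suc n)) + \<sigma>^2 * (C * ?u ^ Suc n)) * (?u ^ 2 / 4)"
    proof (rule mult_right_mono)
      have "norm (6 + 4 * of_nat n :: complex) = 6 + 4 * real n"
        using norm_of_nat[of "6 + 4 * n", where 'a=complex] by simp
      then show "norm ((6 + 4 * of_nat n) * hk \<sigma> (Suc n) s + of_real (\<sigma>^2) * hk \<sigma> n s)
         \<le> (6 + 4 * real n) * (D * ?u ^ Suc (Suc n)) + \<sigma>^2 * (C * ?u ^ Suc n)"
        using mult_left_mono[OF D(2)[OF s], of "6 + 4 * real n"] mult_left_mono[OF C(2)[OF s], of "\<sigma>^2"]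
        by (intro norm_triangle_le) (simp only: norm_mult norm_of_real abs_power2 add_mono zero_le_power2
              of_nat_0_le_iff add_nonneg_nonneg zero_le_numeral mult_nonneg_nonneg)
    qed simp
    also have "\<dots> \<le> ((6 + 4 * real n) * (D * ?u ^ Suc n) + \<sigma>^2 * (C * ?u ^ Suc n)) * ?u ^ 2"
    proof (intro mult_mono add_mono mult_left_mono)
      show "?u ^ Suc (Suc n) \<le> ?u ^ Suc n" using u by (intro power_decreasing) auto
    qed (use C D u in auto)
    also have "\<dots> = ((6 + 4 * real n) * D + \<sigma>^2 * C) * ?u ^ Suc (Suc (Suc n))"
      by (simp add: algebra_simps eval_nat_numeral)
    finally show ?thesis .
  qed
  then show ?case using C D by (intro exI[of _ "(6 + 4 * real n) * D + \<sigma>^2 * C"]) auto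
qed

section \<open>The Wronskian and variation of parameters\<close>

definition wronskian :: "real \<Rightarrow> nat \<Rightarrow> real \<Rightarrow> complex" where
  "wronskian k n s = hk k n s * hk (- k) (Suc n) s - hk (- k) n s * hk k (Suc n) s"

text \<open>When the recursion is inserted for the highest index, the terms with
  \<open>6 + 4 n\<close> cancel and the Wronskian reproduces itself; for positive \<open>s\<close>
  the factor is \<open>k^2 / (4 s)\<close>.\<close>

lemma wronskian_Suc:
  "wronskian k (Suc n) s = of_real (k^2) * (rsqrt (of_real s) ^ 2 / 4) * wronskian k n s"
  by (simp add: wronskian_def hk_def algebra_simps)

text \<open>At \<open>n = 0\<close> the two exponentials cancel and \<open>- \<i> k s^(-3/2)\<close>
  remains; every further index multiplies by a nonzero factor.\<close>

lemma wronskian_nz: "k \<noteq> 0 \<Longrightarrow> s > 0 \<Longrightarrow> wronskian k n s \<noteq> 0"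
proof (induction n)
  case 0
  let ?c = "csqrt (of_real s)"
  have e: "exp (\<i> * of_real k * ?c) * exp (- (\<i> * of_real k * ?c)) = 1" by (simp flip: exp_add)
  have "wronskian k 0 s = - (exp (\<i> * of_real k * ?c) * exp (- (\<i> * of_real k * ?c))) * \<i> * of_real k * rsqrt (of_real s) ^ 3"
    by (simp add: wronskian_def hk_def algebra_simps eval_nat_numeral)
  then show ?case using 0 unfolding e by (simp add: rsqrt_of_real)
next
  case (Suc n)
  then show ?case by (simp add: wronskian_Suc rsqrt_of_real)
qed

text \<open>The support of \<open>g\<close> stays away from the singularities of \<open>y\<close>:
  the product is smooth on \<open>S\<close> and, being zero there, off the support.\<close>

lemma test1_mult_local:
  assumes "test1 I g" "smooth_on S y" "open S" "I \<subseteq> S" shows "test1 I (\<lambda>s. y s * g s)"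
proof -
  obtain K where K: "smooth_on UNIV g" "compact K" "K \<subseteq> I" "\<And>s. s \<notin> K \<Longrightarrow> g s = 0"
    using assms(1) by (auto simp: test1_def)
  have "smooth_on S (\<lambda>s. y s * g s)"
    by (intro smooth_on_mult assms smooth_on_subset[OF K(1)]) auto
  moreover have "smooth_on (- K) (\<lambda>s. y s * g s)"
  proof -
    have "open (- K)" using compact_imp_closed[OF K(2)] by auto
    then show ?thesis using K(4) smooth_on_cong[of "-K" "\<lambda>s. y s * g s" "\<lambda>s. 0"] by auto
  qed
  ultimately have "smooth_on (S \<union> - K) (\<lambda>s. y s * g s)" by (rule smooth_on_Un)
  moreover have "S \<union> - K = UNIV" using K assms by auto
  ultimately show ?thesis unfolding test1_def using K by auto
qed

lemma test1_antiderivative: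
  fixes \<phi> :: "real \<Rightarrow> complex"
  assumes "test1 {a<..<b} \<phi>"
  obtains F where "smooth_on UNIV F" "\<And>s. (F has_vector_derivative \<phi> s) (at s)"
    "\<And>s. s \<le> a \<Longrightarrow> F s = 0" "\<And>s. b \<le> s \<Longrightarrow> F s = F b"
proof -
  obtain K where K: "smooth_on UNIV \<phi>" "compact K" "K \<subseteq> {a<..<b}" "\<And>s. s \<notin> K \<Longrightarrow> \<phi> s = 0"
    using assms by (auto simp: test1_def)
  have z: "\<phi> s = 0" if "s \<le> a \<or> b \<le> s" for s
  proof (rule K(4))
    show "s \<notin> K" using K(3) that by fastforce
  qed
  \<comment> \<open>Integrating from \<open>a - 1\<close> instead of \<open>a\<close> makes every
    \<open>s \<ge> a\<close> an interior point of \<open>{a - 1..s + 1}\<close>, so the derivative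
    is two-sided.\<close>
  define F where "F s = integral {a - 1..s} \<phi>" for s
  have cont: "continuous_on T \<phi>" for T
    using continuous_on_subset[OF smooth_on_continuous_on[OF K(1)]] by blast
  have F0: "F s = 0" if "s \<le> a" for s
    unfolding F_def by (rule integral_unique[OF has_integral_is_0]) (use that z in auto)
  have F': "(F has_vector_derivative \<phi> s) (at s)" for s
  proof (cases "s < a")
    case True
    have "((\<lambda>_. 0) has_vector_derivative 0) (at s)" by simp
    then have "(F has_vector_derivative 0) (at s)"
      by (rule has_vector_derivative_transform_within_open[of _ _ _ "{..<a}"]) (use True F0 in auto)
    then show ?thesis using z True by simp
  next
    case False
    have "((\<lambda>u. integral {a - 1..u} \<phi>) has_vector_derivative \<phi> s) (at s within {a - 1..s + 1})"
      by (rule integral_has_vector_derivative[OF cont]) (use False in auto)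
    moreover have "at s within {a - 1..s + 1} = at s"
      by (rule at_within_interior) (use False in auto)
    ultimately show ?thesis by (simp add: F_def[abs_def])
  qed
  have Fb: "F s = F b" if "b \<le> s" for s
  proof -
    have "integral {a-1..b} \<phi> + integral {b..s} \<phi> = integral {a-1..s} \<phi>" if "a - 1 \<le> b"
      by (rule Henstock_Kurzweil_Integration.integral_combine) (use that \<open>b \<le> s\<close> cont in \<open>auto intro: integrable_continuous_real\<close>)
    moreover have "integral {b..s} \<phi> = 0"
      by (rule integral_unique[OF has_integral_is_0]) (use z in auto)
    \<comment> \<open>The order of \<open>a\<close> and \<open>b\<close> is not prescribed; in this
      case every point lies in the zero set of \<open>\<phi>\<close>.\<close>
    moreover have "F s = F b" if "b < a - 1"
    proof -
      have "\<phi> x = 0" for x using z[of x] that by linarith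
      then have "\<phi> = (\<lambda>_. 0)" by auto
      then show ?thesis by (simp add: F_def)
    qed
    ultimately show ?thesis unfolding F_def by fastforce
  qed
  show ?thesis
    by (rule that[of F]) (auto intro!: F0 F' Fb smooth_on_real_derivI[OF open_UNIV F' K(1)])
qed

text \<open>Variation of parameters. The coefficients \<open>A\<close> and \<open>B\<close> are
  constant on either side of the support of \<open>g\<close>, and the free constants
  \<open>cA\<close>, \<open>cB\<close> select where the solution vanishes: the values
  \<open>A b\<close>, \<open>B b\<close> beyond the support, the values \<open>0\<close>,
  \<open>0\<close> before it.\<close>

lemma bessel_solve:
  assumes g: "test1 {a<..<b} g" and a: "0 < a" and k: "k \<noteq> 0"
  obtains A B where "smooth_on UNIV A" "smooth_on UNIV B"
    "\<And>s. s \<le> a \<Longrightarrow> A s = 0 \<and> B s = 0" "\<And>s. b \<le> s \<Longrightarrow> A s = A b \<and> B s = B b"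
    "\<And>cA cB h. h = (\<lambda>s. (A s - cA) * hk k d s + (B s - cB) * hk (- k) d s) \<Longrightarrow> smooth_on {0<..} h \<and>
       (\<forall>s>0. vd h s = (A s - cA) * hk k (Suc d) s + (B s - cB) * hk (- k) (Suc d) s \<and>
              bessel_op (of_real (k^2)) d h s = g s)"
proof -
  have W: "wronskian k d s \<noteq> 0" if "s > 0" for s using wronskian_nz[OF k that] .
  have o: "open {0::real<..}" by simp
  have smW: "smooth_on {0<..} (\<lambda>s. 4 * complex_of_real s * wronskian k d s)"
    unfolding wronskian_def[abs_def]
    by (intro smooth_on_mult smooth_on_diff smooth_hk smooth_on_const o
        smooth_on_bounded_linear[OF bounded_linear_of_real] smooth_on_id)
  have sm: "smooth_on {0<..} (\<lambda>s. y s / (4 * complex_of_real s * wronskian k d s))" if "smooth_on {0<..} y" for y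
    by (rule smooth_on_divide[OF o that smW]) (use W in auto)
  \<comment> \<open>Cramer's rule for the derivatives of the coefficients: \<open>4 s\<close> is the
    leading coefficient of the operator, and \<open>wronskian\<close> is the determinant.\<close>
  define \<phi> where "\<phi> \<sigma> s = hk \<sigma> d s / (4 * complex_of_real s * wronskian k d s) * g s" for \<sigma> s
  have t: "test1 {a<..<b} (\<phi> \<sigma>)" for \<sigma>
    unfolding \<phi>_def[abs_def] by (rule test1_mult_local[OF g sm[OF smooth_hk] o]) (use a in auto)
  obtain A' where A: "smooth_on UNIV A'" "\<And>s. (A' has_vector_derivative \<phi> (-k) s) (at s)"
    "\<And>s. s \<le> a \<Longrightarrow> A' s = 0" "\<And>s. b \<le> s \<Longrightarrow> A' s = A' b" using test1_antiderivative[OF t] by metis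
  obtain B where B: "smooth_on UNIV B" "\<And>s. (B has_vector_derivative \<phi> k s) (at s)"
    "\<And>s. s \<le> a \<Longrightarrow> B s = 0" "\<And>s. b \<le> s \<Longrightarrow> B s = B b" using test1_antiderivative[OF t] by metis
  define A where "A s = - A' s" for s
  have A1: "smooth_on UNIV A" unfolding A_def[abs_def] by (rule smooth_on_minus[OF open_UNIV A(1)])
  have A2: "(A has_vector_derivative - \<phi> (-k) s) (at s)" for s
    unfolding A_def[abs_def] by (rule has_vector_derivative_minus[OF A(2)])
  have key: "smooth_on {0<..} h \<and>
       (\<forall>s>0. vd h s = (A s - cA) * hk k (Suc d) s + (B s - cB) * hk (- k) (Suc d) s \<and>
              bessel_op (of_real (k^2)) d h s = g s)"
    if h: "h = (\<lambda>s. (A s - cA) * hk k d s + (B s - cB) * hk (- k) d s)" for h cA cB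
  proof (intro conjI allI impI)
    show "smooth_on {0<..} h"
      unfolding h by (intro smooth_on_add smooth_on_mult smooth_on_diff smooth_hk smooth_on_const o
          smooth_on_subset[OF A1] smooth_on_subset[OF B(1)]) auto
    define h1 where "h1 s = (A s - cA) * hk k (Suc d) s + (B s - cB) * hk (- k) (Suc d) s" for s
    define h2 where "h2 s = (A s - cA) * hk k (Suc (Suc d)) s + (B s - cB) * hk (- k) (Suc (Suc d)) s
        + g s / (4 * of_real s)" for s
    \<comment> \<open>For \<open>n = d\<close> the terms with \<open>\<phi>\<close> cancel, so
      \<open>h\<close> is differentiated as if \<open>A\<close> and \<open>B\<close> were constant;
      for \<open>n = Suc d\<close> they add up to \<open>g s / (4 s)\<close>.\<close>
    have dl: "((\<lambda>s. (A s - cA) * hk k n s + (B s - cB) * hk (- k) n s) has_vector_derivative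
        (A s - cA) * hk k (Suc n) s + - \<phi> (-k) s * hk k n s + ((B s - cB) * hk (- k) (Suc n) s + \<phi> k s * hk (- k) n s)) (at s)"
      if "s > 0" for n s
      using has_vector_derivative_add[OF
          has_vector_derivative_mult[OF has_vector_derivative_diff[OF A2 has_vector_derivative_const] hk_deriv[OF that, of k n]]
          has_vector_derivative_mult[OF has_vector_derivative_diff[OF B(2) has_vector_derivative_const] hk_deriv[OF that, of "-k" n]]]
      by simp
    have d1: "(h has_vector_derivative h1 s) (at s)" if "s > 0" for s
      using dl[OF that, of d] unfolding h h1_def \<phi>_def by (simp add: mult_ac)
    have d2: "(h1 has_vector_derivative h2 s) (at s)" if s: "s > 0" for s
    proof -
      have "- \<phi> (-k) s * hk k (Suc d) s + \<phi> k s * hk (- k) (Suc d) s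
          = wronskian k d s / wronskian k d s * (g s / (4 * of_real s))"
        unfolding \<phi>_def by (subst (3) wronskian_def) (simp add: diff_divide_distrib algebra_simps)
      then have "- \<phi> (-k) s * hk k (Suc d) s + \<phi> k s * hk (- k) (Suc d) s = g s / (4 * of_real s)"
        using W[OF s] by simp
      then show ?thesis using dl[OF s, of "Suc d"] unfolding h1_def[abs_def] h2_def by (simp add: algebra_simps)
    qed
    fix s :: real assume s: "s > 0"
    have v1: "vd h s = h1 s" if "s > 0" for s using d1[OF that] by (simp add: vd_def vector_derivative_at)
    show "vd h s = (A s - cA) * hk k (Suc d) s + (B s - cB) * hk (- k) (Suc d) s"
      using v1[OF s] by (simp add: h1_def)
    have "(vd h has_vector_derivative h2 s) (at s)"
      by (rule has_vector_derivative_transform_within_open[OF d2[OF s] o]) (use s v1 in auto)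
    then have v2: "vd (vd h) s = h2 s" unfolding vd_def[of "vd h"] by (rule vector_derivative_at)
    have alg: "4*S*(p*y2+q*z2+G) + (6+4*N)*(p*y1+q*z1) + K*(p*y0+q*z0) =
       p*(4*S*y2+(6+4*N)*y1+K*y0) + q*(4*S*z2+(6+4*N)*z1+K*z0) + 4*S*G"
       for S N K p q y0 y1 y2 z0 z1 z2 G :: complex by (simp add: algebra_simps)
    have hs: "h s = (A s - cA) * hk k d s + (B s - cB) * hk (- k) d s" unfolding h by (rule refl)
    have "bessel_op (of_real (k^2)) d h s = (A s - cA) * (4 * of_real s * hk k (Suc (Suc d)) s
         + (6 + 4 * of_nat d) * hk k (Suc d) s + of_real (k^2) * hk k d s)
       + (B s - cB) * (4 * of_real s * hk (-k) (Suc (Suc d)) s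
         + (6 + 4 * of_nat d) * hk (-k) (Suc d) s + of_real ((-k)^2) * hk (-k) d s)
       + 4 * of_real s * (g s / (4 * of_real s))"
      unfolding bessel_op_def v2 v1[OF s] h1_def h2_def hs power2_minus by (rule alg)
    then show "bessel_op (of_real (k^2)) d h s = g s"
      unfolding hk_ode[OF s] using s by simp
  qed
  show ?thesis
  proof (rule that[OF A1 B(1) _ _ key])
    show "A s = 0 \<and> B s = 0" if "s \<le> a" for s using A(3)[OF that] B(3)[OF that] by (simp add: A_def)
    show "A s = A b \<and> B s = B b" if "b \<le> s" for s using A(4)[OF that] B(4)[OF that] by (simp add: A_def)
  qed
qed

section \<open>Unique continuation and Rellich's lemma\<close>

text \<open>Real polynomials expanded at \<open>p\<close>. Moments are known for monomials in
  \<open>x - p\<close>, whereas the approximation theorem speaks of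
  \<open>real_polynomial_function\<close>; this predicate connects the two.\<close>

inductive mono_span :: "real^3 \<Rightarrow> (real^3 \<Rightarrow> real) \<Rightarrow> bool" for p where
  base: "mono_span p (\<lambda>x. c * (\<Prod>i\<in>UNIV. (x $ i - p $ i) ^ e i))"
| add: "mono_span p F \<Longrightarrow> mono_span p G \<Longrightarrow> mono_span p (\<lambda>x. F x + G x)"

lemma mono_span_cmult: "mono_span p F \<Longrightarrow> mono_span p (\<lambda>x. F x * c)"
proof (induction rule: mono_span.induct)
  case (base c' e)
  show ?case using mono_span.base[of p "c * c'" e] by (simp add: mult_ac)
next
  case (add F G) then show ?case using mono_span.add by (simp add: distrib_right)
qed

lemma mono_span_coord: "mono_span p F \<Longrightarrow> mono_span p (\<lambda>x. F x * (x $ j - p $ j))"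
proof (induction rule: mono_span.induct)
  case (base c e)
  have "(\<Prod>i\<in>UNIV. (x $ i - p $ i) ^ (e(j := Suc (e j))) i) = (\<Prod>i\<in>UNIV. (x $ i - p $ i) ^ e i) * (x $ j - p $ j)" for x :: "real^3"
    by (subst (1 2) prod.remove[of UNIV j]) (auto intro!: prod.cong)
  then show ?case using mono_span.base[of p c "e(j := Suc (e j))"] by (simp add: mult_ac)
next
  case (add F G) then show ?case using mono_span.add by (simp add: distrib_right)
qed

text \<open>Stated for multiplication by \<open>P\<close>, so that the product case is a composition
  of two multiplications. A linear functional is expanded at \<open>p\<close> in coordinates, and
  \<open>F = 1\<close> yields all polynomials.\<close>

lemma mono_span_mult_poly:
  assumes "real_polynomial_function P" "mono_span p F"
  shows "mono_span p (\<lambda>x. F x * P x)"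
  using assms
proof (induction P arbitrary: F rule: real_polynomial_function.induct)
  case (linear f)
  have f: "f x = f p + (x$1 - p$1) * f (axis 1 1) + (x$2 - p$2) * f (axis 2 1) + (x$3 - p$3) * f (axis 3 1)" for x
  proof -
    have "x = p + (x$1 - p$1) *\<^sub>R axis 1 1 + (x$2 - p$2) *\<^sub>R axis 2 1 + (x$3 - p$3) *\<^sub>R axis 3 1"
      by (auto simp: vec_eq_iff axis_def forall_3)
    from arg_cong[OF this, of f] show ?thesis
      by (simp add: linear_add[OF bounded_linear.linear[OF linear(1)]]
          linear_cmul[OF bounded_linear.linear[OF linear(1)]])
  qed
  have "mono_span p (\<lambda>x. F x * f p + F x * (x$1 - p$1) * f (axis 1 1) + F x * (x$2 - p$2) * f (axis 2 1)
     + F x * (x$3 - p$3) * f (axis 3 1))"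
    by (intro mono_span.add mono_span_cmult mono_span_coord linear)
  moreover have "(\<lambda>x. F x * f p + F x * (x$1 - p$1) * f (axis 1 1) + F x * (x$2 - p$2) * f (axis 2 1)
     + F x * (x$3 - p$3) * f (axis 3 1)) = (\<lambda>x. F x * f x)"
  proof
    fix x
    show "F x * f p + F x * (x$1 - p$1) * f (axis 1 1) + F x * (x$2 - p$2) * f (axis 2 1)
     + F x * (x$3 - p$3) * f (axis 3 1) = F x * f x"
      unfolding f[of x] by (simp only: distrib_left mult.assoc)
  qed
  ultimately show ?case by simp
next
  case (const c) then show ?case by (rule mono_span_cmult)
next
  case (add f g) then show ?case using mono_span.add by (simp add: distrib_left)
next
  case (mult f g) 
  have "mono_span p (\<lambda>x. (F x * f x) * g x)" using mult by blast
  then show ?case by (simp add: mult.assoc)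
qed

text \<open>The integral of \<open>|f|\<close> is a limit of integrals of \<open>f\<close> against
  truncated continuous approximations of \<open>sgn f\<close>, by dominated convergence.\<close>

lemma AE_zero_if_orthogonal_continuous:
  fixes f :: "'a::euclidean_space \<Rightarrow> real"
  assumes f: "integrable lebesgue f"
    and orth: "\<And>\<phi>. continuous_on UNIV \<phi> \<Longrightarrow> (\<And>x. \<bar>\<phi> x\<bar> \<le> 1) \<Longrightarrow> (LINT x|lebesgue. f x * \<phi> x) = 0"
  shows "AE x in lebesgue. f x = 0"
proof -
  have fm: "f \<in> borel_measurable lebesgue" using f by auto
  have "(\<lambda>x. sgn (f x)) \<in> borel_measurable lebesgue" 
    using measurable_compose[OF fm, of sgn] by (simp add: borel_measurable_sgn)
  then have "(\<lambda>x. sgn (f x)) measurable_on UNIV"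
    by (rule lebesgue_measurable_imp_measurable_on_real) simp
  then obtain N g where N: "negligible N" "\<And>n. continuous_on UNIV (g n)"
    "\<And>x. x \<notin> N \<Longrightarrow> (\<lambda>n. g n x) \<longlonglongrightarrow> sgn (f x)" unfolding measurable_on_def by auto
  define \<phi> where "\<phi> n x = max (-1) (min 1 (g n x))" for n :: nat and x
  have c: "continuous_on UNIV (\<phi> n)" for n
    unfolding \<phi>_def[abs_def] by (intro continuous_intros N)
  have lim: "(\<lambda>n. LINT x|lebesgue. f x * \<phi> n x) \<longlonglongrightarrow> (LINT x|lebesgue. \<bar>f x\<bar>)"
  proof (rule integral_dominated_convergence[where w="\<lambda>x. \<bar>f x\<bar>"])
    show "(\<lambda>x. \<bar>f x\<bar>) \<in> borel_measurable lebesgue" using fm by simp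
    show "(\<lambda>x. f x * \<phi> n x) \<in> borel_measurable lebesgue" for n
    proof -
      have "\<phi> n \<in> borel_measurable lebesgue"
        by (intro measurable_completion) (simp add: borel_measurable_continuous_onI c)
      then show ?thesis using fm by (intro borel_measurable_times)
    qed
    show "integrable lebesgue (\<lambda>x. \<bar>f x\<bar>)" using f by simp
    have "AE x in lebesgue. x \<notin> N" using N(1)
      by (simp add: negligible_iff_null_sets AE_not_in)
    then show "AE x in lebesgue. (\<lambda>n. f x * \<phi> n x) \<longlonglongrightarrow> \<bar>f x\<bar>"
    proof eventually_elim
      case (elim x)
      have "(\<lambda>n. f x * \<phi> n x) \<longlonglongrightarrow> f x * max (-1) (min 1 (sgn (f x)))"
        unfolding \<phi>_def by (intro tendsto_intros N elim)
      also have "f x * max (-1) (min 1 (sgn (f x))) = \<bar>f x\<bar>" by (simp add: sgn_real_def)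
      finally show ?case .
    qed
    show "AE x in lebesgue. norm (f x * \<phi> n x) \<le> \<bar>f x\<bar>" for n
      by (auto simp: abs_mult \<phi>_def intro!: mult_left_le)
  qed
  moreover have "(LINT x|lebesgue. f x * \<phi> n x) = 0" for n
    by (rule orth[OF c]) (auto simp: \<phi>_def)
  ultimately have "(LINT x|lebesgue. \<bar>f x\<bar>) = 0" by (simp add: LIMSEQ_const_iff)
  then show ?thesis
    using integral_nonneg_eq_0_iff_AE[of lebesgue "\<lambda>x. \<bar>f x\<bar>"] f by simp
qed

text \<open>\<open>f\<close> lives on the compact set \<open>K\<close>, where polynomials
  approximate a continuous function uniformly; the integral of \<open>|f|\<close> controls the
  error.\<close>

lemma AE_zero_if_orthogonal_polynomials:
  fixes f :: "'a::euclidean_space \<Rightarrow> real"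
  assumes f: "integrable lebesgue f" and K: "compact K" "\<And>x. x \<notin> K \<Longrightarrow> f x = 0"
    and orth: "\<And>P. real_polynomial_function P \<Longrightarrow> (LINT x|lebesgue. f x * P x) = 0"
  shows "AE x in lebesgue. f x = 0"
proof (rule AE_zero_if_orthogonal_continuous[OF f])
  fix \<phi> :: "'a \<Rightarrow> real" assume c: "continuous_on UNIV \<phi>"
  have int: "integrable lebesgue (\<lambda>x. f x * g x)" if "continuous_on UNIV g" for g :: "'a \<Rightarrow> real"
  proof -
    have "compact (g ` K)" by (rule compact_continuous_image[OF continuous_on_subset[OF that] K(1)]) simp
    then have "\<exists>B. \<forall>x\<in>K. \<bar>g x\<bar> \<le> B" by (auto dest!: compact_imp_bounded simp: bounded_iff)
    then obtain B where B: "\<And>x. x \<in> K \<Longrightarrow> \<bar>g x\<bar> \<le> B" by blast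
    have "integrable lebesgue (\<lambda>x. B * f x)" using f by simp
    then show ?thesis
    proof (rule Bochner_Integration.integrable_bound)
      show "(\<lambda>x. f x * g x) \<in> borel_measurable lebesgue"
      proof -
        have "g \<in> borel_measurable lebesgue"
          by (intro measurable_completion) (simp add: borel_measurable_continuous_onI that)
        then show ?thesis using f by (intro borel_measurable_times) auto
      qed
      have "norm (f x * g x) \<le> norm (B * f x)" for x
      proof (cases "x \<in> K")
        case True
        then have "\<bar>g x\<bar> \<le> \<bar>B\<bar>" using B[OF True] by linarith
        then show ?thesis using mult_left_mono[of "\<bar>g x\<bar>" "\<bar>B\<bar>" "\<bar>f x\<bar>"] by (simp add: abs_mult mult.commute)
      qed (simp add: K)
      then show "AE x in lebesgue. norm (f x * g x) \<le> norm (B * f x)" by simp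
    qed
  qed
  define L where "L = (LINT x|lebesgue. \<bar>f x\<bar>)"
  have "\<bar>LINT x|lebesgue. f x * \<phi> x\<bar> \<le> e * L" if e: "e > 0" for e
  proof -
    obtain P where P: "real_polynomial_function P" "\<And>x. x \<in> K \<Longrightarrow> \<bar>\<phi> x - P x\<bar> < e"
      using Stone_Weierstrass_real_polynomial_function[OF K(1) continuous_on_subset[OF c] e] by auto
    have cP: "continuous_on UNIV P"
      using continuous_real_polymonial_function[OF P(1)] by (simp add: continuous_at_imp_continuous_on)
    have "(LINT x|lebesgue. f x * \<phi> x) = (LINT x|lebesgue. f x * (\<phi> x - P x))"
      using orth[OF P(1)] int[OF c] int[OF cP] by (simp add: right_diff_distrib)
    also have "\<bar>\<dots>\<bar> \<le> (LINT x|lebesgue. \<bar>f x * (\<phi> x - P x)\<bar>)"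
      by (rule integral_abs_bound)
    also have "\<dots> \<le> (LINT x|lebesgue. e * \<bar>f x\<bar>)"
    proof (rule integral_mono)
      show "integrable lebesgue (\<lambda>x. \<bar>f x * (\<phi> x - P x)\<bar>)"
        by (intro integrable_abs int continuous_on_diff c cP)
      show "\<bar>f x * (\<phi> x - P x)\<bar> \<le> e * \<bar>f x\<bar>" for x
        using K(2)[of x] P(2)[of x] mult_left_mono[of "\<bar>\<phi> x - P x\<bar>" e "\<bar>f x\<bar>"]
        by (cases "x \<in> K") (auto simp: abs_mult mult.commute)
    qed (use f in simp)
    finally show ?thesis by (simp add: L_def)
  qed
  note b = this
  show "(LINT x|lebesgue. f x * \<phi> x) = 0"
  proof (rule ccontr)
    assume "\<not> ?thesis"
    then have pos: "\<bar>LINT x|lebesgue. f x * \<phi> x\<bar> > 0" (is "?A > 0") by simp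
    have L: "L \<ge> 0" by (simp add: L_def)
    \<comment> \<open>The tolerance \<open>?A / (2 (L + 1))\<close> times \<open>L\<close> stays
      below \<open>?A\<close>; the added 1 covers \<open>L = 0\<close>.\<close>
    have "?A \<le> ?A / (2 * (L + 1)) * L" using b[of "?A / (2 * (L + 1))"] pos L by simp
    also have "\<dots> = ?A * (L / (2 * (L + 1)))" by simp
    also have "\<dots> < ?A * 1"
    proof (rule mult_strict_left_mono[OF _ pos])
      have *: "y / (2 * (y + 1)) < 1" if "y \<ge> 0" for y :: real using that by simp
      show "L / (2 * (L + 1)) < 1" by (rule *[OF L])
    qed
    finally show False by simp
  qed
qed

text \<open>A fixed bump \<open>g\<close>, positive exactly on \<open>(a, b)\<close>, gives
  \<open>v\<close> compact support without introducing other zeros there. All polynomial moments of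
  the product vanish, hence the product does, and \<open>g\<close> can be divided out.\<close>

lemma moments_imp_zero:
  fixes v :: "real^3 \<Rightarrow> complex"
  assumes v: "loc_integrable v"
    and mom: "\<And>e g. test1 I g \<Longrightarrow> (LINT x|lebesgue. v x * (monom3 p e x * g (sqd p x))) = 0"
    and ab: "{a..b} \<subseteq> I"
  shows "AE x in lebesgue. a < sqd p x \<and> sqd p x < b \<longrightarrow> v x = 0"
proof -
  define g where "g s = flat 0 (s - a) * flat 0 (b - s)" for s
  have fl: "smooth_on UNIV (\<lambda>t. flat 0 (q t))" if "smooth_on UNIV q" for q :: "real \<Rightarrow> real"
    by (rule smooth_on_compose[OF _ _ that smooth_flat]) auto
  have "smooth_on UNIV g" unfolding g_def[abs_def]
    by (intro smooth_on_mult fl smooth_on_diff smooth_on_id) auto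
  then have sg: "smooth_on UNIV (\<lambda>s. complex_of_real (g s))"
    by (rule smooth_on_bounded_linear[OF bounded_linear_of_real open_UNIV])
  have g0: "g s = 0" if "s \<notin> {a..b}" for s using that by (auto simp: g_def flat_def)
  have gpos: "g s > 0" if "a < s" "s < b" for s using that by (auto simp: g_def flat_def)
  have t: "test1 I (\<lambda>s. of_real (g s))" unfolding test1_def
    using sg ab g0 by (auto intro!: exI[of _ "{a..b}"])
  define w where "w x = v x * of_real (g (sqd p x))" for x
  define K where "K = {x. sqd p x \<in> {a..b}}"
  have K: "compact K" unfolding K_def by (rule compact_sqd_preimage) simp
  have w0: "w x = 0" if "x \<notin> K" for x using that g0 by (simp add: w_def K_def)
  have int: "integrable lebesgue (\<lambda>x. v x * (monom3 p e x * of_real (g (sqd p x))))" for e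
    by (rule loc_integrable_test[OF v test_fn_monom3_radial[OF t]])
  have "monom3 p (\<lambda>_. 0) x = 1" for x by (simp add: monom3_def)
  then have wi: "integrable lebesgue w" using int[of "\<lambda>_. 0"] by (simp add: w_def[abs_def])
  have real_m: "monom3 p e x = of_real (\<Prod>i\<in>UNIV. (x $ i - p $ i) ^ e i)" for e x
    by (simp add: monom3_def)
  \<comment> \<open>\<open>L\<close> will be \<open>Re\<close> or \<open>Im\<close>; its second
    property lets the real polynomial weights pass through.\<close>
  have "AE x in lebesgue. L (w x) = 0" if L: "bounded_linear L" "\<And>c z. L (z * complex_of_real c) = L z * c" for L :: "complex \<Rightarrow> real"
  proof (rule AE_zero_if_orthogonal_polynomials[OF integrable_bounded_linear[OF L(1) wi] K])
    show "L (w x) = 0" if "x \<notin> K" for x using w0[OF that] bounded_linear.linear[OF L(1), THEN linear_0] by simp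
    have mon0: "integrable lebesgue (\<lambda>x. L (w x) * (\<Prod>i\<in>UNIV. (x $ i - p $ i) ^ e i)) \<and>
       (LINT x|lebesgue. L (w x) * (\<Prod>i\<in>UNIV. (x $ i - p $ i) ^ e i)) = 0" for e
    proof -
      have eq: "L (w x) * (\<Prod>i\<in>UNIV. (x $ i - p $ i) ^ e i) = L (v x * (monom3 p e x * of_real (g (sqd p x))))" for x
        by (simp add: w_def real_m mult_ac flip: L(2) del: of_real_prod of_real_power of_real_diff)
      have "(LINT x|lebesgue. L (v x * (monom3 p e x * of_real (g (sqd p x))))) = 0"
        using integral_bounded_linear[OF L(1) int[of e]] mom[OF t, of e] bounded_linear.linear[OF L(1), THEN linear_0]
        by simp
      then show ?thesis unfolding eq using integrable_bounded_linear[OF L(1) int[of e]] by simp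
    qed
    have span: "integrable lebesgue (\<lambda>x. L (w x) * F x) \<and> (LINT x|lebesgue. L (w x) * F x) = 0"
      if "mono_span p F" for F
      using that
    proof (induction rule: mono_span.induct)
      case (base c e)
      have "(\<lambda>x. L (w x) * (c * (\<Prod>i\<in>UNIV. (x $ i - p $ i) ^ e i))) = (\<lambda>x. c * (L (w x) * (\<Prod>i\<in>UNIV. (x $ i - p $ i) ^ e i)))"
        by (simp add: mult_ac)
      then show ?case using mon0[of e] by simp
    next
      case (add F G) then show ?case by (simp add: distrib_left)
    qed
    fix P :: "real^3 \<Rightarrow> real" assume "real_polynomial_function P"
    from mono_span_mult_poly[OF this mono_span.base[of p 1 "\<lambda>_. 0"]]
    have "mono_span p P" by simp
    then show "(LINT x|lebesgue. L (w x) * P x) = 0" using span by blast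
  qed
  from this[of Re] this[of Im] have "AE x in lebesgue. Re (w x) = 0" "AE x in lebesgue. Im (w x) = 0"
    by (simp_all add: bounded_linear_Re bounded_linear_Im)
  then show ?thesis
  proof eventually_elim
    case (elim x)
    then have "w x = 0" by (simp add: complex_eq_iff)
    then show ?case using gpos[of "sqd p x"] by (auto simp: w_def)
  qed
qed

section \<open>Locality of the radial operator and unique continuation in balls\<close>

lemma vd_cong: 
  assumes "open S" "s \<in> S" "\<And>t. t \<in> S \<Longrightarrow> f t = g t" shows "vd f s = vd g s"
proof -
  have "(f has_vector_derivative D) (at s) \<longleftrightarrow> (g has_vector_derivative D) (at s)" for D
    using has_vector_derivative_transform_within_open[OF _ assms(1,2), of f D g]
      has_vector_derivative_transform_within_open[OF _ assms(1,2), of g D f] assms(3) by auto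
  then show ?thesis by (simp add: vd_def vector_derivative_def)
qed

lemma bessel_op_cong:
  assumes "open S" "s \<in> S" "\<And>t. t \<in> S \<Longrightarrow> f t = g t" shows "bessel_op \<kappa> d f s = bessel_op \<kappa> d g s"
proof -
  have 1: "vd f t = vd g t" if "t \<in> S" for t using vd_cong[OF assms(1) that] assms(3) by blast
  then have "vd (vd f) s = vd (vd g) s" using vd_cong[OF assms(1,2)] by blast
  then show ?thesis using 1 assms by (simp add: bessel_op_def)
qed

lemma test1_bounds:
  assumes "test1 {l<..<u} g" "l < u"
  obtains a b where "l < a" "a < b" "b < u" "test1 {a<..<b} g"
proof -
  obtain K where K: "smooth_on UNIV g" "compact K" "K \<subseteq> {l<..<u}" "\<And>s. s \<notin> K \<Longrightarrow> g s = 0"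
    using assms(1) by (auto simp: test1_def)
  show ?thesis
  proof (cases "K = {}")
    case True
    obtain a b where "l < a" "a < b" "b < u" using assms(2) dense by meson
    moreover have "test1 {a<..<b} g"
      unfolding test1_def using K True by (intro conjI exI[of _ "{}"]) auto
    ultimately show ?thesis using that by blast
  next
    case False
    obtain m where m: "m \<in> K" "\<And>s. s \<in> K \<Longrightarrow> m \<le> s" using compact_attains_inf[OF K(2) False] by blast
    obtain n where n: "n \<in> K" "\<And>s. s \<in> K \<Longrightarrow> s \<le> n" using compact_attains_sup[OF K(2) False] by blast
    have "l < m" "n < u" "m \<le> n" using K(3) m n by auto
    then obtain a b where ab: "l < a" "a < m" "n < b" "b < u" using dense by meson
    have "K \<subseteq> {a<..<b}" using m(2) n(2) ab by fastforce
    then show ?thesis using that[of a b] ab \<open>m \<le> n\<close> K by (auto simp: test1_def)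
  qed
qed

text \<open>The solution is chosen to vanish beyond the support of \<open>g\<close>, so its only
  defect is the singularity at \<open>s = 0\<close>. The cutoff that removes it acts inside the ball
  where \<open>v\<close> is zero, and the error in \<open>solve\<close> is exactly 0.\<close>

lemma ucp_ball:
  fixes v :: "real^3 \<Rightarrow> complex"
  assumes v: "loc_integrable v" and k: "k \<noteq> 0" and r: "0 < r" "r < R"
    and zero: "AE x in lebesgue. x \<in> ball p r \<longrightarrow> v x = 0"
    and helm: "\<And>f. test_fn (ball p R) f \<Longrightarrow>
       (LINT x|lebesgue. v x * ((\<Sum>j\<in>UNIV. pd j (pd j f) x) + of_real (k^2) * f x)) = 0"
  shows "AE x in lebesgue. x \<in> ball p R \<longrightarrow> v x = 0"
proof -
  have rR: "0 < r^2" "r^2 < R^2" using r by (auto simp: power_strict_mono)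
  have in_ball: "sqd p x < t^2 \<longleftrightarrow> x \<in> ball p t" if "t > 0" for x t
    using that real_less_rsqrt[of "norm (x-p)" "t^2"] power_strict_mono[of "norm (x-p)" t 2]
    by (auto simp: sqd_def dist_norm norm_minus_commute power2_less_imp_less)
  let ?I = "{0<..<R^2}"
  have sub: "{x. sqd p x \<in> ?I} \<subseteq> ball p R" using in_ball[of R] r by auto
  have mom: "(LINT x|lebesgue. v x * (monom3 p e x * g (sqd p x))) = 0" if g: "test1 ?I g" for e g
  proof (rule radial_moments_zero[OF v _ _ g])
    show "(LINT x|lebesgue. v x * ((\<Sum>j\<in>UNIV. pd j (pd j f) x) + of_real (k^2) * f x)) = 0"
      if "test_fn {x. sqd p x \<in> ?I} f" for f
      by (rule helm[OF test_fn_subset[OF that sub]])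
    fix e :: "3 \<Rightarrow> nat" and g \<epsilon> assume g: "test1 ?I g" and "\<epsilon> > (0::real)"
    let ?d = "\<Sum>j\<in>UNIV. e j"
    obtain a b where ab: "0 < a" "a < b" "b < R^2" and gt: "test1 {a<..<b} g"
    proof -
      have "0 < R^2" using rR by linarith
      from test1_bounds[OF g this] that show thesis by metis
    qed
    obtain A B where AB: "\<And>s. b \<le> s \<Longrightarrow> A s = A b \<and> B s = B b" and sol: "\<And>cA cB h. h = (\<lambda>s. (A s - cA) * hk k ?d s + (B s - cB) * hk (- k) ?d s) \<Longrightarrow> smooth_on {0<..} h \<and>
       (\<forall>s>0. vd h s = (A s - cA) * hk k (Suc ?d) s + (B s - cB) * hk (- k) (Suc ?d) s \<and>
              bessel_op (of_real (k^2)) ?d h s = g s)"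
      by (rule bessel_solve[OF gt ab(1) k, of ?d]) blast
    define h where "h s = (A s - A b) * hk k ?d s + (B s - B b) * hk (- k) ?d s" for s
    have h: "smooth_on {0<..} h" "\<And>s. s > 0 \<Longrightarrow> bessel_op (of_real (k^2)) ?d h s = g s"
      using sol[of h "A b" "B b"] by (auto simp: h_def[abs_def])
    have h0: "h s = 0" if "b \<le> s" for s using AB[OF that] by (simp add: h_def)
    \<comment> \<open>Since \<open>a2 < r^2\<close>, all points with \<open>sqd p x \<le> a2\<close>
      lie in the zero ball; the cutoff acts between \<open>a2 / 2\<close> and
      \<open>a2\<close>.\<close>
    define a2 where "a2 = min a (r^2) / 2"
    have a2: "0 < a2" "a2 < a" "a2 < r^2" 
    proof -
      have "0 < min a (r^2)" "min a (r^2) \<le> a" "min a (r^2) \<le> r^2" using ab rR by auto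
      then show "0 < a2" "a2 < a" "a2 < r^2" using ab(1) rR(1) unfolding a2_def by linarith+
    qed
    obtain \<eta> where \<eta>: "smooth_on UNIV \<eta>" "\<And>t. t \<le> a2 / 2 \<Longrightarrow> \<eta> t = 0" "\<And>t. t \<ge> a2 \<Longrightarrow> \<eta> t = (1::real)"
      using smooth_cutoff[of "a2 / 2" a2] a2 by auto
    define H where "H s = of_real (\<eta> s) * h s" for s
    have smH: "smooth_on UNIV H"
    proof -
      have "smooth_on {0<..} H" unfolding H_def[abs_def]
        by (intro smooth_on_mult h(1) smooth_on_bounded_linear[OF bounded_linear_of_real] smooth_on_subset[OF \<eta>(1)]) auto
      moreover have "smooth_on {..<a2/2} H"
        using smooth_on_cong[of "{..<a2/2}" H "\<lambda>_. 0"] \<eta>(2) by (simp add: H_def)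
      ultimately have "smooth_on ({0<..} \<union> {..<a2/2}) H" by (rule smooth_on_Un)
      moreover have "{0<..} \<union> {..<a2/2} = (UNIV::real set)" using a2 by auto
      ultimately show ?thesis by simp
    qed
    have "H s = 0" if "s \<notin> {a2/2..b}" for s using that \<eta>(2)[of s] h0[of s] by (auto simp: H_def)
    then have tH: "test1 ?I H" unfolding test1_def
      using smH a2 ab by (auto intro!: exI[of _ "{a2/2..b}"])
    have eq: "bessel_op (of_real (k^2)) ?d H s = g s" if "a2 < s" for s
    proof -
      have "bessel_op (of_real (k^2)) ?d H s = bessel_op (of_real (k^2)) ?d h s"
        by (rule bessel_op_cong[of "{a2<..}"]) (use that \<eta>(3) in \<open>auto simp: H_def\<close>)
      then show ?thesis using h(2)[of s] that a2 by simp
    qed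
    have "AE x in lebesgue. v x * (monom3 p e x * (bessel_op (of_real (k^2)) ?d H (sqd p x) - g (sqd p x))) = 0"
      using zero
    proof eventually_elim
      case (elim x)
      show ?case
      proof (cases "a2 < sqd p x")
        case True then show ?thesis using eq by simp
      next
        case False
        then have "x \<in> ball p r" using in_ball[of r x] r a2 by auto
        then show ?thesis using elim by simp
      qed
    qed
    from integral_eq_zero_AE[OF this] 
    show "\<exists>h. test1 ?I h \<and> norm (LINT x|lebesgue. v x * (monom3 p e x * (bessel_op (of_real (k^2)) ?d h (sqd p x) - g (sqd p x)))) < \<epsilon>"
      using tH \<open>\<epsilon> > 0\<close> by (intro exI[of _ H]) simp
  qed
  \<comment> \<open>Moments control only compact subintervals of \<open>(0, R^2)\<close>: countably
    many of them exhaust the upper end, and below \<open>r^2\<close> the hypothesis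
    \<open>zero\<close> takes over.\<close>
  have "AE x in lebesgue. \<forall>n. r^2/2 < sqd p x \<and> sqd p x < R^2 - inverse (real (Suc n)) \<longrightarrow> v x = 0"
  proof (subst AE_all_countable, rule allI)
    fix n
    have "inverse (real (Suc n)) > 0" by simp
    then have "0 < s \<and> s < R^2" if "s \<in> {r^2/2..R^2 - inverse (real (Suc n))}" for s
      using rR(1) that unfolding atLeastAtMost_iff by linarith
    then have "{r^2/2..R^2 - inverse (real (Suc n))} \<subseteq> ?I" by auto
    from moments_imp_zero[OF v mom this]
    show "AE x in lebesgue. r^2/2 < sqd p x \<and> sqd p x < R^2 - inverse (real (Suc n)) \<longrightarrow> v x = 0" .
  qed
  with zero show ?thesis
  proof eventually_elim
    case (elim x)
    show ?case
    proof
      assume x: "x \<in> ball p R"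
      show "v x = 0"
      proof (cases "x \<in> ball p r")
        case False
        then have "sqd p x \<ge> r^2" using in_ball[of r x] r by auto
        then have "r^2/2 < sqd p x" using rR(1) by linarith
        moreover have "sqd p x < R^2" using in_ball[of R x] r x by auto
        then obtain n where "inverse (real (Suc n)) < R^2 - sqd p x"
          using reals_Archimedean[of "R^2 - sqd p x"] by auto
        ultimately show ?thesis using elim(2) by (metis less_diff_eq add.commute)
      qed (use elim in auto)
    qed
  qed
qed

section \<open>Cutting off at large radius, and Rellich's lemma\<close>

lemma norm_monom3_le: "norm (monom3 0 e x) \<le> norm x ^ (\<Sum>j\<in>UNIV. e j)"
proof -
  have "norm (monom3 0 e x) = (\<Prod>i\<in>UNIV. \<bar>x $ i\<bar> ^ e i)"
    by (simp add: monom3_def norm_power flip: prod_norm)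
  also have "\<dots> \<le> (\<Prod>i\<in>UNIV. norm x ^ e i)"
    by (intro prod_mono conjI power_mono component_le_norm_cart) auto
  finally show ?thesis by (simp add: power_sum)
qed

lemma vd_of_real_scale:
  assumes "smooth_on UNIV \<eta>"
  shows "vd (\<lambda>s. complex_of_real (\<eta> (s / N))) s = of_real (vector_derivative \<eta> (at (s / N)) / N)"
proof -
  have "(\<eta> has_vector_derivative vector_derivative \<eta> (at (s / N))) (at (s / N))"
    using smooth_on_vector_derivative(2)[OF assms] by simp
  then have 1: "(\<eta> has_real_derivative vector_derivative \<eta> (at (s / N))) (at (s / N))"
    by (simp add: has_real_derivative_iff_has_vector_derivative)
  have "((\<lambda>s. \<eta> (s / N)) has_real_derivative vector_derivative \<eta> (at (s / N)) * (1 / N)) (at s)"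
    by (rule DERIV_chain2[where f=\<eta> and g="\<lambda>s. s / N", OF 1]) (rule DERIV_cdivide[OF DERIV_ident])
  then have "((\<lambda>s. complex_of_real (\<eta> (s / N))) has_vector_derivative of_real (vector_derivative \<eta> (at (s / N)) * (1 / N))) (at s)"
    unfolding has_real_derivative_iff_has_vector_derivative
    using bounded_linear.has_vector_derivative[OF bounded_linear_of_real] by fastforce
  then show ?thesis by (simp add: vd_def vector_derivative_at)
qed

lemma vd_mult:
  assumes "smooth_on S f" "smooth_on S g" "open S" "s \<in> S"
  shows "vd (\<lambda>s. f s * g s) s = f s * vd g s + vd f s * g s"
  using has_vector_derivative_mult[OF has_vd[OF assms(1,3,4)] has_vd[OF assms(2,3,4)]]
  unfolding vd_def[of "\<lambda>s. f s * g s"] by (rule vector_derivative_at)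

lemma vd_add:
  assumes "smooth_on S f" "smooth_on S g" "open S" "s \<in> S"
  shows "vd (\<lambda>s. f s + g s) s = vd f s + vd g s"
  using has_vector_derivative_add[OF has_vd[OF assms(1,3,4)] has_vd[OF assms(2,3,4)]]
  unfolding vd_def[of "\<lambda>s. f s + g s"] by (rule vector_derivative_at)

text \<open>The bracket is the commutator of the radial operator with multiplication by
  \<open>f\<close>; it contains only derivatives of \<open>f\<close>, so it lives where a cutoff
  varies.\<close>

lemma bessel_op_mult:
  assumes f: "smooth_on S f" and g: "smooth_on S g" and S: "open S" "s \<in> S"
  shows "bessel_op \<kappa> d (\<lambda>s. f s * g s) s = f s * bessel_op \<kappa> d g s
     + (4 * of_real s * (2 * vd f s * vd g s + vd (vd f) s * g s) + (6 + 4 * of_nat d) * vd f s * g s)"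
proof -
  note v = smooth_on_vd[OF f S(1)] smooth_on_vd[OF g S(1)]
  have "vd (vd (\<lambda>s. f s * g s)) s = vd (\<lambda>s. f s * vd g s + vd f s * g s) s"
    by (rule vd_cong[OF S]) (rule vd_mult[OF f g S(1)])
  also have "\<dots> = f s * vd (vd g) s + 2 * (vd f s * vd g s) + vd (vd f) s * g s"
    by (subst vd_add[OF smooth_on_mult[OF S(1) f v(2)] smooth_on_mult[OF S(1) v(1) g] S])
       (simp add: vd_mult[OF f v(2) S] vd_mult[OF v(1) g S])
  finally show ?thesis by (simp add: bessel_op_def vd_mult[OF f g S] algebra_simps)
qed

lemma bounded_on_interval:
  fixes f :: "real \<Rightarrow> real"
  assumes "smooth_on UNIV f" obtains B where "B \<ge> 0" "\<And>t. t \<in> {a..b} \<Longrightarrow> \<bar>f t\<bar> \<le> B"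
proof -
  have "compact (f ` {a..b})"
    by (rule compact_continuous_image[OF continuous_on_subset[OF smooth_on_continuous_on[OF assms]]]) auto
  then have "\<exists>B. \<forall>x\<in>{a..b}. \<bar>f x\<bar> \<le> B" by (auto dest!: compact_imp_bounded simp: bounded_iff)
  then obtain B where "\<And>x. x \<in> {a..b} \<Longrightarrow> \<bar>f x\<bar> \<le> B" by blast
  then show ?thesis using that[of "max 0 B"] by fastforce
qed

text \<open>The solution that is zero before \<open>a\<close> reaches infinity with size
  \<open>s^(-(d+1)/2)\<close>, its derivative with size \<open>s^(-(d+2)/2)\<close>. A cutoff at
  scale \<open>N\<close> has derivatives \<open>O(1/s)\<close> and \<open>O(1/s^2)\<close> on its
  shell, so the commutator is \<open>O(s^(-(d+2)/2))\<close>, led by \<open>8 s E' h'\<close>. That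
  \<open>C\<close> does not depend on \<open>N\<close> is essential.\<close>

lemma outgoing_cutoff:
  assumes g: "test1 {a<..<b} g" and a: "0 < a" and c: "c < a" and k: "k \<noteq> 0"
  obtains C where "C \<ge> 0"
    "\<And>N. N \<ge> max b 1 \<Longrightarrow> \<exists>H. test1 {c<..} H \<and>
      (\<forall>s. norm (bessel_op (of_real (k^2)) d H s - g s) \<le>
         (if N \<le> s \<and> s \<le> 2 * N then C * inverse (sqrt s) ^ (d + 2) else 0))"
proof -
  obtain A B where AB0: "\<And>s. s \<le> a \<Longrightarrow> A s = 0 \<and> B s = 0"
    and AB: "\<And>s. b \<le> s \<Longrightarrow> A s = A b \<and> B s = B b" and sol: "\<And>cA cB h. h = (\<lambda>s. (A s - cA) * hk k d s + (B s - cB) * hk (- k) d s) \<Longrightarrow> smooth_on {0<..} h \<and>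
       (\<forall>s>0. vd h s = (A s - cA) * hk k (Suc d) s + (B s - cB) * hk (- k) (Suc d) s \<and>
              bessel_op (of_real (k^2)) d h s = g s)"
    by (rule bessel_solve[OF g a k, of d]) blast
  define h where "h s = A s * hk k d s + B s * hk (- k) d s" for s
  have h: "smooth_on {0<..} h" "\<And>s. s > 0 \<Longrightarrow> bessel_op (of_real (k^2)) d h s = g s"
    "\<And>s. s > 0 \<Longrightarrow> vd h s = A s * hk k (Suc d) s + B s * hk (- k) (Suc d) s"
    using sol[of h 0 0] by (auto simp: h_def[abs_def])
  have h0: "h s = 0" if "s \<le> a" for s using AB0[OF that] by (simp add: h_def)
  have g0: "g s = 0" if "b \<le> s" for s using g that by (fastforce simp: test1_def)
  obtain C1 where C1: "C1 \<ge> 0" "\<And>s. s \<ge> max b 1 \<Longrightarrow> norm (h s) \<le> C1 * inverse (sqrt s) ^ Suc d"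
    "\<And>s. s \<ge> max b 1 \<Longrightarrow> norm (vd h s) \<le> C1 * inverse (sqrt s) ^ Suc (Suc d)"
  proof -
    have "\<exists>C\<ge>0. \<forall>s\<ge>max b 1. norm (A s * hk k n s + B s * hk (- k) n s) \<le> C * inverse (sqrt s) ^ Suc n" for n
    proof -
      obtain C D where C: "C \<ge> 0" "\<And>s. s \<ge> 1 \<Longrightarrow> norm (hk k n s) \<le> C * inverse (sqrt s) ^ Suc n"
        and D: "D \<ge> 0" "\<And>s. s \<ge> 1 \<Longrightarrow> norm (hk (-k) n s) \<le> D * inverse (sqrt s) ^ Suc n"
        using hk_bound[of k n] hk_bound[of "-k" n] by blast
      have "norm (A s * hk k n s + B s * hk (- k) n s) \<le> (norm (A b) * C + norm (B b) * D) * inverse (sqrt s) ^ Suc n"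
        if s: "s \<ge> max b 1" for s
      proof -
        have ab: "A s = A b" "B s = B b" using AB[of s] s by auto
        have "norm (A b * hk k n s) \<le> norm (A b) * (C * inverse (sqrt s) ^ Suc n)"
          unfolding norm_mult by (rule mult_left_mono[OF C(2)]) (use s in auto)
        moreover have "norm (B b * hk (-k) n s) \<le> norm (B b) * (D * inverse (sqrt s) ^ Suc n)"
          unfolding norm_mult by (rule mult_left_mono[OF D(2)]) (use s in auto)
        ultimately have "norm (A b * hk k n s + B b * hk (-k) n s)
            \<le> norm (A b) * (C * inverse (sqrt s) ^ Suc n) + norm (B b) * (D * inverse (sqrt s) ^ Suc n)"
          by (rule norm_triangle_mono)
        then show ?thesis unfolding ab by (simp only: distrib_right mult.assoc)
      qed
      then show ?thesis using C(1) D(1) by (intro exI[of _ "norm (A b) * C + norm (B b) * D"]) auto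
    qed
    from this[of d] this[of "Suc d"] obtain C D where C: "C \<ge> 0" "D \<ge> 0"
      "\<And>s. s \<ge> max b 1 \<Longrightarrow> norm (A s * hk k d s + B s * hk (- k) d s) \<le> C * inverse (sqrt s) ^ Suc d"
      "\<And>s. s \<ge> max b 1 \<Longrightarrow> norm (A s * hk k (Suc d) s + B s * hk (- k) (Suc d) s) \<le> D * inverse (sqrt s) ^ Suc (Suc d)"
      by blast
    show thesis
    proof (rule that[of "max C D"])
      fix s assume s: "s \<ge> max b 1"
      have u: "inverse (sqrt s) \<ge> 0" using s by simp
      show "norm (h s) \<le> max C D * inverse (sqrt s) ^ Suc d"
        unfolding h_def
        by (rule order_trans[OF C(3)[OF s] mult_right_mono[OF max.cobounded1 zero_le_power[OF u]]])
      show "norm (vd h s) \<le> max C D * inverse (sqrt s) ^ Suc (Suc d)"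
      proof -
        have "vd h s = A s * hk k (Suc d) s + B s * hk (- k) (Suc d) s" using h(3)[of s] s by simp
        then show ?thesis
          using order_trans[OF C(4)[OF s] mult_right_mono[OF max.cobounded2 zero_le_power[OF u]]] by metis
      qed
    next
      show "max C D \<ge> 0" using C(1) by simp
    qed
  qed
  obtain \<theta> :: "real \<Rightarrow> real" where \<theta>: "smooth_on UNIV \<theta>" "\<And>t. t \<le> 1 \<Longrightarrow> \<theta> t = 0" "\<And>t. t \<ge> 2 \<Longrightarrow> \<theta> t = (1::real)"
    using smooth_cutoff[of 1 2] by auto
  define \<eta> where "\<eta> t = 1 - \<theta> t" for t
  have \<eta>: "smooth_on UNIV \<eta>" "\<And>t. t \<le> 1 \<Longrightarrow> \<eta> t = 1" "\<And>t. t \<ge> 2 \<Longrightarrow> \<eta> t = 0"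
    unfolding \<eta>_def[abs_def] using \<theta> by (auto intro!: smooth_on_diff)
  define \<eta>1 where "\<eta>1 t = vector_derivative \<eta> (at t)" for t
  define \<eta>2 where "\<eta>2 t = vector_derivative \<eta>1 (at t)" for t
  have sm1: "smooth_on UNIV \<eta>1" unfolding \<eta>1_def[abs_def] by (rule smooth_on_vector_derivative[OF \<eta>(1) open_UNIV])
  have sm2: "smooth_on UNIV \<eta>2" unfolding \<eta>2_def[abs_def] by (rule smooth_on_vector_derivative[OF sm1 open_UNIV])
  have van: "vector_derivative f (at t) = 0" if "open S" "t \<in> S" "\<And>u. u \<in> S \<Longrightarrow> f u = c" for f :: "real \<Rightarrow> real" and c S t
  proof -
    have "((\<lambda>_. c) has_vector_derivative 0) (at t)" by simp
    then have "(f has_vector_derivative 0) (at t)"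
      by (rule has_vector_derivative_transform_within_open[OF _ that(1,2)]) (use that(3) in auto)
    then show ?thesis by (rule vector_derivative_at)
  qed
  have v1: "\<eta>1 t = 0" if "t < 1 \<or> t > 2" for t
    unfolding \<eta>1_def using that van[of "{..<1}" t \<eta> 1] van[of "{2<..}" t \<eta> 0] \<eta> by auto
  have v2: "\<eta>2 t = 0" if "t < 1 \<or> t > 2" for t
    unfolding \<eta>2_def using that van[of "{..<1}" t \<eta>1 0] van[of "{2<..}" t \<eta>1 0] v1 by auto
  obtain B1 where B1: "B1 \<ge> 0" "\<And>t. t \<in> {1..2} \<Longrightarrow> \<bar>\<eta>1 t\<bar> \<le> B1" using bounded_on_interval[OF sm1] by metis
  obtain B2 where B2: "B2 \<ge> 0" "\<And>t. t \<in> {1..2} \<Longrightarrow> \<bar>\<eta>2 t\<bar> \<le> B2" using bounded_on_interval[OF sm2] by metis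
  \<comment> \<open>The summands bound the three commutator terms; their factors come from
    \<open>s / N \<le> 2\<close> and \<open>1 / N \<le> 2 / s\<close> on the shell.\<close>
  define C where "C = 16 * B1 * C1 + 16 * B2 * C1 + (6 + 4 * real d) * 2 * B1 * C1"
  have "\<exists>H. test1 {c<..} H \<and>
      (\<forall>s. norm (bessel_op (of_real (k^2)) d H s - g s) \<le>
         (if N \<le> s \<and> s \<le> 2 * N then C * inverse (sqrt s) ^ (d + 2) else 0))" if N: "N \<ge> max b 1" for N
  proof -
    define E where "E s = complex_of_real (\<eta> (s / N))" for s
    have N1: "N \<ge> 1" "N \<ge> b" using N by auto
    have smq: "smooth_on UNIV (\<lambda>s. q (s / N))" if "smooth_on UNIV q" for q :: "real \<Rightarrow> real"
    proof (rule smooth_on_compose[OF _ _ _ that])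
      show "smooth_on UNIV (\<lambda>s. s / N)" by (rule smooth_on_linear[OF bounded_linear_divide open_UNIV])
    qed auto
    have smE: "smooth_on UNIV E" unfolding E_def[abs_def]
      by (intro smooth_on_bounded_linear[OF bounded_linear_of_real] smq \<eta>(1)) auto
    have E1: "vd E s = of_real (\<eta>1 (s / N) / N)" for s
      unfolding E_def[abs_def] \<eta>1_def by (rule vd_of_real_scale[OF \<eta>(1)])
    have E2: "vd (vd E) s = of_real (\<eta>2 (s / N) / N / N)" for s
    proof -
      have "vd E = (\<lambda>s. complex_of_real (1 / N) * of_real (\<eta>1 (s / N)))" by (simp add: E1 fun_eq_iff)
      then have "vd (vd E) s = vd (\<lambda>s. complex_of_real (1 / N) * of_real (\<eta>1 (s / N))) s" by simp
      also have "\<dots> = of_real (1 / N) * vd (\<lambda>s. of_real (\<eta>1 (s / N))) s + vd (\<lambda>_. of_real (1 / N)) s * of_real (\<eta>1 (s / N))"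
        by (rule vd_mult[of UNIV]) (auto intro!: smooth_on_bounded_linear[OF bounded_linear_of_real] smq sm1)
      also have "vd (\<lambda>_. complex_of_real (1 / N)) s = 0" by (simp add: vd_def)
      finally show ?thesis by (simp add: vd_of_real_scale[OF sm1] \<eta>2_def)
    qed
    define H where "H s = E s * h s" for s
    have smH: "smooth_on UNIV H"
    proof -
      have "smooth_on {0<..} H" unfolding H_def[abs_def]
        by (intro smooth_on_mult h(1) smooth_on_subset[OF smE]) auto
      moreover have "smooth_on {..<a} H"
        using smooth_on_cong[of "{..<a}" H "\<lambda>_. 0"] h0 by (simp add: H_def)
      ultimately have "smooth_on ({0<..} \<union> {..<a}) H" by (rule smooth_on_Un)
      moreover have "{0<..} \<union> {..<a} = (UNIV::real set)" using a by auto
      ultimately show ?thesis by simp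
    qed
    have "H s = 0" if "s \<notin> {a..2*N}" for s
    proof -
      have "s < a \<or> s / N \<ge> 2" using that N1 by (auto simp: field_simps)
      then show ?thesis using h0[of s] \<eta>(3)[of "s / N"] by (auto simp: H_def E_def)
    qed
    then have tH: "test1 {c<..} H" unfolding test1_def
      using smH c by (auto intro!: exI[of _ "{a..2*N}"])
    have "norm (bessel_op (of_real (k^2)) d H s - g s) \<le>
         (if N \<le> s \<and> s \<le> 2 * N then C * inverse (sqrt s) ^ (d + 2) else 0)" if s: "s > 0" for s
    proof -
      \<comment> \<open>The cutoff equals 1 on the support of \<open>g\<close>, because
        \<open>N \<ge> b\<close>.\<close>
      have Eg: "E s * g s = g s"
      proof (cases "s \<le> N")
        case True then have "s / N \<le> 1" using N1 by simp
        then show ?thesis using \<eta>(2) by (simp add: E_def)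
      next
        case False then show ?thesis using g0[of s] N1 by simp
      qed
      have "bessel_op (of_real (k^2)) d H s - g s = 4 * of_real s * (2 * vd E s * vd h s + vd (vd E) s * h s) + (6 + 4 * of_nat d) * vd E s * h s"
        unfolding H_def[abs_def]
        by (subst bessel_op_mult[OF smooth_on_subset[OF smE] h(1)]) (use s h(2) Eg in auto)
      then have nb: "norm (bessel_op (of_real (k^2)) d H s - g s) = norm (4 * of_real s * (2 * vd E s * vd h s + vd (vd E) s * h s) + (6 + 4 * of_nat d) * vd E s * h s)"
        by simp
      show ?thesis
      proof (cases "N \<le> s \<and> s \<le> 2 * N")
        case False
        then have "s / N < 1 \<or> s / N > 2" using N1 by (auto simp: field_simps)
        then show ?thesis using v1 v2 unfolding if_not_P[OF False] nb E1 E2 by simp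
      next
        case True
        let ?u = "inverse (sqrt s)"
        have sN: "s / N \<in> {1..2}" "s \<ge> max b 1" using True N1 by (auto simp: field_simps)
        have u: "0 \<le> ?u" "?u \<le> 1" using sN(2) by (auto simp: inverse_le_1_iff)
        have n1: "1 / N \<le> 2 * ?u^2" using True N1 s by (simp add: power_inverse field_simps)
        have s1: "s * (1 / N) \<le> 2" using sN(1) by simp
        have d1: "norm (vd E s) \<le> B1 * (1 / N)"
          unfolding E1 using B1(2)[OF sN(1)] N1 by (simp add: norm_divide divide_right_mono)
        have d2: "norm (vd (vd E) s) \<le> B2 * (1 / N) * (1 / N)"
        proof -
          have "norm (vd (vd E) s) = \<bar>\<eta>2 (s / N)\<bar> * (1 / N) * (1 / N)"
            unfolding E2 norm_of_real using N1 by (simp add: abs_divide)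
          then show ?thesis using B2(2)[OF sN(1)] N1 by (simp only:) (intro mult_right_mono, auto)
        qed
        note hb = C1(2)[OF sN(2)] C1(3)[OF sN(2)]
        have t1: "norm (4 * of_real s * (2 * vd E s * vd h s)) \<le> 16 * B1 * C1 * ?u ^ (d + 2)"
        proof -
          have "norm (4 * of_real s * (2 * vd E s * vd h s)) = 8 * (s * norm (vd E s) * norm (vd h s))"
            using s by (simp add: norm_mult)
          also have "\<dots> \<le> 8 * (s * (B1 * (1 / N)) * (C1 * ?u ^ Suc (Suc d)))"
            using d1 hb(2) s N1 B1(1) by (intro mult_left_mono mult_mono) auto
          also have "\<dots> = 8 * ((s * (1 / N)) * (B1 * C1 * ?u ^ Suc (Suc d)))" by simp
          also have "\<dots> \<le> 8 * (2 * (B1 * C1 * ?u ^ Suc (Suc d)))"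
            using s1 B1(1) C1(1) u by (intro mult_left_mono mult_right_mono) auto
          finally show ?thesis by simp
        qed
        have low: "?u ^ Suc d * ?u^2 \<le> ?u ^ (d + 2)"
          unfolding power_add[symmetric] by (rule power_decreasing) (use u in auto)
        have t2: "norm (4 * of_real s * (vd (vd E) s * h s)) \<le> 16 * B2 * C1 * ?u ^ (d + 2)"
        proof -
          have "norm (4 * of_real s * (vd (vd E) s * h s)) = 4 * (s * norm (vd (vd E) s) * norm (h s))"
            using s by (simp add: norm_mult)
          also have "\<dots> \<le> 4 * (s * (B2 * (1 / N) * (1 / N)) * (C1 * ?u ^ Suc d))"
            using d2 hb(1) s N1 B2(1) by (intro mult_left_mono mult_mono) auto
          also have "\<dots> = 4 * ((s * (1 / N)) * (1 / N) * (B2 * C1 * ?u ^ Suc d))" by simp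
          also have "\<dots> \<le> 4 * (2 * (2 * ?u^2) * (B2 * C1 * ?u ^ Suc d))"
            using s1 n1 B2(1) C1(1) u N1 s by (intro mult_left_mono mult_right_mono mult_mono) auto
          also have "\<dots> = 16 * B2 * C1 * (?u ^ Suc d * ?u^2)" by (simp only: mult_ac)
          also have "\<dots> \<le> 16 * B2 * C1 * ?u ^ (d + 2)"
            using low B2(1) C1(1) by (intro mult_left_mono) auto
          finally show ?thesis .
        qed
        have t3: "norm ((6 + 4 * of_nat d) * vd E s * h s) \<le> (6 + 4 * real d) * 2 * B1 * C1 * ?u ^ (d + 2)"
        proof -
          have n6: "norm (6 + 4 * of_nat d :: complex) = 6 + 4 * real d"
            using norm_of_nat[of "6 + 4 * d", where 'a=complex] by simp
          have "norm ((6 + 4 * of_nat d) * vd E s * h s) = (6 + 4 * real d) * (norm (vd E s) * norm (h s))"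
            unfolding norm_mult n6 by simp
          also have "\<dots> \<le> (6 + 4 * real d) * ((B1 * (1 / N)) * (C1 * ?u ^ Suc d))"
            using d1 hb(1) N1 B1(1) by (intro mult_left_mono mult_mono) auto
          also have "\<dots> = (6 + 4 * real d) * ((1 / N) * (B1 * C1 * ?u ^ Suc d))" by simp
          also have "\<dots> \<le> (6 + 4 * real d) * ((2 * ?u^2) * (B1 * C1 * ?u ^ Suc d))"
            using n1 B1(1) C1(1) u by (intro mult_left_mono mult_right_mono) auto
          also have "\<dots> = (6 + 4 * real d) * 2 * B1 * C1 * (?u ^ Suc d * ?u^2)" by (simp only: mult_ac)
          also have "\<dots> \<le> (6 + 4 * real d) * 2 * B1 * C1 * ?u ^ (d + 2)"
            using low B1(1) C1(1) by (intro mult_left_mono) auto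
          finally show ?thesis .
        qed
        have "norm (4 * of_real s * (2 * vd E s * vd h s + vd (vd E) s * h s) + (6 + 4 * of_nat d) * vd E s * h s)
          \<le> 16 * B1 * C1 * ?u ^ (d + 2) + 16 * B2 * C1 * ?u ^ (d + 2) + (6 + 4 * real d) * 2 * B1 * C1 * ?u ^ (d + 2)"
          unfolding distrib_left[of "4 * of_real s"] by (intro norm_triangle_mono t1 t2 t3)
        also have "\<dots> = C * ?u ^ (d + 2)" unfolding C_def by (simp only: distrib_right)
        finally show ?thesis unfolding nb using True by simp
      qed
    qed
    moreover have "norm (bessel_op (of_real (k^2)) d H s - g s) = 0" if "s \<le> 0" for s
    proof -
      have "bessel_op (of_real (k^2)) d H s = bessel_op (of_real (k^2)) d (\<lambda>_. 0) s"
        by (rule bessel_op_cong[of "{..<a}"]) (use that a h0 in \<open>auto simp: H_def\<close>)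
      moreover have "vd (\<lambda>_. 0) = (\<lambda>_. 0)" by (simp add: vd_def fun_eq_iff)
      moreover have "g s = 0" using g that a by (fastforce simp: test1_def)
      ultimately show ?thesis by (simp add: bessel_op_def)
    qed
    moreover have "\<not> (N \<le> s \<and> s \<le> 2 * N)" if "s \<le> 0" for s using that N by simp
    ultimately have "norm (bessel_op (of_real (k^2)) d H s - g s) \<le>
         (if N \<le> s \<and> s \<le> 2 * N then C * inverse (sqrt s) ^ (d + 2) else 0)" for s
      by (cases "s > 0") (auto simp: not_less)
    then show ?thesis using tH by blast
  qed
  moreover have "C \<ge> 0" unfolding C_def using B1(1) B2(1) C1(1) by simp
  ultimately show ?thesis using that by blast
qed


lemma sqd_0: "sqd 0 x = (norm x)^2" by (simp add: sqd_def)

text \<open>On the shell the integrand is \<open>O(N^(-2))\<close>, and the shell has volume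
  \<open>O(N^(3/2))\<close>. With the decay \<open>|x|^(-1)\<close> of a general radiating field the
  same estimate would only give a bound of order 1, so this is where the vanishing of the far field
  enters.\<close>

lemma rellich:
  fixes v :: "real^3 \<Rightarrow> complex"
  assumes v: "loc_integrable v" and k: "k \<noteq> 0" and R: "R > 0"
    and decay: "AE x in lebesgue. norm x > R \<longrightarrow> norm (v x) \<le> D / (norm x)^2"
    and helm: "\<And>f. test_fn {x. norm x > R} f \<Longrightarrow>
       (LINT x|lebesgue. v x * ((\<Sum>j\<in>UNIV. pd j (pd j f) x) + of_real (k^2) * f x)) = 0"
  shows "AE x in lebesgue. norm x > R \<longrightarrow> v x = 0"
proof -
  let ?I = "{R^2<..}"
  have iff: "sqd 0 x > R^2 \<longleftrightarrow> norm x > R" for x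
    using R by (auto simp: sqd_0 intro: power_strict_mono dest: power_less_imp_less_base)
  have mom: "(LINT x|lebesgue. v x * (monom3 0 e x * g (sqd 0 x))) = 0" if g: "test1 ?I g" for e g
  proof (rule radial_moments_zero[OF v _ _ g])
    show "(LINT x|lebesgue. v x * ((\<Sum>j\<in>UNIV. pd j (pd j f) x) + of_real (k^2) * f x)) = 0"
      if "test_fn {x. sqd 0 x \<in> ?I} f" for f
      by (rule helm) (use that iff in simp)
    fix e :: "3 \<Rightarrow> nat" and g \<epsilon> assume g: "test1 ?I g" and \<epsilon>: "\<epsilon> > (0::real)"
    let ?d = "\<Sum>j\<in>UNIV. e j"
    obtain a b where ab: "R^2 < a" "a < b" and gt: "test1 {a<..<b} g"
    proof -
      obtain K where K: "smooth_on UNIV g" "compact K" "K \<subseteq> ?I" "\<And>s. s \<notin> K \<Longrightarrow> g s = 0"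
        using g by (auto simp: test1_def)
      obtain u where u: "\<And>s. s \<in> K \<Longrightarrow> s < u" "u > R^2"
      proof -
        obtain u where "\<And>s. s \<in> K \<Longrightarrow> \<bar>s\<bar> \<le> u"
          using compact_imp_bounded[OF K(2)] by (auto simp: bounded_iff)
        then show ?thesis by (intro that[of "max u (R^2) + 1"]) fastforce+
      qed
      have "test1 {R^2<..<u} g" unfolding test1_def using K u by (intro conjI exI[of _ K]) auto
      from test1_bounds[OF this u(2)] that show thesis by metis
    qed
    have a0: "a > 0" using ab R by (meson less_trans zero_less_power)
    obtain C where C: "C \<ge> 0"
      "\<And>N. N \<ge> max b 1 \<Longrightarrow> \<exists>H. test1 ?I H \<and>
      (\<forall>s. norm (bessel_op (of_real (k^2)) ?d H s - g s) \<le>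
         (if N \<le> s \<and> s \<le> 2 * N then C * inverse (sqrt s) ^ (?d + 2) else 0))"
      using outgoing_cutoff[OF gt a0 ab(1) k, of ?d] by metis
    define V where "V = measure lborel (ball (0::real^3) 1)"
    define M where "M = \<bar>D\<bar> * C"
    have M0: "M \<ge> 0" "V \<ge> 0" using C(1) by (auto simp: M_def V_def)
    \<comment> \<open>\<open>m\<close> is the square root of the scale \<open>N\<close>. The final
      bound is \<open>8 M V / m\<close>, with \<open>8 = 2^3\<close> from the radius
      \<open>2 m\<close>, and the second entry pushes it below \<open>\<epsilon>\<close>.\<close>
    define m where "m = max (max b 1) (8 * M * V / \<epsilon> + 1)"
    have m: "m \<ge> b" "m \<ge> 1" "8 * M * V / \<epsilon> < m" by (auto simp: m_def)
    define N where "N = m^2"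
    have mN: "m \<le> N" using m(2) mult_right_mono[of 1 m m] by (simp add: N_def power2_eq_square)
    then have "N \<ge> max b 1" using m by auto
    from C(2)[OF this] obtain H where H: "test1 ?I H"
      "\<And>s. norm (bessel_op (of_real (k^2)) ?d H s - g s) \<le>
         (if N \<le> s \<and> s \<le> 2 * N then C * inverse (sqrt s) ^ (?d + 2) else 0)" by blast
    define f where "f x = v x * (monom3 0 e x * (bessel_op (of_real (k^2)) ?d H (sqd 0 x) - g (sqd 0 x)))" for x
    have fi: "integrable lebesgue f"
    proof -
      have "test1 ?I (\<lambda>s. bessel_op (of_real (k^2)) ?d H s + (-1) * g s)"
        by (intro test1_add test1_bessel H test1_mult g) auto
      from loc_integrable_test[OF v test_fn_monom3_radial[OF this, of 0 e]] show ?thesis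
        by (simp add: f_def[abs_def])
    qed
    have bound: "AE x in lebesgue. norm (f x) \<le> M / N^2 * indicator (cball 0 (2 * m)) x"
      using decay
    proof eventually_elim
      case (elim x)
      show ?case
      proof (cases "N \<le> sqd 0 x \<and> sqd 0 x \<le> 2 * N")
        case False
        then show ?thesis using H(2)[of "sqd 0 x"] M0 by (auto simp: f_def)
      next
        case True
        have N0: "N > 0" using mN m by linarith
        have nx: "N \<le> (norm x)^2" "(norm x)^2 \<le> 2 * N" using True by (auto simp: sqd_0)
        have "R^2 < sqd 0 x" using True ab mN m by linarith
        then have xR: "norm x > R" using iff by simp
        then have x0: "norm x > 0" using R by linarith
        have "norm x \<le> 2 * m"
        proof (rule power2_le_imp_le)
          have "(2 * m)^2 = 4 * m^2" by (simp add: power_mult_distrib)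
          then show "(norm x)^2 \<le> (2 * m)^2" using nx(2) N0 unfolding N_def by linarith
        qed (use m in simp)
        then have ind: "indicator (cball 0 (2 * m)) x = (1::real)" by simp
        have "norm (f x) = norm (v x) * (norm (monom3 0 e x) * norm (bessel_op (of_real (k^2)) ?d H (sqd 0 x) - g (sqd 0 x)))"
          by (simp add: f_def norm_mult)
        also have "\<dots> \<le> (\<bar>D\<bar> / (norm x)^2) * (norm x ^ ?d * (C * inverse (norm x) ^ (?d + 2)))"
        proof (intro mult_mono norm_monom3_le)
          have "norm (v x) \<le> D / (norm x)^2" using elim xR by simp
          also have "\<dots> \<le> \<bar>D\<bar> / (norm x)^2" by (intro divide_right_mono) auto
          finally show "norm (v x) \<le> \<bar>D\<bar> / (norm x)^2" .
          show "norm (bessel_op (of_real (k^2)) ?d H (sqd 0 x) - g (sqd 0 x)) \<le> C * inverse (norm x) ^ (?d + 2)"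
            using H(2)[of "sqd 0 x"] True by (simp add: sqd_0)
        qed (use C(1) in auto)
        also have "\<dots> = M / ((norm x)^2 * (norm x)^2)"
          using x0 by (simp add: M_def power_add power_inverse field_simps eval_nat_numeral)
        also have "\<dots> \<le> M / (N * N)"
          using nx(1) N0 M0 by (intro divide_left_mono mult_mono mult_pos_pos) (auto intro: less_le_trans)
        finally show ?thesis unfolding ind by (simp add: power2_eq_square)
      qed
    qed
    have "norm (LINT x|lebesgue. f x) \<le> (LINT x|lebesgue. norm (f x))" by (rule integral_norm_bound)
    also have "\<dots> \<le> (LINT x|lebesgue. M / N^2 * indicator (cball (0::real^3) (2 * m)) x)"
    proof (rule Bochner_Integration.integral_mono_AE)
      show "integrable lebesgue (\<lambda>x::real^3. M / N^2 * indicator (cball 0 (2 * m)) x)"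
        using lmeasurable_cball[of "0::real^3" "2*m"] by (intro integrable_mult_right integrable_real_indicator) (auto simp: fmeasurable_def)
    qed (use fi bound in auto)
    also have "\<dots> = M / N^2 * measure lebesgue (cball (0::real^3) (2 * m))" by simp
    also have "\<dots> = M / N^2 * ((2 * m)^3 * V)"
    proof -
      have "measure lebesgue (cball (0::real^3) (2 * m)) = measure lborel (ball (0::real^3) (2 * m))"
        by (simp add: content_cball_conv_ball)
      also have "\<dots> = (2 * m)^3 * V"
        unfolding V_def using m(2) content_ball_conv_unit_ball[of "2 * m" "0::real^3"] by simp
      finally show ?thesis by simp
    qed
    also have "\<dots> = 8 * M * V / m"
      using m(2) by (simp add: N_def power2_eq_square power3_eq_cube field_simps)
    also have "\<dots> < \<epsilon>"
      using m(2,3) \<epsilon> by (simp add: field_simps)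
    finally have "norm (LINT x|lebesgue. f x) < \<epsilon>" .
    then show "\<exists>h. test1 ?I h \<and> norm (LINT x|lebesgue. v x * (monom3 0 e x * (bessel_op (of_real (k^2)) ?d h (sqd 0 x) - g (sqd 0 x)))) < \<epsilon>"
      using H(1) unfolding f_def[abs_def] by blast
  qed
  have "AE x in lebesgue. \<forall>n. R^2 + inverse (real (Suc n)) < sqd 0 x \<and> sqd 0 x < real n \<longrightarrow> v x = 0"
  proof (subst AE_all_countable, rule allI)
    fix n
    have "inverse (real (Suc n)) > 0" by simp
    then have "R^2 < s" if "s \<in> {R^2 + inverse (real (Suc n))..real n}" for s
      using that unfolding atLeastAtMost_iff by linarith
    then have "{R^2 + inverse (real (Suc n))..real n} \<subseteq> ?I" by auto
    from moments_imp_zero[OF v mom this]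
    show "AE x in lebesgue. R^2 + inverse (real (Suc n)) < sqd 0 x \<and> sqd 0 x < real n \<longrightarrow> v x = 0" .
  qed
  then show ?thesis
  proof eventually_elim
    case (elim x)
    show ?case
    proof
      assume "norm x > R"
      then have "sqd 0 x - R^2 > 0" using iff by simp
      then obtain n where n: "inverse (real (Suc n)) < sqd 0 x - R^2" using reals_Archimedean by blast
      obtain n' where n': "sqd 0 x < real n'" using reals_Archimedean2 by blast
      define l where "l = max n n'"
      have "inverse (real (Suc l)) \<le> inverse (real (Suc n))"
        by (rule le_imp_inverse_le) (auto simp: l_def)
      moreover have "real n' \<le> real l" by (simp add: l_def)
      ultimately have "R^2 + inverse (real (Suc l)) < sqd 0 x" "sqd 0 x < real l" using n n' by linarith+
      then show "v x = 0" using elim by blast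
    qed
  qed
qed

section \<open>Propagation of zeros through the exterior of a Lipschitz domain\<close>

lemma AE_lebesgue_iff_negligible: "(AE x in lebesgue. Q x) \<longleftrightarrow> negligible {x::'a::euclidean_space. \<not> Q x}"
proof
  assume "AE x in lebesgue. Q x"
  then obtain N where "N \<in> null_sets lebesgue" "{x. \<not> Q x} \<subseteq> N"
    unfolding eventually_ae_filter by auto
  then show "negligible {x. \<not> Q x}" by (metis negligible_iff_null_sets negligible_subset)
next
  assume "negligible {x. \<not> Q x}"
  then show "AE x in lebesgue. Q x"
    unfolding negligible_iff_null_sets by (rule AE_I') auto
qed

text \<open>A locally negligible set is negligible, which replaces the choice of a countable
  subcover.\<close>

lemma AE_local_to_global:
  fixes G :: "'a::euclidean_space set"
  assumes "\<And>y. y \<in> G \<Longrightarrow> \<exists>\<delta>>0. AE x in lebesgue. x \<in> ball y \<delta> \<longrightarrow> P x"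
  shows "AE x in lebesgue. x \<in> G \<longrightarrow> P x"
proof -
  let ?N = "{x \<in> G. \<not> P x}"
  have "negligible ?N"
  proof (subst locally_negligible_alt, rule ballI)
    fix y assume y: "y \<in> ?N"
    then obtain \<delta> where \<delta>: "\<delta> > 0" "AE x in lebesgue. x \<in> ball y \<delta> \<longrightarrow> P x" using assms by blast
    then have "negligible {x. \<not> (x \<in> ball y \<delta> \<longrightarrow> P x)}" by (simp only: AE_lebesgue_iff_negligible)
    then have "negligible (?N \<inter> ball y \<delta>)" by (rule negligible_subset) auto
    then show "\<exists>U. openin (top_of_set ?N) U \<and> y \<in> U \<and> negligible U"
      using y \<delta>(1) by (intro exI[of _ "?N \<inter> ball y \<delta>"]) auto
  qed
  then show ?thesis unfolding AE_lebesgue_iff_negligible by (rule negligible_subset) auto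
qed

text \<open>The chart describes only \<open>\<Omega>\<close>. A point on the graph is a limit of
  points of \<open>\<Omega>\<close>, reached by moving up along \<open>\<nu>\<close>; a point
  strictly below the graph has a neighbourhood that misses \<open>\<Omega>\<close>.\<close>

lemma lipschitz_epigraph_exterior:
  fixes \<nu> x :: "'a::euclidean_space" and \<gamma> :: "'a \<Rightarrow> real"
  assumes \<nu>: "norm \<nu> = 1" and L: "L-lipschitz_on {y. y \<bullet> \<nu> = 0} \<gamma>"
    and \<Omega>: "\<Omega> \<inter> ball x r = {y \<in> ball x r. y \<bullet> \<nu> > \<gamma> (y - (y \<bullet> \<nu>) *\<^sub>R \<nu>)}"
    and y: "y \<in> ball x r"
  shows "y \<in> - closure \<Omega> \<longleftrightarrow> y \<bullet> \<nu> < \<gamma> (y - (y \<bullet> \<nu>) *\<^sub>R \<nu>)"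
proof
  have nn: "\<nu> \<bullet> \<nu> = 1" using \<nu> by (simp add: dot_square_norm)
  define \<pi> where "\<pi> y = y - (y \<bullet> \<nu>) *\<^sub>R \<nu>" for y
  have \<pi>: "\<pi> y \<in> {y. y \<bullet> \<nu> = 0}" for y by (simp add: \<pi>_def inner_diff_left nn)
  have mem: "z \<in> \<Omega> \<longleftrightarrow> z \<bullet> \<nu> > \<gamma> (\<pi> z)" if "z \<in> ball x r" for z
  proof -
    have "z \<in> \<Omega> \<inter> ball x r \<longleftrightarrow> z \<in> {y \<in> ball x r. y \<bullet> \<nu> > \<gamma> (y - (y \<bullet> \<nu>) *\<^sub>R \<nu>)}" by (simp only: \<Omega>)
    then show ?thesis using that by (simp add: \<pi>_def)
  qed
  have c\<pi>: "continuous_on UNIV \<pi>" unfolding \<pi>_def[abs_def] by (intro continuous_intros)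
  have c: "continuous_on UNIV (\<lambda>y. \<gamma> (\<pi> y))"
    by (rule continuous_on_compose2[OF lipschitz_on_continuous_on[OF L] c\<pi>]) (use \<pi> in auto)
  {
    assume "y \<bullet> \<nu> < \<gamma> (y - (y \<bullet> \<nu>) *\<^sub>R \<nu>)"
    let ?S = "ball x r \<inter> {y. y \<bullet> \<nu> < \<gamma> (\<pi> y)}"
    have "open ?S" by (intro open_Int open_ball open_Collect_less c continuous_intros)
    moreover have "?S \<inter> \<Omega> = {}" using mem by fastforce
    moreover have "y \<in> ?S" using y \<open>y \<bullet> \<nu> < _\<close> by (simp add: \<pi>_def)
    ultimately show "y \<in> - closure \<Omega>" by (metis ComplI disjoint_iff open_Int_closure_eq_empty)
  }
  assume X: "y \<in> - closure \<Omega>"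
  then have "y \<notin> \<Omega>" using closure_subset by auto
  then have le: "y \<bullet> \<nu> \<le> \<gamma> (\<pi> y)" using mem[OF y] by simp
  have "y \<bullet> \<nu> \<noteq> \<gamma> (\<pi> y)"
  proof
    assume eq: "y \<bullet> \<nu> = \<gamma> (\<pi> y)"
    have "open (- closure \<Omega> \<inter> ball x r)" by auto
    then obtain e where e: "e > 0" "ball y e \<subseteq> - closure \<Omega> \<inter> ball x r"
      using X y open_contains_ball by (metis IntI)
    let ?z = "y + (e/2) *\<^sub>R \<nu>"
    have z: "?z \<in> ball y e" using e(1) \<nu> by (simp add: dist_norm)
    have "?z \<bullet> \<nu> > \<gamma> (\<pi> ?z)"
      using eq e(1) by (simp add: \<pi>_def inner_add_left nn algebra_simps)
    then have "?z \<in> \<Omega>" using mem[of ?z] z e(2) by blast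
    then show False using z e(2) closure_subset by blast
  qed
  then show "y \<bullet> \<nu> < \<gamma> (y - (y \<bullet> \<nu>) *\<^sub>R \<nu>)" using le by (simp add: \<pi>_def)
qed

text \<open>Unique continuation acts in the open exterior \<open>X\<close>, but connectedness is
  given for \<open>- \<Omega>\<close>, which includes the boundary. Hence the clopen argument runs
  in \<open>- \<Omega>\<close> with \<open>W\<close>, the points having a neighbourhood whose
  exterior part consists of zeros; the Lipschitz chart makes \<open>W\<close> closed at boundary
  points.\<close>

lemma zero_propagation:
  fixes \<Omega> :: "'a::euclidean_space set" and P :: "'a \<Rightarrow> bool"
  assumes lip: "bounded_lipschitz_domain \<Omega>" and conn: "connected (- \<Omega>)"
    and ucp: "\<And>p r R. 0 < r \<Longrightarrow> r < R \<Longrightarrow> ball p R \<subseteq> - closure \<Omega> \<Longrightarrow>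
       (AE x in lebesgue. x \<in> ball p r \<longrightarrow> P x) \<Longrightarrow> (AE x in lebesgue. x \<in> ball p R \<longrightarrow> P x)"
    and inf: "AE x in lebesgue. norm x > R0 \<longrightarrow> P x"
    and x0: "x0 \<notin> \<Omega>"
  obtains \<eta> where "\<eta> > 0" "AE x in lebesgue. x \<in> ball x0 \<eta> - closure \<Omega> \<longrightarrow> P x"
proof -
  define Z where "Z = {y. \<exists>\<delta>>0. AE x in lebesgue. x \<in> ball y \<delta> \<longrightarrow> P x}"
  define X where "X = - closure \<Omega>"
  have op: "open \<Omega>" and bdd: "bounded \<Omega>" using lip by (auto simp: bounded_lipschitz_domain_def)
  have oX: "open X" unfolding X_def by (intro open_Compl closed_closure)
  have oZ: "open Z"
    unfolding open_contains_ball
  proof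
    fix y assume "y \<in> Z"
    then obtain \<delta> where \<delta>: "\<delta> > 0" "AE x in lebesgue. x \<in> ball y \<delta> \<longrightarrow> P x" by (auto simp: Z_def)
    have "z \<in> Z" if "z \<in> ball y (\<delta>/2)" for z
    proof -
      have sub: "ball z (\<delta>/2) \<subseteq> ball y \<delta>" using that by (simp add: ball_subset_ball_iff dist_commute)
      have "AE x in lebesgue. x \<in> ball z (\<delta>/2) \<longrightarrow> P x"
        using \<delta>(2) by eventually_elim (use sub in blast)
      then show ?thesis using \<delta>(1) unfolding Z_def by (auto intro!: exI[of _ "\<delta>/2"])
    qed
    then show "\<exists>e>0. ball y e \<subseteq> Z" using \<delta>(1) by (intro exI[of _ "\<delta>/2"]) auto
  qed
  \<comment> \<open>The radii: a point \<open>z\<close> of \<open>Z\<close> within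
    \<open>d/4\<close> of \<open>y\<close> has a ball of radius \<open>3 d/4\<close> inside
    \<open>ball y d\<close>, and this ball contains \<open>ball y (d/2)\<close>.\<close>
  have clZ: "y \<in> Z" if y: "y \<in> X" "y \<in> closure Z" for y
  proof -
    obtain d where d: "d > 0" "ball y d \<subseteq> X" using oX y(1) open_contains_ball by metis
    obtain z where z: "z \<in> Z" "dist z y < d/4" using y(2) d(1) by (meson closure_approachable divide_pos_pos zero_less_numeral)
    obtain \<delta> where \<delta>: "\<delta> > 0" "AE x in lebesgue. x \<in> ball z \<delta> \<longrightarrow> P x" using z(1) by (auto simp: Z_def)
    have "AE x in lebesgue. x \<in> ball z (3*d/4) \<longrightarrow> P x"
    proof (rule ucp[of "min \<delta> (d/4)"])
      have "ball z (3*d/4) \<subseteq> ball y d" using z(2) by (simp add: ball_subset_ball_iff)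
      then show "ball z (3*d/4) \<subseteq> - closure \<Omega>" using d(2) by (auto simp: X_def)
      show "AE x in lebesgue. x \<in> ball z (min \<delta> (d/4)) \<longrightarrow> P x" using \<delta>(2) by eventually_elim auto
    qed (use \<delta> d in auto)
    moreover have "ball y (d/2) \<subseteq> ball z (3*d/4)" using z(2) by (simp add: ball_subset_ball_iff dist_commute)
    ultimately have "AE x in lebesgue. x \<in> ball y (d/2) \<longrightarrow> P x"
      by (elim eventually_mono) blast
    then show ?thesis unfolding Z_def using d(1) by (auto intro!: exI[of _ "d/2"])
  qed
  have spread: "C \<subseteq> Z" if C: "connected C" "C \<subseteq> X" and m: "y \<in> C" "y \<in> Z" for C y
  proof -
    have "openin (top_of_set C) (C \<inter> Z)" by (rule openin_open_Int[OF oZ])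
    moreover have "closedin (top_of_set C) (C \<inter> Z)"
    proof -
      have "C \<inter> Z = C \<inter> closure Z" using clZ C(2) closure_subset by blast
      then show ?thesis by (simp add: closedin_closed_Int)
    qed
    ultimately show ?thesis using C(1) m unfolding connected_clopen by blast
  qed
  define W where "W = {x \<in> - \<Omega>. \<exists>\<eta>>0. ball x \<eta> \<inter> X \<subseteq> Z}"
  have "openin (top_of_set (- \<Omega>)) W"
    unfolding openin_contains_ball
  proof (intro conjI ballI)
    fix x assume "x \<in> W"
    then obtain \<eta> where \<eta>: "\<eta> > 0" "ball x \<eta> \<inter> X \<subseteq> Z" by (auto simp: W_def)
    have "y \<in> W" if "y \<in> ball x (\<eta>/2) \<inter> - \<Omega>" for y
    proof -
      have "ball y (\<eta>/2) \<subseteq> ball x \<eta>" using that by (simp add: ball_subset_ball_iff dist_commute)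
      then have "ball y (\<eta>/2) \<inter> X \<subseteq> Z" using \<eta>(2) by blast
      then show ?thesis using that \<eta>(1) unfolding W_def by (auto intro!: exI[of _ "\<eta>/2"])
    qed
    then show "\<exists>e>0. ball x e \<inter> - \<Omega> \<subseteq> W" using \<eta>(1) by (intro exI[of _ "\<eta>/2"]) auto
  qed (auto simp: W_def)
  moreover have "closedin (top_of_set (- \<Omega>)) W"
  proof -
    have "x \<in> W" if x: "x \<in> - \<Omega>" "x \<in> closure W" for x
    proof (cases "x \<in> X")
      case True
      then obtain d where d: "d > 0" "ball x d \<subseteq> X" using oX open_contains_ball by metis
      obtain w where w: "w \<in> W" "dist w x < d" using x(2) d(1) closure_approachable by metis
      then have wb: "w \<in> ball x d" by (simp add: dist_commute)
      then have "w \<in> Z" using w d(2) unfolding W_def by force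
      then have "ball x d \<subseteq> Z" using spread[OF connected_ball d(2) wb] by blast
      then show ?thesis using x(1) d(1) by (auto simp: W_def)
    next
      case False
      then have fr: "x \<in> frontier \<Omega>" using x(1) op by (simp add: X_def frontier_def interior_open)
      then obtain \<nu> \<gamma> L r where \<nu>: "norm \<nu> = 1" and r: "r > 0" and L: "L-lipschitz_on {y. y \<bullet> \<nu> = 0} \<gamma>"
        and ch: "\<Omega> \<inter> ball x r = {y \<in> ball x r. y \<bullet> \<nu> > (\<gamma> (y - (y \<bullet> \<nu>) *\<^sub>R \<nu>) :: real)}"
        using lip unfolding bounded_lipschitz_domain_def by meson
      have L0: "L \<ge> 0" using L lipschitz_on_nonneg by blast
      have nn: "\<nu> \<bullet> \<nu> = 1" using \<nu> by (simp add: dot_square_norm)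
      define \<pi> where "\<pi> y = y - (y \<bullet> \<nu>) *\<^sub>R \<nu>" for y
      have \<pi>0: "\<pi> y \<bullet> \<nu> = 0" for y by (simp add: \<pi>_def inner_diff_left nn)
      have \<pi>s: "\<pi> (y - t *\<^sub>R \<nu>) = \<pi> y" for y t by (simp add: \<pi>_def inner_diff_left nn algebra_simps)
      have ext: "y \<in> X \<longleftrightarrow> y \<bullet> \<nu> < \<gamma> (\<pi> y)" if "y \<in> ball x r" for y
        unfolding X_def \<pi>_def by (rule lipschitz_epigraph_exterior[OF \<nu> L ch that])
      have below: "y \<bullet> \<nu> \<le> \<gamma> (\<pi> y)" if "y \<in> ball x r" "y \<notin> \<Omega>" for y
      proof -
        have "y \<notin> {y \<in> ball x r. y \<bullet> \<nu> > \<gamma> (y - (y \<bullet> \<nu>) *\<^sub>R \<nu>)}"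
          using that by (simp only: ch[symmetric]) simp
        then show ?thesis using that by (simp add: \<pi>_def)
      qed
      have xeq: "x \<bullet> \<nu> = \<gamma> (\<pi> x)" using below[of x] ext[of x] x(1) False r by auto
      \<comment> \<open>A descent by \<open>t0\<close> must beat the amount
        \<open>(L + 1) \<eta>\<close> by which height and graph together can vary over
        \<open>ball x \<eta>\<close>, and \<open>\<eta> + t0 = r / 2\<close> keeps everything inside
        the chart.\<close>
      define \<eta> where "\<eta> = r / (2 * (L + 3))"
      define t0 where "t0 = (L + 2) * \<eta>"
      have \<eta>: "\<eta> > 0" using r L0 by (simp add: \<eta>_def)
      have t0: "t0 > 0" "(L + 1) * \<eta> < t0" using \<eta> L0 by (auto simp: t0_def intro!: mult_pos_pos)
      have sum: "\<eta> + t0 = r / 2"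
      proof -
        have "\<eta> + t0 = \<eta> * (L + 3)" by (simp add: t0_def algebra_simps)
        also have "\<dots> = r / 2" using L0 by (simp add: \<eta>_def field_simps)
        finally show ?thesis .
      qed
      have inb: "z - t *\<^sub>R \<nu> \<in> ball x r" if "z \<in> ball x \<eta>" "0 \<le> t" "t \<le> t0" for z t
      proof -
        have "norm (x - (z - t *\<^sub>R \<nu>)) \<le> norm (x - z) + norm (t *\<^sub>R \<nu>)"
          by (metis diff_diff_eq2 add_diff_eq norm_triangle_ineq diff_add_eq)
        also have "\<dots> < \<eta> + t0" using that \<nu> by (simp add: dist_norm)
        finally show ?thesis using sum r by (simp add: dist_norm)
      qed
      have zb: "z \<in> ball x r" if "z \<in> ball x \<eta>" for z using inb[OF that, of 0] t0 by simp
      \<comment> \<open>A ball below the graph, hence in \<open>X\<close>, to which every exterior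
        point near \<open>x\<close> is joined by a segment in \<open>X\<close> parallel to
        \<open>\<nu>\<close>. One zero near \<open>x\<close> therefore spreads through
        \<open>?D\<close> to all of them.\<close>
      let ?D = "ball (x - t0 *\<^sub>R \<nu>) \<eta>"
      have Dz: "z - t0 *\<^sub>R \<nu> \<in> ?D" if "z \<in> ball x \<eta>" for z using that by (simp add: dist_norm)
      have DX: "?D \<subseteq> X"
      proof
        fix y assume "y \<in> ?D"
        then have z: "y + t0 *\<^sub>R \<nu> \<in> ball x \<eta>" (is "?z \<in> _") by (simp add: dist_norm algebra_simps)
        have yz: "y = ?z - t0 *\<^sub>R \<nu>" by simp
        have "norm (\<pi> ?z - \<pi> x) \<le> norm (?z - x)"
        proof -
          have "\<pi> ?z - \<pi> x = \<pi> (?z - x)" by (simp add: \<pi>_def algebra_simps inner_diff_left inner_add_left)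
          moreover have "(norm (\<pi> w))^2 \<le> (norm w)^2" for w
          proof -
            have "(norm (\<pi> w))^2 = (norm w)^2 - (w \<bullet> \<nu>)^2"
              unfolding power2_norm_eq_inner \<pi>_def
              by (simp add: inner_diff_left inner_diff_right nn inner_commute power2_eq_square)
            then show ?thesis by simp
          qed
          ultimately show ?thesis using power2_le_imp_le[of "norm (\<pi> (?z - x))" "norm (?z - x)"] by simp
        qed
        then have n1: "norm (\<pi> ?z - \<pi> x) \<le> \<eta>" using z by (simp add: dist_norm norm_minus_commute)
        have "dist (\<gamma> (\<pi> ?z)) (\<gamma> (\<pi> x)) \<le> L * dist (\<pi> ?z) (\<pi> x)"
          by (rule lipschitz_onD[OF L]) (simp_all add: \<pi>0)
        also have "\<dots> \<le> L * \<eta>" using n1 L0 by (intro mult_left_mono) (auto simp: dist_norm)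
        finally have g: "\<gamma> (\<pi> x) - L * \<eta> \<le> \<gamma> (\<pi> ?z)" by (simp add: dist_real_def abs_le_iff)
        have "?z \<bullet> \<nu> - x \<bullet> \<nu> \<le> norm (?z - x)"
          using norm_cauchy_schwarz[of "?z - x" \<nu>] \<nu> by (simp add: inner_diff_left)
        then have "?z \<bullet> \<nu> \<le> x \<bullet> \<nu> + \<eta>" using z by (simp add: dist_norm norm_minus_commute)
        then have "?z \<bullet> \<nu> - t0 < \<gamma> (\<pi> ?z)" using g xeq t0(2) by (simp add: distrib_right)
        moreover have "y \<bullet> \<nu> = ?z \<bullet> \<nu> - t0" by (simp add: inner_add_left nn)
        moreover have "\<pi> y = \<pi> ?z" using \<pi>s[of ?z t0] by simp
        moreover have "y \<in> ball x r" using inb[OF z, of t0] t0 by simp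
        ultimately show "y \<in> X" using ext by simp
      qed
      have seg: "closed_segment z (z - t0 *\<^sub>R \<nu>) \<subseteq> X" if z: "z \<in> ball x \<eta>" "z \<in> X" for z
      proof
        fix y assume "y \<in> closed_segment z (z - t0 *\<^sub>R \<nu>)"
        then obtain u where u: "0 \<le> u" "u \<le> 1" "y = (1 - u) *\<^sub>R z + u *\<^sub>R (z - t0 *\<^sub>R \<nu>)"
          by (auto simp: closed_segment_def)
        then have y: "y = z - (u * t0) *\<^sub>R \<nu>" by (simp add: algebra_simps)
        have ut: "0 \<le> u * t0" "u * t0 \<le> t0" using u t0 by (auto intro: mult_left_le_one_le)
        have "z \<bullet> \<nu> < \<gamma> (\<pi> z)" using ext[OF zb[OF z(1)]] z(2) by simp
        then have "y \<bullet> \<nu> < \<gamma> (\<pi> y)" unfolding y \<pi>s using ut by (simp add: inner_diff_left nn)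
        then show "y \<in> X" using ext[of y] inb[OF z(1) ut] y by simp
      qed
      obtain w where w: "w \<in> W" "dist w x < \<eta>" using x(2) \<eta> closure_approachable by metis
      obtain \<eta>' where \<eta>': "\<eta>' > 0" "ball w \<eta>' \<inter> X \<subseteq> Z" "w \<notin> \<Omega>" using w(1) by (auto simp: W_def)
      have wb: "w \<in> ball x \<eta>" using w(2) by (simp add: dist_commute)
      \<comment> \<open>The point \<open>w\<close> may lie on the boundary; a step \<open>s\<close>
        down leads into \<open>X\<close> and stays within the neighbourhoods of \<open>w\<close> and
        of \<open>x\<close>.\<close>
      define s where "s = min \<eta>' (\<eta> - dist w x) / 2"
      have "0 < min \<eta>' (\<eta> - dist w x)" using w(2) \<eta>'(1) by simp
      then have s: "0 < s" "s < \<eta>'" "s < \<eta> - dist w x"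
        unfolding s_def by (simp_all add: min_def split: if_splits)
      let ?y = "w - s *\<^sub>R \<nu>"
      have dwy: "dist w ?y = s" using s(1) \<nu> by (simp add: dist_norm)
      then have yb: "?y \<in> ball x \<eta>" using s dist_triangle[of x ?y w] by (simp add: dist_commute)
      have "w \<bullet> \<nu> \<le> \<gamma> (\<pi> w)" by (rule below[OF zb[OF wb] \<eta>'(3)])
      then have "?y \<bullet> \<nu> < \<gamma> (\<pi> ?y)" unfolding \<pi>s using s(1) by (simp add: inner_diff_left nn)
      then have yX: "?y \<in> X" using ext[OF zb[OF yb]] by simp
      have yZ: "?y \<in> Z" using \<eta>'(2) yX s(2) dwy by (auto simp: subset_iff)
      have "closed_segment ?y (?y - t0 *\<^sub>R \<nu>) \<subseteq> Z"
        by (rule spread[OF connected_segment(1) seg[OF yb yX] _ yZ]) simp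
      then have "?y - t0 *\<^sub>R \<nu> \<in> Z" by auto
      then have DZ: "?D \<subseteq> Z" by (rule spread[OF connected_ball DX Dz[OF yb]])
      have "z \<in> Z" if z: "z \<in> ball x \<eta>" "z \<in> X" for z
      proof -
        have "closed_segment z (z - t0 *\<^sub>R \<nu>) \<subseteq> Z"
          by (rule spread[OF connected_segment(1) seg[OF z], of "z - t0 *\<^sub>R \<nu>"]) (use DZ Dz[OF z(1)] in auto)
        then show ?thesis by auto
      qed
      then show ?thesis unfolding W_def using x(1) \<eta> by auto
    qed
    moreover have "W \<subseteq> - \<Omega>" by (auto simp: W_def)
    ultimately have "W = - \<Omega> \<inter> closure W" using closure_subset[of W] by blast
    then show ?thesis by (metis closedin_closed_Int closed_closure)
  qed
  moreover have "W \<noteq> {}"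
  proof -
    obtain B where B: "\<And>x. x \<in> \<Omega> \<Longrightarrow> norm x \<le> B" using bdd by (auto simp: bounded_iff)
    obtain b :: 'a where b: "b \<in> Basis" using nonempty_Basis by blast
    \<comment> \<open>A point outside \<open>\<Omega>\<close> whose unit ball lies beyond radius
      \<open>R0\<close>; it starts the propagation.\<close>
    let ?x = "(\<bar>B\<bar> + \<bar>R0\<bar> + 2) *\<^sub>R b"
    have nx: "norm ?x = \<bar>B\<bar> + \<bar>R0\<bar> + 2" using b by simp
    have far: "norm y > R0" if "y \<in> ball ?x 1" for y
    proof -
      have "norm (?x - y) < 1" using that by (simp add: dist_norm)
      then show ?thesis using nx norm_triangle_sub[of ?x y] by linarith
    qed
    have "ball ?x 1 \<subseteq> Z"
    proof
      fix y assume "y \<in> ball ?x 1"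
      then obtain d where d: "d > 0" "ball y d \<subseteq> ball ?x 1" using open_ball open_contains_ball by metis
      have "AE x in lebesgue. x \<in> ball y d \<longrightarrow> P x" using inf
        by eventually_elim (use far d(2) in auto)
      then show "y \<in> Z" using d(1) by (auto simp: Z_def)
    qed
    moreover have "?x \<notin> \<Omega>" using B[of ?x] nx by linarith
    ultimately have "?x \<in> W" unfolding W_def by (auto intro!: exI[of _ 1])
    then show ?thesis by blast
  qed
  ultimately have "W = - \<Omega>" using conn unfolding connected_clopen by blast
  then obtain \<eta> where \<eta>: "\<eta> > 0" "ball x0 \<eta> \<inter> X \<subseteq> Z" using x0 by (auto simp: W_def)
  have "AE x in lebesgue. x \<in> ball x0 \<eta> \<inter> X \<longrightarrow> P x"
    by (rule AE_local_to_global) (use \<eta>(2) in \<open>auto simp: Z_def\<close>)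
  then show ?thesis using \<eta>(1) that by (auto simp: X_def Diff_eq)
qed

section \<open>The Laplace transform of a circular cone\<close>

lemma tendsto_linear_exp_0:
  assumes "s > (0::real)" shows "((\<lambda>x. (x * p + q) * exp (- (s * x))) \<longlongrightarrow> 0) at_top"
proof -
  have l: "filterlim (\<lambda>x. s * x) at_top at_top"
    using assms by (rule filterlim_tendsto_pos_mult_at_top[OF tendsto_const _ filterlim_ident])
  have "((\<lambda>x. p / s * ((s * x) ^ 1 / exp (s * x)) + q * ((s * x) ^ 0 / exp (s * x))) \<longlongrightarrow> p / s * 0 + q * 0) at_top"
    by (intro tendsto_intros filterlim_compose[OF tendsto_power_div_exp_0 l])
  then show ?thesis using assms by (simp add: exp_minus field_simps)
qed

lemma exp_half_line:
  fixes s c :: real assumes "s > 0"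
  shows "integrable lborel (\<lambda>x. indicator {c<..} x * exp (- (s * x)))"
    and "(LINT x|lborel. indicator {c<..} x * exp (- (s * x))) = exp (- (s * c)) / s"
proof -
  have B: "(((\<lambda>x. - exp (- (s * x)) / s) \<circ> real_of_ereal) \<longlongrightarrow> 0) (at_left \<infinity>)"
    using tendsto_linear_exp_0[OF assms, of 0 "- 1 / s"] unfolding ereal_tendsto_simps by (simp add: mult.commute)
  have A: "(((\<lambda>x. - exp (- (s * x)) / s) \<circ> real_of_ereal) \<longlongrightarrow> - exp (- (s * c)) / s) (at_right (ereal c))"
    unfolding ereal_tendsto_simps using assms by (auto intro!: tendsto_eq_intros)
  have D: "((\<lambda>x. - exp (- (s * x)) / s) has_real_derivative exp (- (s * x))) (at x)" for x
    using assms by (auto intro!: derivative_eq_intros)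
  note F = interval_integral_FTC_nonneg[of "ereal c" \<infinity>, OF _ D _ _ A B]
  show "integrable lborel (\<lambda>x. indicator {c<..} x * exp (- (s * x)))"
    using F(1) by (simp add: set_integrable_def)
  show "(LINT x|lborel. indicator {c<..} x * exp (- (s * x))) = exp (- (s * c)) / s"
    using F(2) by (simp add: interval_lebesgue_integral_def set_lebesgue_integral_def)
qed

text \<open>The antiderivative is
  \<open>- (x / \<sigma> + 1 / \<sigma>^2) exp (- \<sigma> x)\<close>. In the integrability bound
  half of the exponential rate is spent on absorbing the factor \<open>x\<close>.\<close>

lemma linear_exp_half_line:
  fixes \<sigma> :: complex assumes "Re \<sigma> > 0"
  shows "integrable lborel (\<lambda>x. indicator {0<..} x *\<^sub>R (of_real x * exp (- (\<sigma> * of_real x))))"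
    and "(LINT x|lborel. indicator {0<..} x *\<^sub>R (of_real x * exp (- (\<sigma> * of_real x)))) = 1 / \<sigma>^2"
proof -
  let ?s = "Re \<sigma>"
  have nz: "\<sigma> \<noteq> 0" using assms by auto
  have ne: "norm (exp (- (\<sigma> * of_real x))) = exp (- (?s * x))" for x by simp
  show int: "integrable lborel (\<lambda>x. indicator {0<..} x *\<^sub>R (of_real x * exp (- (\<sigma> * of_real x))))"
  proof (rule Bochner_Integration.integrable_bound)
    show "integrable lborel (\<lambda>x. 2 / ?s * (indicator {0<..} x * exp (- (?s / 2 * x))))"
      by (intro integrable_mult_right exp_half_line) (use assms in simp)
    show "(\<lambda>x. indicator {0<..} x *\<^sub>R (of_real x * exp (- (\<sigma> * of_real x)))) \<in> borel_measurable lborel" by measurable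
    have "norm (of_real x * exp (- (\<sigma> * of_real x))) \<le> 2 / ?s * exp (- (?s / 2 * x))" if "x > 0" for x
    proof -
      have "?s / 2 * x \<le> exp (?s / 2 * x)" using exp_ge_add_one_self[of "?s / 2 * x"] by linarith
      then have "x \<le> 2 / ?s * exp (?s / 2 * x)" using assms by (simp add: field_simps)
      then have "x * exp (- (?s * x)) \<le> 2 / ?s * exp (?s / 2 * x) * exp (- (?s * x))" by (rule mult_right_mono) simp
      also have "\<dots> = 2 / ?s * exp (- (?s / 2 * x))" by (simp flip: exp_add add: field_simps)
      finally show ?thesis using that by (simp add: norm_mult)
    qed
    then show "AE x in lborel. norm (indicator {0<..} x *\<^sub>R (of_real x * exp (- (\<sigma> * of_real x))))
        \<le> norm (2 / ?s * (indicator {0<..} x * exp (- (?s / 2 * x))))"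
      using assms by (intro AE_I2) (auto simp: indicator_def)
  qed
  let ?F = "\<lambda>x. - (of_real x / \<sigma> + 1 / \<sigma>^2) * exp (- (\<sigma> * of_real x))"
  have "(LBINT x=0..\<infinity>. of_real x * exp (- (\<sigma> * of_real x))) = 0 - ?F 0"
  proof (rule interval_integral_FTC_integrable[where F="?F"])
    show "(?F has_vector_derivative of_real x * exp (- (\<sigma> * of_real x))) (at x)" for x
    proof -
      have "((\<lambda>z. - (z / \<sigma> + 1 / \<sigma>^2) * exp (- (\<sigma> * z))) has_field_derivative z * exp (- (\<sigma> * z))) (at z)" for z
        using nz by (auto intro!: derivative_eq_intros simp: field_simps power2_eq_square)
      from has_vector_derivative_real_field[OF this] show ?thesis .
    qed
    show "isCont (\<lambda>x. of_real x * exp (- (\<sigma> * of_real x))) x" for x by (intro continuous_intros)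
    show "set_integrable lborel (einterval 0 \<infinity>) (\<lambda>x. of_real x * exp (- (\<sigma> * of_real x)))"
      using int by (simp add: set_integrable_def zero_ereal_def)
    have "(?F \<longlongrightarrow> ?F 0) (at_right 0)" by (intro tendsto_intros) (auto simp: nz)
    then show "((?F \<circ> real_of_ereal) \<longlongrightarrow> ?F 0) (at_right 0)"
      unfolding zero_ereal_def ereal_tendsto_simps .
    have "(?F \<longlongrightarrow> 0) at_top"
    proof (rule Lim_null_comparison[OF _ tendsto_linear_exp_0[OF assms, of "1 / norm \<sigma>" "1 / norm \<sigma>^2"]])
      show "\<forall>\<^sub>F x in at_top. norm (?F x) \<le> (x * (1 / norm \<sigma>) + 1 / norm \<sigma>^2) * exp (- (?s * x))"
        using eventually_ge_at_top[of 0]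
      proof eventually_elim
        case (elim x)
        have "norm (of_real x / \<sigma> + 1 / \<sigma>^2) \<le> x * (1 / norm \<sigma>) + 1 / norm \<sigma>^2"
          using norm_triangle_ineq[of "of_real x / \<sigma>" "1 / \<sigma>^2"] elim by (simp add: norm_divide norm_power)
        from mult_right_mono[OF this, of "exp (- (?s * x))"] show ?case
          unfolding norm_mult norm_minus_cancel ne by simp
      qed
    qed
    then show "((?F \<circ> real_of_ereal) \<longlongrightarrow> 0) (at_left \<infinity>)" unfolding ereal_tendsto_simps .
  qed simp
  then show "(LINT x|lborel. indicator {0<..} x *\<^sub>R (of_real x * exp (- (\<sigma> * of_real x)))) = 1 / \<sigma>^2"
    by (simp add: interval_lebesgue_integral_def set_lebesgue_integral_def zero_ereal_def)
qed

text \<open>Twice the real part of \<open>1 / (s + \<i> t)^2\<close>: the case \<open>t = 1\<close>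
  carries the cosine, the case \<open>t = 0\<close> is the majorant needed for Fubini.\<close>

lemma even_linear_exp_cos:
  fixes s :: real assumes "s > 0"
  shows "integrable lborel (\<lambda>x. \<bar>x\<bar> * cos x * exp (- (s * \<bar>x\<bar>)))"
    and "(LINT x|lborel. \<bar>x\<bar> * cos x * exp (- (s * \<bar>x\<bar>))) = 2 * (s^2 - 1) / (s^2 + 1)^2"
    and "integrable lborel (\<lambda>x. \<bar>x\<bar> * exp (- (s * \<bar>x\<bar>)))"
    and "(LINT x|lborel. \<bar>x\<bar> * exp (- (s * \<bar>x\<bar>))) = 2 / s^2"
proof -
  have even: "integrable lborel h \<and> (LINT x|lborel. h x) = 2 * (LINT x|lborel. indicator {0<..} x * h x)"
    if "\<And>x. h (- x) = h x" "integrable lborel (\<lambda>x. indicator {0<..} x * h x)" for h :: "real \<Rightarrow> real"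
  proof -
    let ?g = "\<lambda>x. indicator {0<..} x * h x"
    have r: "integrable lborel (\<lambda>x. ?g (- x))" 
      using lborel_integrable_real_affine[OF that(2), of "-1" 0] by simp
    have ri: "(LINT x|lborel. ?g (- x)) = (LINT x|lborel. ?g x)"
      using lborel_integral_real_affine[of "-1" ?g 0] by simp
    have ae: "AE x in lborel. h x = ?g x + ?g (- x)"
      using AE_lborel_singleton[of 0] by eventually_elim (auto simp: indicator_def that(1))
    have hm: "h \<in> borel_measurable lborel"
    proof -
      have "h = (\<lambda>x. ?g x + ?g (- x) + indicator {0} x * h 0)" 
        by (rule ext) (auto simp: indicator_def that(1))
      moreover have "\<dots> \<in> borel_measurable lborel" using that(2) r
        by (intro borel_measurable_add borel_measurable_integrable) (auto simp: borel_measurable_integrable)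
      ultimately show ?thesis by metis
    qed
    have i: "integrable lborel (\<lambda>x. ?g x + ?g (- x))" using that(2) r by (rule Bochner_Integration.integrable_add)
    have "integrable lborel h" using integrable_cong_AE[OF hm borel_measurable_integrable[OF i] ae] i by blast
    moreover have "(LINT x|lborel. h x) = (LINT x|lborel. ?g x + ?g (- x))"
      by (rule integral_cong_AE[OF hm borel_measurable_integrable[OF i] ae])
    ultimately show ?thesis using that(2) r ri by simp
  qed
  have base: "integrable lborel (\<lambda>x. indicator {0<..} x * (\<bar>x\<bar> * cos (t * x) * exp (- (s * \<bar>x\<bar>)))) \<and>
     (LINT x|lborel. indicator {0<..} x * (\<bar>x\<bar> * cos (t * x) * exp (- (s * \<bar>x\<bar>)))) = Re (1 / (Complex s t)^2)" for t
  proof -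
    have re: "Re (Complex s t) > 0" using assms by simp
    note L = linear_exp_half_line[OF re]
    have eq: "indicator {0<..} x * (\<bar>x\<bar> * cos (t * x) * exp (- (s * \<bar>x\<bar>))) =
       Re (indicator {0<..} x *\<^sub>R (of_real x * exp (- (Complex s t * of_real x))))" for x
      by (auto simp: indicator_def Re_exp)
    show ?thesis unfolding eq using integrable_Re[OF L(1)] integral_Re[OF L(1)] L(2) by simp
  qed
  have c1: "Re (1 / (Complex s 1)^2) = (s^2 - 1) / (s^2 + 1)^2"
  proof -
    have "(Complex s 1)^2 = Complex (s^2 - 1) (2 * s)" by (simp add: complex_eq_iff power2_eq_square)
    moreover have "(s^2 - 1)^2 + (2 * s)^2 = (s^2 + 1)^2" by (simp add: power2_eq_square algebra_simps)
    ultimately show ?thesis by (simp add: Re_divide)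
  qed
  have c0: "Re (1 / (Complex s 0)^2) = 1 / s^2"
  proof -
    have "(Complex s 0)^2 = of_real (s^2)" by (simp add: complex_eq_iff power2_eq_square)
    then show ?thesis by (simp add: Re_divide_of_real)
  qed
  have 1: "integrable lborel (\<lambda>x. \<bar>x\<bar> * cos (1 * x) * exp (- (s * \<bar>x\<bar>))) \<and>
    (LINT x|lborel. \<bar>x\<bar> * cos (1 * x) * exp (- (s * \<bar>x\<bar>))) = 2 * ((s^2 - 1) / (s^2 + 1)^2)"
    using even[OF _ base[of 1, THEN conjunct1]] base[of 1] c1 by simp
  have 0: "integrable lborel (\<lambda>x. \<bar>x\<bar> * cos (0 * x) * exp (- (s * \<bar>x\<bar>))) \<and>
    (LINT x|lborel. \<bar>x\<bar> * cos (0 * x) * exp (- (s * \<bar>x\<bar>))) = 2 * (1 / s^2)"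
    using even[OF _ base[of 0, THEN conjunct1]] base[of 0] c0 by simp
  show "integrable lborel (\<lambda>x. \<bar>x\<bar> * cos x * exp (- (s * \<bar>x\<bar>)))"
    "(LINT x|lborel. \<bar>x\<bar> * cos x * exp (- (s * \<bar>x\<bar>))) = 2 * (s^2 - 1) / (s^2 + 1)^2"
    using 1 by simp_all
  show "integrable lborel (\<lambda>x. \<bar>x\<bar> * exp (- (s * \<bar>x\<bar>)))"
    "(LINT x|lborel. \<bar>x\<bar> * exp (- (s * \<bar>x\<bar>))) = 2 / s^2"
    using 0 by simp_all
qed

text \<open>The scaling \<open>r = sqrt (d / (d + 1))\<close> reduces the integrand to the
  derivative of the arctangent; the value is \<open>pi / (r (d + 1))\<close>.\<close>

lemma inverse_quadratic_line:
  fixes d :: real assumes "d > 0"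
  shows "integrable lborel (\<lambda>u. 1 / (d * u^2 + d + 1))" and "(LINT u|lborel. 1 / (d * u^2 + d + 1)) > 0"
proof -
  define r where "r = sqrt (d / (d + 1))"
  have r: "r > 0" "r^2 = d / (d + 1)" using assms by (auto simp: r_def)
  let ?F = "\<lambda>u. arctan (r * u) / (r * (d + 1))"
  have D: "(?F has_real_derivative 1 / (d * u^2 + d + 1)) (at u)" for u
  proof -
    have e: "(r * u)^2 = d / (d + 1) * u^2" by (simp add: power_mult_distrib r)
    have "r * (d + 1) \<noteq> 0" using r assms by simp
    then have "(?F has_real_derivative inverse (1 + (r * u)^2) * r / (r * (d + 1))) (at u)"
      by (auto intro!: derivative_eq_intros)
    moreover have "inverse (1 + (r * u)^2) * r / (r * (d + 1)) = 1 / (d * u^2 + d + 1)"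
    proof -
      have "1 + (r * u)^2 = (d * u^2 + d + 1) / (d + 1)" unfolding e using assms by (simp add: field_simps)
      then show ?thesis using r(1) assms by simp
    qed
    ultimately show ?thesis by simp
  qed
  have top: "filterlim (\<lambda>u. r * u) at_top at_top"
    using r(1) by (rule filterlim_tendsto_pos_mult_at_top[OF tendsto_const _ filterlim_ident])
  have bot: "filterlim (\<lambda>u. r * u) at_bot at_bot"
    using r(1) by (rule filterlim_tendsto_pos_mult_at_bot[OF tendsto_const _ filterlim_ident])
  have B: "((?F \<circ> real_of_ereal) \<longlongrightarrow> (pi/2) / (r * (d + 1))) (at_left \<infinity>)"
    unfolding ereal_tendsto_simps using r assms
    by (intro tendsto_intros filterlim_compose[OF tendsto_arctan_at_top top]) auto
  have A: "((?F \<circ> real_of_ereal) \<longlongrightarrow> (-(pi/2)) / (r * (d + 1))) (at_right (-\<infinity>))"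
    unfolding ereal_tendsto_simps using r assms
    by (intro tendsto_intros filterlim_compose[OF tendsto_arctan_at_bot bot]) auto
  have pos: "d * u^2 + d + 1 > 0" for u using assms by (intro add_nonneg_pos) auto
  have C: "isCont (\<lambda>u. 1 / (d * u^2 + d + 1)) u" for u using pos[of u] by (intro continuous_intros) auto
  have N: "AE u in lborel. -\<infinity> < ereal u \<longrightarrow> ereal u < \<infinity> \<longrightarrow> 0 \<le> 1 / (d * u^2 + d + 1)"
    using pos by (auto intro: less_imp_le)
  note F = interval_integral_FTC_nonneg[of "-\<infinity>" \<infinity>, OF _ D C N A B]
  show "integrable lborel (\<lambda>u. 1 / (d * u^2 + d + 1))" using F(1) by (simp add: set_integrable_def)
  have "(LINT u|lborel. 1 / (d * u^2 + d + 1)) = (pi/2) / (r * (d + 1)) - (-(pi/2)) / (r * (d + 1))"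
    using F(2) by (simp add: interval_lebesgue_integral_def set_lebesgue_integral_def)
  also have "\<dots> = pi / (r * (d + 1))" by (simp flip: add_divide_distrib)
  also have "\<dots> > 0" using r assms by (intro divide_pos_pos mult_pos_pos) auto
  finally show "(LINT u|lborel. 1 / (d * u^2 + d + 1)) > 0" .
qed

text \<open>The integrand is \<open>2 d / ((d + 1) D) - 2 / (d + 1) (u / D)'\<close> with \<open>D = d u\<^sup>2 + d + 1\<close>.\<close>

lemma quadratic_line_pos:
  fixes d :: real assumes d: "d > 0"
  shows "(LINT u|lborel. 2 * (d * u^2 + d - 1) / (d * u^2 + d + 1)^2) > 0"
proof -
  let ?D = "\<lambda>u. d * u^2 + d + 1"
  let ?h = "\<lambda>u. (d + 1 - d * u^2) / (?D u)^2"
  have pos: "?D u > 0" for u using assms by (intro add_nonneg_pos) auto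
  note Q = inverse_quadratic_line[OF d]
  have hi: "integrable lborel ?h"
  proof (rule Bochner_Integration.integrable_bound[OF Q(1)])
    have "\<bar>?h u\<bar> \<le> 1 / ?D u" for u
    proof -
      have "\<bar>d + 1 - d * u^2\<bar> \<le> ?D u" using d by (simp add: abs_le_iff)
      then have "\<bar>d + 1 - d * u^2\<bar> / (?D u)^2 \<le> ?D u / (?D u)^2" by (rule divide_right_mono) simp
      also have "\<dots> = 1 / ?D u" using pos[of u] by (simp add: power2_eq_square)
      finally show ?thesis by (simp add: abs_divide)
    qed
    then show "AE u in lborel. norm (?h u) \<le> norm (1 / ?D u)" using pos by (auto simp: less_imp_le)
  qed measurable
  have h0: "(LINT u|lborel. ?h u) = 0"
  proof -
    have lim: "((\<lambda>u. u / ?D u) \<longlongrightarrow> 0) F" if F: "filterlim (\<lambda>u. inverse u) (nhds 0) F" "eventually (\<lambda>u. u \<noteq> 0) F" for F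
    proof (rule Lim_null_comparison)
      show "\<forall>\<^sub>F u in F. norm (u / ?D u) \<le> 1 / d * \<bar>inverse u\<bar>" using F(2)
      proof eventually_elim
        case (elim u)
        have "\<bar>u\<bar> * (d * \<bar>u\<bar>) = d * u^2"
          by (metis abs_mult_self_eq mult.left_commute power2_eq_square)
        then have "\<bar>u\<bar> * (d * \<bar>u\<bar>) \<le> ?D u" using d by linarith
        then show ?case using elim d pos[of u] by (simp add: abs_divide field_simps)
      qed
      show "((\<lambda>u. 1 / d * \<bar>inverse u\<bar>) \<longlongrightarrow> 0) F"
        using tendsto_mult[OF tendsto_const tendsto_rabs[OF F(1)], of "1/d"] by simp
    qed
    have "(LBINT u=-\<infinity>..\<infinity>. ?h u) = 0 - 0"
    proof (rule interval_integral_FTC_integrable[where F="\<lambda>u. u / ?D u"])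
      show "((\<lambda>u. u / ?D u) has_vector_derivative ?h u) (at u)" for u
        unfolding has_real_derivative_iff_has_vector_derivative[symmetric]
        using pos[of u] by (auto intro!: derivative_eq_intros simp: field_simps power2_eq_square)
      show "isCont ?h u" for u using pos[of u] by (intro continuous_intros) auto
      show "set_integrable lborel (einterval (-\<infinity>) \<infinity>) ?h" using hi by (simp add: set_integrable_def)
      show "(((\<lambda>u. u / ?D u) \<circ> real_of_ereal) \<longlongrightarrow> 0) (at_right (-\<infinity>))"
        unfolding ereal_tendsto_simps
        by (rule lim) (auto intro: tendsto_inverse_0 filterlim_mono[OF _ order_refl at_bot_le_at_infinity] eventually_not_equal_at_infinity filter_leD[OF at_bot_le_at_infinity])
      show "(((\<lambda>u. u / ?D u) \<circ> real_of_ereal) \<longlongrightarrow> 0) (at_left \<infinity>)"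
        unfolding ereal_tendsto_simps
        by (rule lim) (auto intro: tendsto_inverse_0 filterlim_mono[OF _ order_refl at_top_le_at_infinity] eventually_not_equal_at_infinity filter_leD[OF at_top_le_at_infinity])
    qed simp
    then show ?thesis by (simp add: interval_lebesgue_integral_def set_lebesgue_integral_def)
  qed
  have "2 * (d * u^2 + d - 1) / (?D u)^2 = 2 * d / (d + 1) * (1 / ?D u) - 2 / (d + 1) * ?h u" for u
  proof -
    have "2 * d / (d + 1) * (1 / ?D u) - 2 / (d + 1) * ?h u
       = (2 * d * ?D u - 2 * (d + 1 - d * u^2)) / ((d + 1) * (?D u)^2)"
      using pos[of u] d by (simp add: divide_simps power2_eq_square)
    also have "2 * d * ?D u - 2 * (d + 1 - d * u^2) = (d + 1) * (2 * (d * u^2 + d - 1))"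
      by (simp add: algebra_simps power2_eq_square)
    finally show ?thesis using d by simp
  qed
  then have "(LINT u|lborel. 2 * (d * u^2 + d - 1) / (?D u)^2)
      = (LINT u|lborel. 2 * d / (d + 1) * (1 / ?D u) - 2 / (d + 1) * ?h u)" by (simp only:)
  also have "\<dots> = 2 * d / (d + 1) * (LINT u|lborel. 1 / ?D u) - 2 / (d + 1) * (LINT u|lborel. ?h u)"
    unfolding Bochner_Integration.integral_diff[OF integrable_mult_right[OF Q(1)] integrable_mult_right[OF hi]]
      integral_mult_right_zero ..
  finally have "(LINT u|lborel. 2 * (d * u^2 + d - 1) / (?D u)^2) = 2 * d / (d + 1) * (LINT u|lborel. 1 / ?D u)"
    unfolding h0 by simp
  then show ?thesis using Q(2) d by simp
qed

section \<open>Rotations, coordinates and a dominating exponential\<close>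

lemma distr_lborel_orthogonal:
  fixes f :: "real^'n::{finite,wellorder} \<Rightarrow> real^'n::_"
  assumes f: "orthogonal_transformation f" shows "distr lborel borel f = lborel"
proof (rule lborel_eqI[symmetric])
  have "continuous_on UNIV f"
    using linear_continuous_on orthogonal_transformation_linear[OF f] linear_conv_bounded_linear by blast
  then have fm: "f \<in> borel_measurable borel" by (rule borel_measurable_continuous_onI)
  have inv: "orthogonal_transformation (inv f)" by (rule orthogonal_transformation_inv[OF f])
  fix l u :: "real^'n::_" assume lu: "\<And>b. b \<in> Basis \<Longrightarrow> l \<bullet> b \<le> u \<bullet> b"
  have vim: "f -` box l u = inv f ` box l u"
    using bij_vimage_eq_inv_image[OF orthogonal_transformation_bij[OF f]] .
  have "f -` box l u \<in> sets borel" using measurable_sets[OF fm, of "box l u"] by simp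
  then have "emeasure lborel (f -` box l u) = emeasure lebesgue (inv f ` box l u)"
    unfolding vim[symmetric] by simp
  also have "\<dots> = ennreal (measure lebesgue (inv f ` box l u))"
    by (rule emeasure_eq_measure2) (use measurable_orthogonal_image[OF inv lmeasurable_box] in \<open>simp\<close>)
  also have "measure lebesgue (inv f ` box l u) = measure lebesgue (box l u)"
    by (rule measure_orthogonal_image[OF inv lmeasurable_box])
  also have "ennreal (measure lebesgue (box l u)) = (\<Prod>b\<in>Basis. (u - l) \<bullet> b)"
    using lu by (simp add: measure_lborel_box_eq)
  finally show "emeasure (distr lborel borel f) (box l u) = (\<Prod>b\<in>Basis. (u - l) \<bullet> b)"
    using fm by (simp add: emeasure_distr)
qed simp

text \<open>The nesting \<open>((x, y), z)\<close> lets Fubini integrate out the height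
  \<open>z\<close> over a planar pair.\<close>

definition vec3 :: "(real \<times> real) \<times> real \<Rightarrow> real^3" where
  "vec3 p = vector [fst (fst p), snd (fst p), snd p]"

lemma vec3_nth [simp]: "vec3 ((x, y), z) $ 1 = x" "vec3 ((x, y), z) $ 2 = y" "vec3 ((x, y), z) $ 3 = z"
  by (simp_all add: vec3_def)

lemma continuous_vec3: "continuous_on UNIV vec3"
proof -
  have "vec3 = (\<lambda>p. \<chi> i. if i = 1 then fst (fst p) else if i = 2 then snd (fst p) else snd p)"
    by (rule ext) (simp add: vec3_def vec_eq_iff forall_3)
  moreover have "continuous_on UNIV (\<lambda>p::(real\<times>real)\<times>real. (\<chi> i::3. if i = 1 then fst (fst p) else if i = 2 then snd (fst p) else snd p))"
  proof (rule continuous_on_vec_lambda)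
    show "continuous_on UNIV (\<lambda>p::(real\<times>real)\<times>real. if i = 1 then fst (fst p) else if i = 2 then snd (fst p) else snd p)"
      for i :: 3
      by (cases "i = 1"; cases "i = 2") (auto intro!: continuous_intros)
  qed
  ultimately show ?thesis by (simp only:)
qed

lemma distr_lborel_vec3: "distr lborel borel vec3 = lborel"
proof (rule lborel_eqI[symmetric])
  have fm: "vec3 \<in> borel_measurable borel" by (rule borel_measurable_continuous_onI[OF continuous_vec3])
  fix l u :: "real^3" assume lu: "\<And>b. b \<in> Basis \<Longrightarrow> l \<bullet> b \<le> u \<bullet> b"
  have le: "l $ i \<le> u $ i" for i using lu[of "axis i 1"] by (simp add: axis_in_Basis_iff inner_axis)
  have "vec3 -` box l u = ({l$1<..<u$1} \<times> {l$2<..<u$2}) \<times> {l$3<..<u$3}"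
    by (auto simp: mem_box_cart forall_3)
  then have "emeasure (distr lborel borel vec3) (box l u)
      = emeasure (lborel \<Otimes>\<^sub>M lborel) (({l$1<..<u$1} \<times> {l$2<..<u$2}) \<times> {l$3<..<u$3})"
    using fm by (simp add: emeasure_distr lborel_prod)
  also have "\<dots> = emeasure (lborel \<Otimes>\<^sub>M lborel) ({l$1<..<u$1} \<times> {l$2<..<u$2}) * emeasure lborel {l$3<..<u$3}"
    by (subst lborel.emeasure_pair_measure_Times) (auto simp: lborel_prod intro!: borel_open open_Times)
  also have "\<dots> = ennreal (u$1 - l$1) * ennreal (u$2 - l$2) * ennreal (u$3 - l$3)"
    using le by (subst lborel.emeasure_pair_measure_Times) auto
  also have "\<dots> = ennreal (\<Prod>i\<in>UNIV. u$i - l$i)"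
  proof -
    have "(\<Prod>i\<in>UNIV. u$i - l$i) = (u$1 - l$1) * (u$2 - l$2) * (u$3 - l$3)" unfolding UNIV_3 by simp
    then show ?thesis using le by (simp add: ennreal_mult[symmetric] mult.assoc)
  qed
  also have "(\<Prod>i\<in>UNIV. u$i - l$i) = (\<Prod>b\<in>Basis. (u - l) \<bullet> b)"
  proof -
    have B: "(Basis :: (real^3) set) = (\<lambda>i. axis i 1) ` UNIV" by (auto simp: Basis_vec_def)
    have "inj (\<lambda>i::3. axis i (1::real))" by (simp add: inj_def axis_eq_axis)
    then have "(\<Prod>b\<in>Basis. (u - l) \<bullet> b) = (\<Prod>i\<in>UNIV. (u - l) \<bullet> axis i 1)"
      unfolding B by (subst prod.reindex) (simp_all add: o_def)
    then show ?thesis by (simp add: inner_axis)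
  qed
  finally show "emeasure (distr lborel borel vec3) (box l u) = (\<Prod>b\<in>Basis. (u - l) \<bullet> b)" .
qed simp

text \<open>The absolute coordinates add up to at most \<open>3 |y|\<close>, so the function lies
  below a product of one-dimensional exponentials of rate \<open>c / 3\<close>.\<close>

lemma integrable_exp_norm:
  fixes c :: real assumes c: "c > 0"
  shows "integrable lborel (\<lambda>y::real^3. exp (- (c * norm y)))"
proof -
  let ?g = "\<lambda>y::real^3. \<Prod>b\<in>Basis. exp (- (c / 3 * \<bar>y \<bullet> b\<bar>))"
  have i1: "integrable lborel (\<lambda>t. exp (- (c / 3 * \<bar>t\<bar>)))"
  proof -
    \<comment> \<open>Starting at -1 makes the half line and its mirror image cover 0 as well, so
      the bound below holds at every point.\<close>
    have h: "integrable lborel (\<lambda>t. indicator {-1<..} t * exp (- (c / 3 * t)))"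
      by (rule exp_half_line) (use c in simp)
    then have h': "integrable lborel (\<lambda>t. indicator {-1<..} (- t) * exp (- (c / 3 * - t)))"
      using lborel_integrable_real_affine[OF h, of "-1" 0] by simp
    show ?thesis
    proof (rule Bochner_Integration.integrable_bound[OF Bochner_Integration.integrable_add[OF h h']])
      show "AE t in lborel. norm (exp (- (c / 3 * \<bar>t\<bar>))) \<le>
        norm (indicator {-1<..} t * exp (- (c / 3 * t)) + indicator {-1<..} (- t) * exp (- (c / 3 * - t)))"
      proof (rule AE_I2)
        fix t :: real
        let ?p = "indicator {-1<..} t * exp (- (c / 3 * t))" and ?q = "indicator {-1<..} (- t) * exp (- (c / 3 * - t))"
        have "0 \<le> ?p" "0 \<le> ?q" by simp_all
        moreover have "exp (- (c / 3 * \<bar>t\<bar>)) = ?p \<or> exp (- (c / 3 * \<bar>t\<bar>)) = ?q"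
          by (cases "t \<ge> 0") auto
        ultimately show "norm (exp (- (c / 3 * \<bar>t\<bar>))) \<le> norm (?p + ?q)" by (auto simp del: minus_mult_right)
      qed
    qed measurable
  qed
  have "(\<integral>\<^sup>+y. ennreal (?g y) \<partial>lborel) = (\<Prod>b\<in>(Basis::(real^3) set). \<integral>\<^sup>+t. ennreal (exp (- (c / 3 * \<bar>t\<bar>))) \<partial>lborel)"
    using nn_integral_lborel_prod[of "\<lambda>b::real^3. \<lambda>t. ennreal (exp (- (c / 3 * \<bar>t\<bar>)))"]
    by (simp add: prod_ennreal)
  also have "\<dots> < \<infinity>"
    using i1 by (auto simp: integrable_iff_bounded less_top ennreal_prod_eq_top power_less_top_ennreal)
  finally have g: "integrable lborel ?g"
    by (intro integrableI_bounded) (simp_all add: prod_nonneg)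
  show ?thesis
  proof (rule Bochner_Integration.integrable_bound[OF g])
    have "exp (- (c * norm y)) \<le> ?g y" for y :: "real^3"
    proof -
      have "(\<Sum>b\<in>Basis. \<bar>y \<bullet> b\<bar>) \<le> (\<Sum>b\<in>(Basis::(real^3) set). norm y)"
        by (rule sum_mono) (rule Basis_le_norm)
      then have "(\<Sum>b\<in>Basis. \<bar>y \<bullet> b\<bar>) \<le> 3 * norm y" by simp
      then have "c / 3 * (\<Sum>b\<in>Basis. \<bar>y \<bullet> b\<bar>) \<le> c * norm y"
        using c mult_left_mono[of "\<Sum>b\<in>Basis. \<bar>y \<bullet> b\<bar>" "3 * norm y" "c / 3"] by simp
      moreover have "?g y = exp (- (c / 3 * (\<Sum>b\<in>Basis. \<bar>y \<bullet> b\<bar>)))"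
        by (simp add: exp_sum[symmetric] sum_negf sum_distrib_left)
      ultimately show ?thesis by simp
    qed
    then show "AE y in lborel. norm (exp (- (c * norm y))) \<le> norm (?g y)"
      by (intro AE_I2) (simp add: abs_of_nonneg prod_nonneg)
  qed measurable
qed

text \<open>For a unit vector \<open>a\<close>, \<open>\<kappa>\<close> is the cosine of the half
  opening angle; the strict inequality excludes the apex.\<close>

definition axial_cone :: "real^3 \<Rightarrow> real \<Rightarrow> (real^3) set" where
  "axial_cone a \<kappa> = {y. y \<bullet> a > \<kappa> * norm y}"

lemma open_axial_cone: "open (axial_cone a \<kappa>)"
  unfolding axial_cone_def by (intro open_Collect_less continuous_intros)

text \<open>Substituting \<open>y = x u\<close> turns the exponent into
  \<open>- \<delta> |x| sqrt (1 + u^2)\<close> with Jacobian \<open>|x|\<close>, so the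
  \<open>x\<close> integral is explicit after exchanging the order. What remains is the line
  integral of \<open>quadratic_line_pos\<close> with \<open>d = \<delta>^2\<close>.\<close>

lemma planar_exponential_integral:
  fixes \<delta> :: real assumes \<delta>: "\<delta> > 0"
    and int: "integrable (lborel \<Otimes>\<^sub>M lborel) (\<lambda>(x, y). cos x * exp (- (\<delta> * sqrt (x^2 + y^2))))"
  shows "(LINT p|(lborel \<Otimes>\<^sub>M lborel). (case p of (x, y) \<Rightarrow> cos x * exp (- (\<delta> * sqrt (x^2 + y^2))))) > 0"
proof -
  define s where "s u = \<delta> * sqrt (1 + u^2)" for u
  have s: "s u > 0" for u using \<delta> by (simp add: s_def add_pos_nonneg)
  have s2: "(s u)^2 = \<delta>^2 * u^2 + \<delta>^2" for u by (simp add: s_def power_mult_distrib algebra_simps)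
  have d: "\<delta>^2 > 0" using \<delta> by simp
  let ?G = "\<lambda>(u, x). \<bar>x\<bar> * cos x * exp (- (s u * \<bar>x\<bar>))"
  have sm: "s \<in> borel_measurable borel" unfolding s_def[abs_def] by measurable
  have G: "integrable (lborel \<Otimes>\<^sub>M lborel) ?G"
  proof (rule lborel_pair.Fubini_integrable)
    show "?G \<in> borel_measurable (lborel \<Otimes>\<^sub>M lborel)" using sm by measurable
    have nb: "integrable lborel (\<lambda>x. norm (?G (u, x))) \<and> (LINT x|lborel. norm (?G (u, x))) \<le> 2 / (s u)^2" for u
    proof
      show i: "integrable lborel (\<lambda>x. norm (?G (u, x)))" using integrable_norm[OF even_linear_exp_cos(1)[OF s[of u]]] by simp
      have "(LINT x|lborel. norm (?G (u, x))) \<le> (LINT x|lborel. \<bar>x\<bar> * exp (- (s u * \<bar>x\<bar>)))"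
        by (rule integral_mono[OF i even_linear_exp_cos(3)[OF s]]) (auto simp: abs_mult mult_left_le intro!: mult_right_mono)
      then show "(LINT x|lborel. norm (?G (u, x))) \<le> 2 / (s u)^2" using even_linear_exp_cos(4)[OF s] by simp
    qed
    show "integrable lborel (\<lambda>u. LINT x|lborel. norm (?G (u, x)))"
    proof (rule Bochner_Integration.integrable_bound)
      \<comment> \<open>The inner integral of the absolute value is at most
        \<open>2 / (s u)^2\<close>, of order \<open>1 / u^2\<close> for large \<open>u\<close>; the
        integrand of \<open>inverse_quadratic_line\<close> dominates it up to a constant.\<close>
      show "integrable lborel (\<lambda>u. (2 * (\<delta>^2 + 1) / \<delta>^2) * (1 / (\<delta>^2 * u^2 + \<delta>^2 + 1)))"
        by (intro integrable_mult_right inverse_quadratic_line(1) d)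
      show "(\<lambda>u. LINT x|lborel. norm (?G (u, x))) \<in> borel_measurable lborel"
        using sm by measurable
      have bnd: "2 / (s u)^2 \<le> (2 * (\<delta>^2 + 1) / \<delta>^2) * (1 / (\<delta>^2 * u^2 + \<delta>^2 + 1))" for u
      proof -
        have p: "\<delta>^2 * u^2 + \<delta>^2 > 0" "\<delta>^2 * u^2 \<ge> 0" using d by (auto intro: add_nonneg_pos)
        have "\<delta>^2 * (\<delta>^2 * u^2 + \<delta>^2 + 1) \<le> (\<delta>^2 + 1) * (\<delta>^2 * u^2 + \<delta>^2)"
          using p(2) by (simp add: algebra_simps)
        then have "2 * (\<delta>^2 * (\<delta>^2 * u^2 + \<delta>^2 + 1)) \<le> 2 * (\<delta>^2 + 1) * (\<delta>^2 * u^2 + \<delta>^2)"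
          unfolding mult.assoc[of 2] by (rule mult_left_mono) simp
        moreover have "\<delta>^2 * (\<delta>^2 * u^2 + \<delta>^2 + 1) > 0" using p(1) d by (intro mult_pos_pos) linarith+
        ultimately have "2 \<le> (2 * (\<delta>^2 + 1) * (\<delta>^2 * u^2 + \<delta>^2)) / (\<delta>^2 * (\<delta>^2 * u^2 + \<delta>^2 + 1))"
          by (subst pos_le_divide_eq)
        then show ?thesis unfolding s2 pos_divide_le_eq[OF p(1)] by (simp add: mult_ac)
      qed
      then show "AE u in lborel. norm (LINT x|lborel. norm (?G (u, x))) \<le> norm ((2 * (\<delta>^2 + 1) / \<delta>^2) * (1 / (\<delta>^2 * u^2 + \<delta>^2 + 1)))"
      proof (intro AE_I2)
        fix u
        have "0 \<le> (LINT x|lborel. norm (?G (u, x)))" by (rule Bochner_Integration.integral_nonneg) simp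
        then show "norm (LINT x|lborel. norm (?G (u, x))) \<le> norm ((2 * (\<delta>^2 + 1) / \<delta>^2) * (1 / (\<delta>^2 * u^2 + \<delta>^2 + 1)))"
          using order_trans[OF conjunct2[OF nb[of u]] bnd[of u]] unfolding real_norm_def by linarith
      qed
    qed
    show "AE u in lborel. integrable lborel (\<lambda>x. ?G (u, x))"
      using even_linear_exp_cos(1)[OF s] by (intro AE_I2) simp
  qed
  \<comment> \<open>The substitution degenerates only at \<open>x = 0\<close>, a null set.\<close>
  have inner: "AE x in lborel. (LINT y|lborel. cos x * exp (- (\<delta> * sqrt (x^2 + y^2)))) = (LINT u|lborel. ?G (u, x))"
    using AE_lborel_singleton[of 0]
  proof eventually_elim
    case (elim x)
    have "(LINT y|lborel. cos x * exp (- (\<delta> * sqrt (x^2 + y^2))))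
        = \<bar>x\<bar> *\<^sub>R (LINT u|lborel. cos x * exp (- (\<delta> * sqrt (x^2 + (0 + x * u)^2))))"
      by (rule lborel_integral_real_affine[OF elim])
    also have "\<dots> = (LINT u|lborel. \<bar>x\<bar> * (cos x * exp (- (\<delta> * sqrt (x^2 + (0 + x * u)^2)))))" by simp
    also have "\<dots> = (LINT u|lborel. ?G (u, x))"
    proof (rule Bochner_Integration.integral_cong[OF refl])
      fix u
      have "x^2 + (0 + x * u)^2 = x^2 * (1 + u^2)" by (simp add: power_mult_distrib algebra_simps)
      then have "sqrt (x^2 + (0 + x * u)^2) = \<bar>x\<bar> * sqrt (1 + u^2)" by (simp add: real_sqrt_mult)
      then show "\<bar>x\<bar> * (cos x * exp (- (\<delta> * sqrt (x^2 + (0 + x * u)^2)))) = ?G (u, x)"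
        by (simp add: s_def mult_ac)
    qed
    finally show ?case .
  qed
  have "(LINT p|(lborel \<Otimes>\<^sub>M lborel). (case p of (x, y) \<Rightarrow> cos x * exp (- (\<delta> * sqrt (x^2 + y^2)))))
      = (LINT x|lborel. LINT y|lborel. cos x * exp (- (\<delta> * sqrt (x^2 + y^2))))"
    using lborel_pair.integral_fst'[OF int] by simp
  also have "\<dots> = (LINT x|lborel. LINT u|lborel. ?G (u, x))"
    by (rule integral_cong_AE) (use sm inner in \<open>measurable\<close>)
  also have "\<dots> = (LINT u|lborel. LINT x|lborel. ?G (u, x))"
    using lborel_pair.Fubini_integral[of "\<lambda>u x. ?G (u, x)"] G by simp
  also have "\<dots> = (LINT u|lborel. 2 * (\<delta>^2 * u^2 + \<delta>^2 - 1) / (\<delta>^2 * u^2 + \<delta>^2 + 1)^2)"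
    using even_linear_exp_cos(2)[OF s] by (simp add: s2)
  also have "\<dots> > 0" by (rule quadratic_line_pos[OF d])
  finally show ?thesis .
qed


text \<open>In the orthonormal frame \<open>b\<close>, \<open>c\<close>, \<open>a\<close> the cone
  is \<open>z > \<delta> sqrt (x^2 + y^2)\<close>. Integrating the real part
  \<open>cos x exp (- z)\<close> over \<open>z\<close> leaves the planar integral, whose positivity
  settles the claim without a closed form.\<close>

lemma cone_laplace:
  fixes a b :: "real^3"
  assumes a: "norm a = 1" and b: "norm b = 1" and ab: "a \<bullet> b = 0" and \<kappa>: "0 < \<kappa>" "\<kappa> < 1"
  shows "integrable lborel (\<lambda>y. indicator (axial_cone a \<kappa>) y *\<^sub>R exp (Complex (- (a \<bullet> y)) (b \<bullet> y)))" (is "integrable lborel ?f")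
    and "(LINT y|lborel. indicator (axial_cone a \<kappa>) y *\<^sub>R exp (Complex (- (a \<bullet> y)) (b \<bullet> y))) \<noteq> 0"
proof -
  have Cm: "(\<lambda>y. Complex (- (a \<bullet> y)) (b \<bullet> y)) \<in> borel_measurable borel"
    by (intro borel_measurable_continuous_onI) (simp add: Complex_eq continuous_intros)
  have fm: "?f \<in> borel_measurable borel"
    using Cm open_axial_cone[of a \<kappa>]
    by (intro borel_measurable_scaleR borel_measurable_indicator borel_open measurable_compose[OF Cm borel_measurable_exp])
  show fi: "integrable lborel ?f"
  proof (rule Bochner_Integration.integrable_bound[OF integrable_exp_norm[OF \<kappa>(1)]])
    show "?f \<in> borel_measurable lborel" using fm by simp
    show "AE y in lborel. norm (?f y) \<le> norm (exp (- (\<kappa> * norm y)))"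
      by (intro AE_I2) (auto simp: indicator_def axial_cone_def inner_commute norm_exp_eq_Re)
  qed
  define c where "c = cross3 a b"
  have cc: "c \<bullet> a = 0" "c \<bullet> b = 0" by (simp_all add: c_def inner_commute[of _ a] inner_commute[of _ b] dot_cross_self)
  have nc: "c \<bullet> c = 1"
    using norm_cross_dot[of a b] a b ab by (simp add: c_def power2_norm_eq_inner[symmetric] power_mult_distrib)
  have aa: "a \<bullet> a = 1" "b \<bullet> b = 1" using a b by (simp_all add: dot_square_norm)
  define T :: "real^3 \<Rightarrow> real^3" where "T v = (v$1) *\<^sub>R b + (v$2) *\<^sub>R c + (v$3) *\<^sub>R a" for v
  have in1: "(p *\<^sub>R b + q *\<^sub>R c + r *\<^sub>R a) \<bullet> (p' *\<^sub>R b + q' *\<^sub>R c + r' *\<^sub>R a) = p * p' + q * q' + r * r'" for p q r p' q' r'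
    using ab cc by (simp add: inner_add_left inner_add_right aa nc inner_commute)
  have T: "orthogonal_transformation T"
    unfolding orthogonal_transformation_def
  proof
    show "linear T" by (rule linearI) (simp_all add: T_def algebra_simps)
    show "\<forall>v w. T v \<bullet> T w = v \<bullet> w" unfolding T_def in1 by (simp add: inner_vec_def sum_3)
  qed
  have Tm: "T \<in> borel_measurable borel"
    using orthogonal_transformation_linear[OF T]
    by (intro borel_measurable_continuous_onI linear_continuous_on) (simp add: linear_conv_bounded_linear)
  have vm: "vec3 \<in> borel_measurable borel" by (rule borel_measurable_continuous_onI[OF continuous_vec3])
  define \<Phi> where "\<Phi> p = T (vec3 p)" for p
  have \<Phi>m: "\<Phi> \<in> borel_measurable borel" unfolding \<Phi>_def[abs_def] using measurable_compose[OF vm Tm] .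
  have D: "lborel = distr lborel borel \<Phi>"
  proof -
    have "distr (distr lborel borel vec3) borel T = distr lborel borel (T \<circ> vec3)"
      by (rule distr_distr) (use Tm vm in auto)
    then show ?thesis
      unfolding distr_lborel_vec3 distr_lborel_orthogonal[OF T] \<Phi>_def[abs_def] o_def by simp
  qed
  \<comment> \<open>If \<open>\<kappa>\<close> is the cosine of the half opening angle,
    \<open>\<delta>\<close> is its cotangent, the slope of the cone.\<close>
  define \<delta> where "\<delta> = \<kappa> / sqrt (1 - \<kappa>^2)"
  have k2: "\<kappa>^2 < 1" using \<kappa> by (simp add: power_less_one_iff abs_square_less_1)
  have \<delta>: "\<delta> > 0" using \<kappa> k2 by (simp add: \<delta>_def)
  have \<delta>2: "\<delta>^2 * (1 - \<kappa>^2) = \<kappa>^2" using k2 by (simp add: \<delta>_def power_divide)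
  have val: "a \<bullet> \<Phi> ((x, y), z) = z" "b \<bullet> \<Phi> ((x, y), z) = x" "(norm (\<Phi> ((x, y), z)))^2 = x^2 + y^2 + z^2" for x y z
  proof -
    show "a \<bullet> \<Phi> ((x, y), z) = z" "b \<bullet> \<Phi> ((x, y), z) = x"
      using in1[of 0 0 1 x y z] in1[of 1 0 0 x y z] by (simp_all add: \<Phi>_def T_def)
    show "(norm (\<Phi> ((x, y), z)))^2 = x^2 + y^2 + z^2"
      unfolding power2_norm_eq_inner \<Phi>_def T_def in1 by (simp add: power2_eq_square)
  qed
  have mem: "\<Phi> ((x, y), z) \<in> axial_cone a \<kappa> \<longleftrightarrow> \<delta> * sqrt (x^2 + y^2) < z" for x y z
  proof -
    let ?w = "x^2 + y^2"
    have w: "?w \<ge> 0" by simp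
    have "\<Phi> ((x, y), z) \<in> axial_cone a \<kappa> \<longleftrightarrow> \<kappa> * norm (\<Phi> ((x, y), z)) < z"
      by (simp add: axial_cone_def val inner_commute)
    also have "\<dots> \<longleftrightarrow> 0 < z \<and> (\<kappa> * norm (\<Phi> ((x, y), z)))^2 < z^2"
    proof (cases "0 < z")
      case True
      then show ?thesis using \<kappa> power_strict_mono[of "\<kappa> * norm (\<Phi> ((x, y), z))" z 2]
          power2_less_imp_less[of "\<kappa> * norm (\<Phi> ((x, y), z))" z] by auto
    next
      case False
      moreover have "0 \<le> \<kappa> * norm (\<Phi> ((x, y), z))" using \<kappa> by simp
      ultimately show ?thesis by linarith
    qed
    also have "(\<kappa> * norm (\<Phi> ((x, y), z)))^2 < z^2 \<longleftrightarrow> (1 - \<kappa>^2) * (\<delta>^2 * ?w) < (1 - \<kappa>^2) * z^2"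
    proof -
      have e1: "(\<kappa> * norm (\<Phi> ((x, y), z)))^2 = \<kappa>^2 * (?w + z^2)" by (simp add: power_mult_distrib val)
      have e2: "(1 - \<kappa>^2) * (\<delta>^2 * ?w) = \<kappa>^2 * ?w" using \<delta>2 by (simp add: mult_ac flip: mult.assoc)
      show ?thesis unfolding e1 e2 by (simp only: left_diff_distrib distrib_left) linarith
    qed
    also have "\<dots> \<longleftrightarrow> (\<delta> * sqrt ?w)^2 < z^2" using k2 by (simp add: power_mult_distrib)
    also have "0 < z \<and> (\<delta> * sqrt ?w)^2 < z^2 \<longleftrightarrow> \<delta> * sqrt ?w < z"
    proof -
      have n: "0 \<le> \<delta> * sqrt ?w" using \<delta> by simp
      then show ?thesis using power_strict_mono[of "\<delta> * sqrt ?w" z 2] power2_less_imp_less[of "\<delta> * sqrt ?w" z]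
        by (auto intro: le_less_trans)
    qed
    finally show ?thesis .
  qed
  define h where "h p = Re (?f (\<Phi> p))" for p
  have hval: "h ((x, y), z) = cos x * (indicator {\<delta> * sqrt (x^2 + y^2)<..} z * exp (- (1 * z)))" for x y z
    by (simp add: h_def indicator_def mem val Re_exp)
  have fiD: "integrable lborel (\<lambda>p. ?f (\<Phi> p))"
    using fi integrable_distr[of \<Phi> lborel borel ?f] \<Phi>m D by (metis measurable_lborel1 measurable_lborel2)
  have hi: "integrable (lborel \<Otimes>\<^sub>M lborel) h"
    unfolding lborel_prod h_def[abs_def] by (rule integrable_Re[OF fiD])
  have inner: "(LINT z|lborel. h (p, z)) = (case p of (x, y) \<Rightarrow> cos x * exp (- (\<delta> * sqrt (x^2 + y^2))))" for p
    using exp_half_line(2)[of 1 "\<delta> * sqrt ((fst p)^2 + (snd p)^2)"] by (cases p) (simp add: hval)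
  have "integrable (lborel \<Otimes>\<^sub>M lborel) (\<lambda>(x, y). cos x * exp (- (\<delta> * sqrt (x^2 + y^2))))"
    using lborel_pair.integrable_fst'[OF hi] unfolding inner lborel_prod by simp
  from planar_exponential_integral[OF \<delta> this]
  have "(LINT p|lborel. LINT z|lborel. h (p, z)) > 0"
    unfolding inner lborel_prod by simp
  also have "(LINT p|lborel. LINT z|lborel. h (p, z)) = (LINT p|lborel. h p)"
    using lborel_pair.integral_fst'[OF hi] by (simp add: lborel_prod)
  also have "\<dots> = Re (LINT p|lborel. ?f (\<Phi> p))" unfolding h_def[abs_def] by (rule integral_Re[OF fiD])
  also have "(LINT p|lborel. ?f (\<Phi> p)) = (LINT y|distr lborel borel \<Phi>. ?f y)"
    by (rule integral_distr[symmetric]) (use \<Phi>m fm in auto)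
  also have "\<dots> = (LINT y|lborel. ?f y)" using D by simp
  finally show "(LINT y|lborel. ?f y) \<noteq> 0" by auto
qed

section \<open>Complex geometrical optics at the corner\<close>

lemma dot_complex_3: "dot_complex u v = u$1 * v$1 + u$2 * v$2 + u$3 * v$3"
  by (simp add: dot_complex_def sum_3)

lemma cross3_complex_nth [simp]:
  "cross3_complex u v $ 1 = u$2 * v$3 - u$3 * v$2"
  "cross3_complex u v $ 2 = u$3 * v$1 - u$1 * v$3"
  "cross3_complex u v $ 3 = u$1 * v$2 - u$2 * v$1"
  by (simp_all add: cross3_complex_def)

text \<open>The wave \<open>exp (\<zeta> \<bullet> x)\<close> with \<open>\<zeta> = - t a + \<i> s b\<close>, \<open>s\<^sup>2 = t\<^sup>2 + k\<^sup>2\<close>, so that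
  \<open>\<zeta> \<bullet> \<zeta> = - k\<^sup>2\<close>; the amplitudes are divided by \<open>t\<close>.\<close>

definition cgo_freq :: "real \<Rightarrow> real^3 \<Rightarrow> real^3 \<Rightarrow> real \<Rightarrow> complex^3" where
  "cgo_freq k a b t = (\<chi> i. Complex (- (t * a$i)) (sqrt (t^2 + k^2) * b$i))"

definition cgo_amp :: "real \<Rightarrow> real^3 \<Rightarrow> real^3 \<Rightarrow> real \<Rightarrow> complex^3" where
  "cgo_amp k a b t = (\<chi> i. Complex (- (sqrt (t^2 + k^2) / t * a$i)) (b$i))"

definition cgo_dual :: "real \<Rightarrow> complex \<Rightarrow> real^3 \<Rightarrow> real^3 \<Rightarrow> real \<Rightarrow> complex^3" where
  "cgo_dual k \<beta> a b t = (\<chi> i. \<i> * of_real (k^2) / (\<beta> * of_real t) * of_real (cross3 a b $ i))"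

text \<open>Frequency and amplitude both lie in the span of \<open>a\<close> and \<open>b\<close>,
  so their product is a multiple of \<open>a \<times> b\<close>, with coefficient
  \<open>\<i> (s^2 - t^2) / t = \<i> k^2 / t\<close>. The dual amplitude is defined from it. The two
  identities make the field terms cancel when both Maxwell equations are tested with the
  wave.\<close>

lemma cgo_cross:
  assumes t: "t > 0" and \<beta>: "\<beta> \<noteq> 0" and \<alpha>\<beta>: "\<alpha> * \<beta> = of_real (k^2)" and a: "norm a = 1" and b: "norm b = 1" and ab: "a \<bullet> b = 0"
  shows "cross3_complex (cgo_freq k a b t) (cgo_amp k a b t) = \<beta> *s cgo_dual k \<beta> a b t"
    and "cross3_complex (cgo_freq k a b t) (cgo_dual k \<beta> a b t) = \<alpha> *s cgo_amp k a b t"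
proof -
  define s where "s = sqrt (t^2 + k^2)"
  have s2: "s^2 = t^2 + k^2" by (simp add: s_def)
  have s2': "s * s = t * t + k * k" using s2 by (simp add: power2_eq_square)
  have k2: "k * k = s * s - t * t" using s2' by simp
  have aa: "a$1 * a$1 + a$2 * a$2 + a$3 * a$3 = 1" "b$1 * b$1 + b$2 * b$2 + b$3 * b$3 = 1"
    "a$1 * b$1 + a$2 * b$2 + a$3 * b$3 = 0"
    using a b ab by (simp_all add: norm_eq_1 inner_vec_def sum_3)
  have n: "cgo_freq k a b t $ j = Complex (- (t * a$j)) (s * b$j)" "cgo_amp k a b t $ j = Complex (- (s / t * a$j)) (b$j)" for j
    by (simp_all add: cgo_freq_def cgo_amp_def s_def)
  have "cross3_complex (cgo_freq k a b t) (cgo_amp k a b t) $ i = \<beta> * cgo_dual k \<beta> a b t $ i" for i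
  proof -
    have comp: "Complex (- (t * x)) (s * y) * Complex (- (s / t * x')) y' - Complex (- (t * x')) (s * y') * Complex (- (s / t * x)) y
        = Complex 0 (k * k / t * (x * y' - x' * y))" for x y x' y'
    proof -
      have "s * s * (x * y' - x' * y) - t * t * (x * y' - x' * y) = k * k * (x * y' - x' * y)"
        unfolding s2' by (simp add: algebra_simps)
      then have "k * k / t * (x * y' - x' * y) = s * s * (x * y' - x' * y) / t - t * (x * y' - x' * y)"
        using t by (simp add: divide_simps mult_ac)
      moreover have "Complex (- (t * x)) (s * y) * Complex (- (s / t * x')) y' - Complex (- (t * x')) (s * y') * Complex (- (s / t * x)) y
        = Complex 0 (s * s * (x * y' - x' * y) / t - t * (x * y' - x' * y))"
        using t by (simp add: complex_eq_iff field_simps)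
      ultimately show ?thesis by (simp only:)
    qed
    have "\<beta> * (\<i> * of_real (k^2) / (\<beta> * of_real t) * of_real r) = Complex 0 (k * k / t * r)" for r
    proof -
      have "\<beta> * (\<i> * of_real (k^2) / (\<beta> * of_real t) * of_real r) = \<i> * of_real (k^2 / t * r)"
        using \<beta> t by (simp add: field_simps)
      then show ?thesis by (simp add: complex_eq_iff power2_eq_square)
    qed
    then have d: "\<beta> * cgo_dual k \<beta> a b t $ j = Complex 0 (k * k / t * cross3 a b $ j)" for j
      by (simp add: cgo_dual_def)
    consider "i = 1" | "i = 2" | "i = 3" using exhaust_3 by blast
    then show ?thesis unfolding d by cases (simp_all only: cross3_complex_nth n comp cross3_def vector_3)
  qed
  then show "cross3_complex (cgo_freq k a b t) (cgo_amp k a b t) = \<beta> *s cgo_dual k \<beta> a b t"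
    by (simp add: vec_eq_iff)
  have k\<beta>: "of_real (k^2) / \<beta> = \<alpha>" using \<alpha>\<beta> \<beta> by (simp add: field_simps)
  have e: "Complex p q * (\<i> * \<alpha> / of_real t * of_real r) = \<alpha> * (Complex (- q * r / t) (p * r / t))" for p q r
    using t by (simp add: complex_eq_iff field_simps)
  have d: "cgo_dual k \<beta> a b t $ i = \<i> * \<alpha> / of_real t * of_real (cross3 a b $ i)" for i
    using \<beta> by (simp add: cgo_dual_def k\<beta>[symmetric])
  have "cross3_complex (cgo_freq k a b t) (cgo_dual k \<beta> a b t) $ i = \<alpha> * cgo_amp k a b t $ i" for i
  proof -
    \<comment> \<open>Components of \<open>b \<times> (a \<times> b) = a\<close> and
      \<open>a \<times> (a \<times> b) = - b\<close> for orthonormal \<open>a\<close>,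
      \<open>b\<close>.\<close>
    have bac: "b$2 * (a$1 * b$2 - a$2 * b$1) - b$3 * (a$3 * b$1 - a$1 * b$3) = a$1"
        "b$3 * (a$2 * b$3 - a$3 * b$2) - b$1 * (a$1 * b$2 - a$2 * b$1) = a$2"
        "b$1 * (a$3 * b$1 - a$1 * b$3) - b$2 * (a$2 * b$3 - a$3 * b$2) = a$3"
        "a$2 * (a$1 * b$2 - a$2 * b$1) - a$3 * (a$3 * b$1 - a$1 * b$3) = - b$1"
        "a$3 * (a$2 * b$3 - a$3 * b$2) - a$1 * (a$1 * b$2 - a$2 * b$1) = - b$2"
        "a$1 * (a$3 * b$1 - a$1 * b$3) - a$2 * (a$2 * b$3 - a$3 * b$2) = - b$3"
      using aa by algebra+
    have lin: "\<alpha> * Complex p q - \<alpha> * Complex p' q' = \<alpha> * Complex (p - p') (q - q')" for p q p' q'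
      by (simp add: complex_eq_iff algebra_simps)
    have q: "- (s * x) * y / t - - (s * x') * y' / t = - (s / t * (x * y - x' * y'))"
      "- (t * x) * y / t - - (t * x') * y' / t = - (x * y - x' * y')" for x y x' y'
      using t by (simp_all add: field_simps)
    consider "i = 1" | "i = 2" | "i = 3" using exhaust_3 by blast
    then show ?thesis
      by cases (simp_all only: cross3_complex_nth d n e lin q cross3_simps(5) cross3_def vector_3 bac, simp_all)
  qed
  then show "cross3_complex (cgo_freq k a b t) (cgo_dual k \<beta> a b t) = \<alpha> *s cgo_amp k a b t"
    by (simp add: vec_eq_iff)
qed

lemma cgo_exponent:
  "(\<Sum>i\<in>UNIV. cgo_freq k a b t $ i * of_real (v $ i)) = Complex (- (t * (a \<bullet> v))) (sqrt (t^2 + k^2) * (b \<bullet> v))"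
  by (simp add: cgo_freq_def sum_3 inner_vec_def complex_eq_iff algebra_simps)

section \<open>Truncated waves, scaling and limits\<close>

definition wave :: "complex^3 \<Rightarrow> real^3 \<Rightarrow> real^3 \<Rightarrow> complex" where
  "wave \<zeta> x0 x = exp (\<Sum>i\<in>UNIV. \<zeta> $ i * of_real (x $ i - x0 $ i))"

lemma smooth_wave: "smooth_on UNIV (wave \<zeta> x0)"
  unfolding wave_def[abs_def]
  by (intro smooth_on_exp smooth_on_sum smooth_on_mult smooth_coord) auto

lemma pd_wave: "pd j (wave \<zeta> x0) x = \<zeta> $ j * wave \<zeta> x0 x"
proof -
  have 1: "((\<lambda>x. complex_of_real (x $ i - x0 $ i)) has_derivative (\<lambda>v. of_real (v $ i))) (at x)" for i
  proof -
    have "((\<lambda>x. x $ i - x0 $ i) has_derivative (\<lambda>v. v $ i - 0)) (at x)"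
      by (rule has_derivative_diff[OF bounded_linear_imp_has_derivative[OF bounded_linear_vec_nth]]) simp
    from bounded_linear.has_derivative[OF bounded_linear_of_real this] show ?thesis by simp
  qed
  have 2: "((\<lambda>x. \<Sum>i\<in>UNIV. \<zeta> $ i * complex_of_real (x $ i - x0 $ i)) has_derivative
      (\<lambda>v. \<Sum>i\<in>UNIV. \<zeta> $ i * of_real (v $ i))) (at x)"
    by (intro has_derivative_sum has_derivative_mult_right 1)
  have "(exp has_derivative (*) (exp z)) (at z)" for z :: complex
    using DERIV_exp[of z] by (simp add: has_field_derivative_def)
  from pd_eqI[OF diff_chain_at[OF 2 this, unfolded o_def], of j]
  show ?thesis unfolding wave_def[abs_def]
    by (simp add: axis_def if_distrib[of of_real] mult_delta_right mult.commute cong: if_cong)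
qed

lemma norm_dot_cross_le:
  "norm (dot_complex u (cross3_complex v w)) \<le> 2 * norm v * norm w * (\<Sum>i\<in>UNIV. norm (u $ i))"
proof -
  have c: "norm (cross3_complex v w $ i) \<le> 2 * norm v * norm w" for i
  proof -
    have p: "norm (v$j * w$l) \<le> norm v * norm w" for j l
      unfolding norm_mult by (intro mult_mono Finite_Cartesian_Product.norm_nth_le) auto
    have d: "norm (v$j * w$l - v$j' * w$l') \<le> 2 * norm v * norm w" for j l j' l'
      using norm_triangle_ineq4[of "v$j * w$l" "v$j' * w$l'"] p[of j l] p[of j' l'] by linarith
    consider "i = 1" | "i = 2" | "i = 3" using exhaust_3 by blast
    then show ?thesis by cases (simp_all add: d)
  qed
  have "norm (dot_complex u (cross3_complex v w)) \<le> (\<Sum>i\<in>UNIV. norm (u $ i * cross3_complex v w $ i))"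
    unfolding dot_complex_def by (rule norm_sum)
  also have "\<dots> \<le> (\<Sum>i\<in>UNIV. norm (u $ i) * (2 * norm v * norm w))"
    unfolding norm_mult by (intro sum_mono mult_left_mono c) auto
  finally show ?thesis by (simp add: sum_distrib_right mult.commute)
qed

text \<open>The gradient lives in the shell between the radii \<open>r\<close> and
  \<open>2 r\<close>, away from the apex, where the wave will be exponentially small inside the
  cone.\<close>

lemma radial_cutoff:
  fixes x0 :: "real^3"
  assumes "r > 0"
  obtains \<psi> :: "real^3 \<Rightarrow> complex" and B where "smooth_on UNIV \<psi>" "\<And>x. norm (x - x0) \<ge> 2 * r \<Longrightarrow> \<psi> x = 0"
    "\<And>x. norm (x - x0) \<le> r \<Longrightarrow> \<psi> x = 1" "\<And>x j. norm (x - x0) < r \<Longrightarrow> pd j \<psi> x = 0"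
    "\<And>x. norm (\<psi> x) \<le> B" "\<And>x. norm (\<chi> j. pd j \<psi> x) \<le> B"
proof -
  have "r^2 < (2 * r)^2" using assms by (intro power_strict_mono) auto
  then obtain \<theta> :: "real \<Rightarrow> real" where \<theta>: "smooth_on UNIV \<theta>" "\<And>t. t \<le> r^2 \<Longrightarrow> \<theta> t = 0" "\<And>t. t \<ge> (2*r)^2 \<Longrightarrow> \<theta> t = 1"
    using smooth_cutoff[of "r^2" "(2*r)^2"] by auto
  define h where "h s = complex_of_real (1 - \<theta> s)" for s
  have sh: "smooth_on UNIV h" unfolding h_def[abs_def]
    by (intro smooth_on_bounded_linear[OF bounded_linear_of_real] smooth_on_diff \<theta>(1)) auto
  define \<psi> where "\<psi> x = h (sqd x0 x)" for x
  have s\<psi>: "smooth_on UNIV \<psi>" unfolding \<psi>_def[abs_def] by (rule smooth_radial[OF sh])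
  have out: "\<psi> x = 0" if "norm (x - x0) \<ge> 2 * r" for x
    using \<theta>(3)[of "sqd x0 x"] that assms power_mono[of "2*r" "norm (x - x0)" 2] by (simp add: \<psi>_def h_def sqd_def)
  have inn: "\<psi> x = 1" if "norm (x - x0) \<le> r" for x
    using \<theta>(2)[of "sqd x0 x"] that power_mono[of "norm (x - x0)" r 2] by (simp add: \<psi>_def h_def sqd_def)
  have d0: "pd j \<psi> x = 0" if "norm (x - x0) < r" for x j
  proof -
    have "((\<lambda>_. 1) has_derivative (\<lambda>_. 0)) (at x)" by simp
    then have "(\<psi> has_derivative (\<lambda>_. 0)) (at x)"
      by (rule has_derivative_transform_within_open[of _ _ _ _ "ball x0 r"]) (use that inn in \<open>auto simp: dist_norm norm_minus_commute\<close>)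
    from pd_eqI[OF this] show ?thesis by simp
  qed
  have bd: "\<exists>B\<ge>0. \<forall>x. norm (f x) \<le> B" if f: "smooth_on UNIV f" "\<And>x. x \<notin> cball x0 (2 * r) \<Longrightarrow> f x = 0" for f :: "real^3 \<Rightarrow> complex"
  proof -
    have "compact (f ` cball x0 (2 * r))"
      by (rule compact_continuous_image[OF continuous_on_subset[OF smooth_on_continuous_on[OF f(1)]]]) auto
    then have "\<exists>B. \<forall>x\<in>cball x0 (2*r). norm (f x) \<le> B" by (auto dest!: compact_imp_bounded simp: bounded_iff)
    then obtain B where B: "\<And>x. x \<in> cball x0 (2*r) \<Longrightarrow> norm (f x) \<le> B" by blast
    have "norm (f x) \<le> max 0 B" for x using B[of x] f(2)[of x] by (cases "x \<in> cball x0 (2*r)") auto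
    then show ?thesis by (intro exI[of _ "max 0 B"]) auto
  qed
  have o: "\<psi> x = 0" if "x \<notin> cball x0 (2*r)" for x using out that by (simp add: dist_norm norm_minus_commute)
  have dout: "pd j \<psi> x = 0" if "x \<notin> cball x0 (2*r)" for x j
    by (rule pd_eq0_outside[of "- cball x0 (2*r)"]) (use o that in auto)
  obtain B0 where B0: "B0 \<ge> 0" "\<And>x. norm (\<psi> x) \<le> B0" using bd[OF s\<psi> o] by blast
  have "\<forall>j. \<exists>B\<ge>0. \<forall>x. norm (pd j \<psi> x) \<le> B" using bd[OF smooth_on_pd[OF s\<psi>] dout] by blast
  then obtain B1 where B1: "\<And>j. B1 j \<ge> 0" "\<And>j x. norm (pd j \<psi> x) \<le> B1 j" by metis
  have "norm (\<chi> j. pd j \<psi> x) \<le> (\<Sum>j\<in>UNIV. B1 j)" for x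
  proof -
    have "norm (\<chi> j. pd j \<psi> x) \<le> (\<Sum>j\<in>UNIV. norm (pd j \<psi> x))"
      unfolding norm_vec_def by (rule order_trans[OF L2_set_le_sum]) auto
    also have "\<dots> \<le> (\<Sum>j\<in>UNIV. B1 j)" by (intro sum_mono B1)
    finally show ?thesis .
  qed
  note grad = this
  have S0: "(\<Sum>j\<in>UNIV. B1 j) \<ge> 0" by (intro sum_nonneg B1)
  show ?thesis
  proof (rule that[of \<psi> "B0 + (\<Sum>j\<in>UNIV. B1 j)"])
    show "norm (\<psi> x) \<le> B0 + (\<Sum>j\<in>UNIV. B1 j)" for x using B0(2)[of x] S0 by linarith
    show "norm (\<chi> j. pd j \<psi> x) \<le> B0 + (\<Sum>j\<in>UNIV. B1 j)" for x using grad[of x] B0(1) by linarith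
  qed (fact s\<psi> out inn d0)+
qed

lemma lborel_integral_scale:
  fixes f :: "real^3 \<Rightarrow> complex"
  assumes f: "f \<in> borel_measurable borel" and t: "t > 0"
  shows "of_real (t^3) * (LINT x|lborel. f x) = (LINT y|lborel. f (x0 + (1 / t) *\<^sub>R y))"
proof -
  let ?g = "\<lambda>y. x0 + (1 / t) *\<^sub>R y"
  have g: "?g \<in> borel_measurable borel" by (intro borel_measurable_continuous_onI continuous_intros)
  have "(LINT x|lborel. f x) = (LINT x|density (distr lborel borel ?g) (\<lambda>_. ennreal (\<bar>1 / t\<bar> ^ 3)). f x)"
    using lborel_affine[of "1 / t" x0] t by simp
  also have "\<dots> = (LINT x|distr lborel borel ?g. \<bar>1 / t\<bar> ^ 3 *\<^sub>R f x)"
    by (rule integral_density) (use f in auto)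
  also have "\<dots> = (LINT y|lborel. \<bar>1 / t\<bar> ^ 3 *\<^sub>R f (?g y))"
    by (rule integral_distr) (use g f in auto)
  also have "\<dots> = of_real ((1 / t) ^ 3) * (LINT y|lborel. f (?g y))"
    using t by (simp add: scaleR_conv_of_real)
  finally show ?thesis using t by (simp add: power_divide flip: of_real_mult of_real_power)
qed

lemma dot_complex_linear:
  "dot_complex (u + v) w = dot_complex u w + dot_complex v w"
  "dot_complex w (u + v) = dot_complex w u + dot_complex w v"
  "dot_complex (c *s u) w = c * dot_complex u w" "dot_complex w (c *s u) = c * dot_complex w u"
  by (simp_all add: dot_complex_3 algebra_simps)

lemma cross3_complex_linear:
  "cross3_complex (u + v) w = cross3_complex u w + cross3_complex v w"
  "cross3_complex (c *s u) w = c *s cross3_complex u w"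
  by (simp_all add: vec_eq_iff forall_3 algebra_simps)

lemma integrable_dot_cross:
  assumes U: "\<And>j. loc_integrable (\<lambda>x. U x $ j)" and g: "\<And>j. test_fn V (g j)"
  shows "integrable lebesgue (\<lambda>x. dot_complex (U x) (cross3_complex (\<chi> j. g j x) q))"
proof -
  have i: "integrable lebesgue (\<lambda>x. (U x $ i * g j x) * c)" for i j c
    by (intro integrable_mult_left loc_integrable_test[OF U g])
  have "dot_complex (U x) (cross3_complex (\<chi> j. g j x) q) =
     (U x $ 1 * g 2 x) * q$3 - (U x $ 1 * g 3 x) * q$2 + ((U x $ 2 * g 3 x) * q$1 - (U x $ 2 * g 1 x) * q$3)
     + ((U x $ 3 * g 1 x) * q$2 - (U x $ 3 * g 2 x) * q$1)" for x
    by (simp add: dot_complex_3 algebra_simps)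
  then show ?thesis
    by (simp only:) (intro Bochner_Integration.integrable_add Bochner_Integration.integrable_diff i)
qed

lemma integrable_dot_scale:
  assumes U: "\<And>j. loc_integrable (\<lambda>x. U x $ j)" and g: "test_fn V g"
  shows "integrable lebesgue (\<lambda>x. dot_complex (U x) (g x *s q))"
proof -
  have "dot_complex (U x) (g x *s q) = (\<Sum>i\<in>UNIV. (U x $ i * g x) * q $ i)" for x
    by (simp add: dot_complex_def mult_ac)
  then show ?thesis
    by (simp only:) (intro Bochner_Integration.integrable_sum integrable_mult_left loc_integrable_test[OF U g])
qed

lemma norm_dot_le: "norm (dot_complex u v) \<le> 3 * norm u * norm v"
proof -
  have p: "norm (u$j * v$j) \<le> norm u * norm v" for j
    unfolding norm_mult by (intro mult_mono Finite_Cartesian_Product.norm_nth_le) auto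
  have "norm (dot_complex u v) \<le> (\<Sum>i\<in>UNIV. norm (u $ i * v $ i))"
    unfolding dot_complex_def by (rule norm_sum)
  also have "\<dots> \<le> (\<Sum>i\<in>(UNIV::3 set). norm u * norm v)" by (intro sum_mono p)
  finally show ?thesis by simp
qed

text \<open>The normalised amplitude tends to the null vector \<open>- a + \<i> b\<close>, while its
  dual is \<open>O(1/t)\<close>: in the limit only one current survives. The shift
  \<open>n + 1\<close> keeps \<open>t\<close> positive.\<close>

lemma cgo_limits:
  fixes k :: real and \<beta> :: complex
  defines "t \<equiv> \<lambda>n. real n + 1"
  shows "(\<lambda>n. sqrt ((t n)^2 + k^2) / t n) \<longlonglongrightarrow> 1"
    and "(\<lambda>n. cgo_amp k a b (t n)) \<longlonglongrightarrow> (\<chi> i. Complex (- (a$i)) (b$i))"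
    and "(\<lambda>n. cgo_dual k \<beta> a b (t n)) \<longlonglongrightarrow> 0"
proof -
  have tp: "t n > 0" for n by (simp add: t_def)
  have inv: "(\<lambda>n. inverse (t n)) \<longlonglongrightarrow> 0"
    using LIMSEQ_inverse_real_of_nat by (simp add: t_def add.commute)
  have "sqrt ((t n)^2 + k^2) / t n = sqrt (1 + (k * inverse (t n))^2)" for n
  proof -
    have "sqrt ((t n)^2 + k^2) / t n = sqrt (((t n)^2 + k^2) / (t n)^2)"
      using tp[of n] by (simp add: real_sqrt_divide)
    also have "((t n)^2 + k^2) / (t n)^2 = 1 + (k * inverse (t n))^2"
      using tp[of n] by (simp add: field_simps)
    finally show ?thesis .
  qed
  moreover have "(\<lambda>n. sqrt (1 + (k * inverse (t n))^2)) \<longlonglongrightarrow> sqrt (1 + (k * 0)^2)"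
    by (intro tendsto_intros inv)
  ultimately show l: "(\<lambda>n. sqrt ((t n)^2 + k^2) / t n) \<longlonglongrightarrow> 1" by simp
  show "(\<lambda>n. cgo_amp k a b (t n)) \<longlonglongrightarrow> (\<chi> i. Complex (- (a$i)) (b$i))"
  proof (rule vec_tendstoI)
    fix i
    have "(\<lambda>n. Complex (- (sqrt ((t n)^2 + k^2) / t n * a$i)) (b$i)) \<longlonglongrightarrow> Complex (- (1 * a$i)) (b$i)"
      by (intro tendsto_Complex tendsto_intros l)
    then show "(\<lambda>n. cgo_amp k a b (t n) $ i) \<longlonglongrightarrow> (\<chi> i. Complex (- (a$i)) (b$i)) $ i"
      by (simp add: cgo_amp_def)
  qed
  show "(\<lambda>n. cgo_dual k \<beta> a b (t n)) \<longlonglongrightarrow> 0"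
  proof (rule vec_tendstoI)
    fix i
    have "(\<lambda>n. \<i> * of_real (k^2) / \<beta> * of_real (cross3 a b $ i) * of_real (inverse (t n)))
        \<longlonglongrightarrow> \<i> * of_real (k^2) / \<beta> * of_real (cross3 a b $ i) * of_real 0"
      by (intro tendsto_intros inv)
    then show "(\<lambda>n. cgo_dual k \<beta> a b (t n) $ i) \<longlonglongrightarrow> 0 $ i"
      by (simp add: cgo_dual_def field_simps)
  qed
qed

text \<open>\<open>Y\<close> collects the currents, \<open>X\<close> the terms with the gradient of
  the cutoff, and the remaining field terms cancel, so the integrals of \<open>X\<close> and
  \<open>Y\<close> agree. The former is exponentially small in \<open>t\<close>, whereas
  \<open>t^3\<close> times the latter tends to the product of the claimed quantity with a nonzero
  Laplace transform. Keeping \<open>\<alpha>\<close> and \<open>\<beta>\<close> abstract lets the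
  two Maxwell equations exchange roles.\<close>

lemma corner_orthogonality:
  fixes E H F G J Jm :: "real^3 \<Rightarrow> complex^3" and x0 a b :: "real^3"
  assumes \<alpha>\<beta>: "\<alpha> * \<beta> = of_real (k^2)" and \<beta>: "\<beta> \<noteq> 0"
    and E: "\<And>j. loc_integrable (\<lambda>x. E x $ j)" and H: "\<And>j. loc_integrable (\<lambda>x. H x $ j)"
    and F: "\<And>j. loc_integrable (\<lambda>x. F x $ j)" and G: "\<And>j. loc_integrable (\<lambda>x. G x $ j)"
    and wE: "has_weak_curl E F" and wH: "has_weak_curl H G"
    and a: "norm a = 1" and b: "norm b = 1" and ab: "a \<bullet> b = 0" and \<kappa>: "0 < \<kappa>" "\<kappa> < 1" and \<rho>0: "\<rho>0 > 0"
    and S: "S = {x \<in> ball x0 \<rho>0. x - x0 \<in> axial_cone a \<kappa>}"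
    and off: "AE x in lebesgue. x \<in> ball x0 \<rho>0 \<and> x \<notin> S \<longrightarrow> E x = 0 \<and> H x = 0"
    and FJ: "AE x in lebesgue. x \<in> ball x0 \<rho>0 \<longrightarrow> F x = \<alpha> *s H x + (if x \<in> S then J x else 0)"
    and GJ: "AE x in lebesgue. x \<in> ball x0 \<rho>0 \<longrightarrow> G x = \<beta> *s E x + (if x \<in> S then Jm x else 0)"
    and J: "continuous_on (closure S) J" and Jm: "continuous_on (closure S) Jm"
  shows "dot_complex (J x0) (\<chi> i. Complex (- (a$i)) (b$i)) = 0"
proof -
  define t where "t n = real n + 1" for n :: nat
  have tp: "t n > 0" "t n \<ge> 1" for n by (simp_all add: t_def)
  define r where "r = \<rho>0 / 3"
  have r: "r > 0" "2 * r < \<rho>0" using \<rho>0 by (simp_all add: r_def)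
  obtain \<psi> :: "real^3 \<Rightarrow> complex" and B where \<psi>: "smooth_on UNIV \<psi>" "\<And>x. norm (x - x0) \<ge> 2 * r \<Longrightarrow> \<psi> x = 0"
    "\<And>x. norm (x - x0) \<le> r \<Longrightarrow> \<psi> x = 1" "\<And>x j. norm (x - x0) < r \<Longrightarrow> pd j \<psi> x = 0"
    "\<And>x. norm (\<psi> x) \<le> B" "\<And>x. norm (\<chi> j. pd j \<psi> x) \<le> B"
    by (rule radial_cutoff[OF r(1), of x0]) blast
  have B0: "B \<ge> 0" using \<psi>(5)[of x0] norm_ge_zero order_trans by blast
  let ?D = "cball x0 (2 * r)"
  have DB: "?D \<subseteq> ball x0 \<rho>0" using r by auto
  have out: "\<psi> x = 0" if "x \<notin> ?D" for x using that \<psi>(2)[of x] by (simp add: dist_norm norm_minus_commute)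
  have dout: "pd j \<psi> x = 0" if "x \<notin> ?D" for x j
    by (rule pd_eq0_outside[of "- ?D"]) (use out that in auto)
  define w where "w n = wave (cgo_freq k a b (t n)) x0" for n
  define f where "f n x = \<psi> x * w n x" for n x
  define Q where "Q n = cgo_amp k a b (t n)" for n
  define P where "P n = cgo_dual k \<beta> a b (t n)" for n
  define grad where "grad x = (\<chi> j. pd j \<psi> x)" for x
  have wv: "w n x = exp (Complex (- (t n * (a \<bullet> (x - x0)))) (sqrt ((t n)^2 + k^2) * (b \<bullet> (x - x0))))" for n x
    using cgo_exponent[of k a b "t n" "x - x0"] by (simp add: w_def wave_def)
  have sw: "smooth_on UNIV (w n)" for n unfolding w_def by (rule smooth_wave)
  have tf: "test_fn (ball x0 \<rho>0) (f n)" for n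
    unfolding test_fn_def f_def[abs_def] using \<psi>(1) sw[of n] DB out
    by (intro conjI exI[of _ ?D] smooth_on_mult) auto
  have tg: "test_fn UNIV (\<lambda>x. pd j \<psi> x * w n x)" for j n
    unfolding test_fn_def using smooth_on_pd[OF \<psi>(1)] sw[of n] dout
    by (intro conjI exI[of _ ?D] smooth_on_mult) auto
  have gf: "(\<chi> j. pd j (f n) x) = f n x *s cgo_freq k a b (t n) + w n x *s grad x" for n x
    unfolding f_def[abs_def] pd_mult[OF \<psi>(1) sw] 
    by (simp add: w_def pd_wave grad_def f_def vec_eq_iff algebra_simps)
  define X where "X n x = w n x * (dot_complex (E x) (cross3_complex (grad x) (Q n)) + dot_complex (H x) (cross3_complex (grad x) (P n)))" for n x
  define JS where "JS x = (if x \<in> S then J x else 0)" for x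
  define JmS where "JmS x = (if x \<in> S then Jm x else 0)" for x
  define Y where "Y n x = f n x * (dot_complex (JS x) (Q n) + dot_complex (JmS x) (P n))" for n x
  have oS: "open S"
  proof -
    have "S = ball x0 \<rho>0 \<inter> (\<lambda>x. x - x0) -` axial_cone a \<kappa>" by (auto simp: S)
    then show ?thesis by (auto intro!: open_Int open_vimage open_axial_cone continuous_intros)
  qed
  have nthm: "(\<lambda>x. (if x \<in> S then g x else 0) $ i) \<in> borel_measurable borel"
    if "continuous_on (closure S) g" for g :: "real^3 \<Rightarrow> complex^3" and i
  proof -
    have "continuous_on S (\<lambda>x. g x $ i)"
      using continuous_on_subset[OF that closure_subset] by (intro continuous_on_component)
    then have "(\<lambda>x. indicator S x *\<^sub>R (g x $ i)) \<in> borel_measurable borel"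
      by (intro borel_measurable_continuous_on_indicator borel_open oS)
    moreover have "(\<lambda>x. indicator S x *\<^sub>R (g x $ i)) = (\<lambda>x. (if x \<in> S then g x else 0) $ i)"
      by (rule ext) (simp add: indicator_def)
    ultimately show ?thesis by simp
  qed
  have Ym: "Y n \<in> borel_measurable borel" for n
  proof -
    have "f n \<in> borel_measurable borel"
      using test_fn_continuous[OF tf] by (rule borel_measurable_continuous_onI)
    then show ?thesis unfolding Y_def[abs_def] dot_complex_def JS_def JmS_def
      by (intro borel_measurable_times borel_measurable_add borel_measurable_sum nthm J Jm borel_measurable_const)
  qed
  have Ym': "Y n \<in> borel_measurable lebesgue" for n
    using Ym[of n] by (intro measurable_completion) simp
  have Xi: "integrable lebesgue (X n)" for n
  proof -
    have "X n x = dot_complex (E x) (cross3_complex (\<chi> j. pd j \<psi> x * w n x) (Q n))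
        + dot_complex (H x) (cross3_complex (\<chi> j. pd j \<psi> x * w n x) (P n))" for x
    proof -
      have "(\<chi> j. pd j \<psi> x * w n x) = w n x *s grad x" by (simp add: grad_def vec_eq_iff mult.commute)
      then show ?thesis by (simp add: X_def cross3_complex_linear dot_complex_linear distrib_left)
    qed
    then have "X n = (\<lambda>x. dot_complex (E x) (cross3_complex (\<chi> j. pd j \<psi> x * w n x) (Q n))
        + dot_complex (H x) (cross3_complex (\<chi> j. pd j \<psi> x * w n x) (P n)))" by blast
    then show ?thesis
      by (simp only:) (intro Bochner_Integration.integrable_add integrable_dot_cross[OF E tg] integrable_dot_cross[OF H tg])
  qed
  have XY: "(LINT x|lborel. Y n x) = (LINT x|lebesgue. X n x)" for n
  proof -
    let ?A1 = "\<lambda>x. dot_complex (E x) (cross3_complex (\<chi> j. pd j (f n) x) (Q n))"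
    let ?A2 = "\<lambda>x. dot_complex (H x) (cross3_complex (\<chi> j. pd j (f n) x) (P n))"
    let ?B1 = "\<lambda>x. dot_complex (F x) (f n x *s Q n)"
    let ?B2 = "\<lambda>x. dot_complex (G x) (f n x *s P n)"
    let ?T = "\<lambda>x. (?A1 x + ?A2 x) - (?B1 x + ?B2 x)"
    have i: "integrable lebesgue ?A1" "integrable lebesgue ?A2" "integrable lebesgue ?B1" "integrable lebesgue ?B2"
      by (rule integrable_dot_cross[OF E test_fn_pd[OF tf]] integrable_dot_cross[OF H test_fn_pd[OF tf]]
          integrable_dot_scale[OF F tf] integrable_dot_scale[OF G tf])+
    have iT: "integrable lebesgue ?T"
      by (intro Bochner_Integration.integrable_diff Bochner_Integration.integrable_add i)
    have "(LINT x|lebesgue. ?T x) = 0"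
      using weak_curl_scale[OF wE tf, of n "Q n"] weak_curl_scale[OF wH tf, of n "P n"]
      by (simp only: Bochner_Integration.integral_diff Bochner_Integration.integral_add i Bochner_Integration.integrable_add) simp
    \<comment> \<open>These identities pair crosswise: the wave part of \<open>?A1\<close> becomes
      \<open>\<beta>\<close> times \<open>E\<close> against \<open>P\<close>, the field part of
      \<open>?B2\<close>, and that of \<open>?A2\<close> becomes \<open>\<alpha>\<close> times
      \<open>H\<close> against \<open>Q\<close>, the field part of \<open>?B1\<close>.\<close>
    note c = cgo_cross[OF tp(1)[of n] \<beta> \<alpha>\<beta> a b ab, folded Q_def P_def]
    have ae: "AE x in lebesgue. Y n x = X n x - ?T x"
      using FJ GJ
    proof eventually_elim
      case (elim x)
      have A: "?A1 x = f n x * (\<beta> * dot_complex (E x) (P n)) + w n x * dot_complex (E x) (cross3_complex (grad x) (Q n))"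
        "?A2 x = f n x * (\<alpha> * dot_complex (H x) (Q n)) + w n x * dot_complex (H x) (cross3_complex (grad x) (P n))"
        unfolding gf cross3_complex_linear c dot_complex_linear by simp_all
      have Bx: "?B1 x = f n x * (\<alpha> * dot_complex (H x) (Q n) + dot_complex (JS x) (Q n))"
        "?B2 x = f n x * (\<beta> * dot_complex (E x) (P n) + dot_complex (JmS x) (P n))"
      proof -
        have "f n x = 0" if "x \<notin> ball x0 \<rho>0"
        proof -
          have "x \<notin> ?D" using DB that by blast
          from out[OF this] show ?thesis by (simp add: f_def)
        qed
        then have "f n x = 0 \<or> (F x = \<alpha> *s H x + JS x \<and> G x = \<beta> *s E x + JmS x)"
          using elim unfolding JS_def JmS_def by blast
        then show "?B1 x = f n x * (\<alpha> * dot_complex (H x) (Q n) + dot_complex (JS x) (Q n))"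
          "?B2 x = f n x * (\<beta> * dot_complex (E x) (P n) + dot_complex (JmS x) (P n))"
          unfolding dot_complex_linear(4) by (auto simp only: dot_complex_linear mult_zero_left)
      qed
      show ?case unfolding A Bx X_def Y_def by (simp add: algebra_simps)
    qed
    have "(LINT x|lebesgue. Y n x) = (LINT x|lebesgue. X n x - ?T x)"
      by (rule integral_cong_AE[OF Ym' _ ae])
        (intro borel_measurable_integrable Bochner_Integration.integrable_diff Xi iT)
    also have "\<dots> = (LINT x|lebesgue. X n x)"
      using \<open>(LINT x|lebesgue. ?T x) = 0\<close> unfolding Bochner_Integration.integral_diff[OF Xi iT] by simp
    finally show ?thesis using integral_completion[of "Y n" lborel] Ym[of n] by simp
  qed
  note lims = cgo_limits[of k, folded t_def]
  obtain CQ where CQ: "\<And>n. norm (Q n) \<le> CQ" "CQ \<ge> 0"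
    using convergent_imp_Bseq[OF convergentI[OF lims(2)[of a b]]] unfolding Q_def[symmetric] Bseq_def by (auto intro: less_imp_le)
  obtain CP where CP: "\<And>n. norm (P n) \<le> CP" "CP \<ge> 0"
    using convergent_imp_Bseq[OF convergentI[OF lims(3)[of \<beta> a b]]] unfolding P_def[symmetric] Bseq_def by (auto intro: less_imp_le)
  define N where "N x = (\<Sum>i\<in>UNIV. norm (E x $ i)) + (\<Sum>i\<in>UNIV. norm (H x $ i))" for x
  define D where "D x = (2 * B * (CQ + CP)) * (indicator ?D x *\<^sub>R N x)" for x
  have Di: "integrable lebesgue D"
  proof -
    have n: "integrable lebesgue (\<lambda>x. indicator ?D x *\<^sub>R norm (U x $ i))" if "loc_integrable (\<lambda>x. U x $ i)" for U :: "real^3 \<Rightarrow> complex^3" and i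
    proof -
      have "integrable lebesgue (\<lambda>x. norm (indicator ?D x *\<^sub>R U x $ i))"
        using that by (intro integrable_norm) (simp add: loc_integrable_def set_integrable_def)
      then show ?thesis by simp
    qed
    have "D x = (2 * B * (CQ + CP)) * ((\<Sum>i\<in>UNIV. indicator ?D x *\<^sub>R norm (E x $ i)) + (\<Sum>i\<in>UNIV. indicator ?D x *\<^sub>R norm (H x $ i)))" for x
      by (simp add: D_def N_def distrib_left sum_distrib_left)
    then have "D = (\<lambda>x. (2 * B * (CQ + CP)) * ((\<Sum>i\<in>UNIV. indicator ?D x *\<^sub>R norm (E x $ i)) + (\<Sum>i\<in>UNIV. indicator ?D x *\<^sub>R norm (H x $ i))))"
      by blast
    then show ?thesis
      by (simp only:) (intro integrable_mult_right Bochner_Integration.integrable_add Bochner_Integration.integrable_sum n E H)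
  qed
  have Xb: "norm (LINT x|lebesgue. X n x) \<le> exp (- (\<kappa> * r * t n)) * (LINT x|lebesgue. D x)" for n
  proof -
    have "norm (LINT x|lebesgue. X n x) \<le> (LINT x|lebesgue. norm (X n x))" by (rule integral_norm_bound)
    also have "\<dots> \<le> (LINT x|lebesgue. exp (- (\<kappa> * r * t n)) * D x)"
    proof (rule Bochner_Integration.integral_mono_AE)
      show "AE x in lebesgue. norm (X n x) \<le> exp (- (\<kappa> * r * t n)) * D x"
        using off
      proof eventually_elim
        case (elim x)
        have N0: "N x \<ge> 0" by (simp add: N_def sum_nonneg)
        have D0: "D x \<ge> 0" using B0 CQ CP N0 by (simp add: D_def)
        show ?case
        proof (cases "x \<in> ?D \<and> norm (x - x0) \<ge> r \<and> x \<in> S")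
          case False
          \<comment> \<open>Outside the shell the cutoff is locally constant; on the shell but off
            \<open>S\<close> both fields vanish.\<close>
          have "grad x = 0 \<or> (E x = 0 \<and> H x = 0)"
          proof (cases "x \<in> ?D \<and> norm (x - x0) \<ge> r")
            case True then show ?thesis using False elim DB by blast
          next
            case False then have "grad x = 0" using dout[of x] \<psi>(4)[of x] by (auto simp: grad_def vec_eq_iff not_le)
            then show ?thesis ..
          qed
          then have "X n x = 0" by (auto simp: X_def dot_complex_3)
          then show ?thesis using D0 by simp
        next
          case True
          \<comment> \<open>On the shell inside the cone \<open>a \<bullet> (x - x0)\<close> is at
            least \<open>\<kappa> r\<close>, which is the rate of exponential decay.\<close>
          have "\<kappa> * r \<le> \<kappa> * norm (x - x0)" using True \<kappa> by (intro mult_left_mono) auto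
          also have "\<dots> \<le> a \<bullet> (x - x0)" using True by (auto simp: S axial_cone_def inner_commute)
          finally have "t n * (\<kappa> * r) \<le> t n * (a \<bullet> (x - x0))" using tp[of n] by (intro mult_left_mono) auto
          then have nw: "norm (w n x) \<le> exp (- (\<kappa> * r * t n))" by (simp add: wv mult_ac norm_exp_eq_Re)
          have e: "norm (dot_complex (U x) (cross3_complex (grad x) q)) \<le> 2 * B * c * N x"
            if "norm q \<le> c" "c \<ge> 0" "(\<Sum>i\<in>UNIV. norm (U x $ i)) \<le> N x" for U q c
          proof -
            have "norm (dot_complex (U x) (cross3_complex (grad x) q)) \<le> 2 * norm (grad x) * norm q * (\<Sum>i\<in>UNIV. norm (U x $ i))"
              by (rule norm_dot_cross_le)
            also have "\<dots> \<le> 2 * B * c * N x"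
              using that \<psi>(6)[of x] B0 by (intro mult_mono) (auto simp: grad_def sum_nonneg)
            finally show ?thesis .
          qed
          have "norm (dot_complex (E x) (cross3_complex (grad x) (Q n)) + dot_complex (H x) (cross3_complex (grad x) (P n)))
             \<le> 2 * B * CQ * N x + 2 * B * CP * N x"
            by (intro norm_triangle_mono e CQ CP) (auto simp: N_def sum_nonneg)
          also have "\<dots> = D x" using True by (simp add: D_def algebra_simps)
          finally show ?thesis unfolding X_def norm_mult using nw by (intro mult_mono) auto
        qed
      qed
    qed (intro integrable_norm Xi integrable_mult_right Di)+
    finally show ?thesis by simp
  qed
  have lim0: "(\<lambda>n. of_real ((t n)^3) * (LINT x|lborel. Y n x)) \<longlonglongrightarrow> 0"
  proof (rule Lim_null_comparison)
    let ?c = "\<kappa> * r"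
    have c: "?c > 0" using \<kappa> r by simp
    have "norm (of_real ((t n)^3) * (LINT x|lborel. Y n x)) \<le> (1 / ?c^3) * ((?c * t n)^3 / exp (?c * t n)) * (LINT x|lebesgue. D x)" for n
    proof -
      have "norm (of_real ((t n)^3) * (LINT x|lborel. Y n x)) \<le> (t n)^3 * (exp (- (?c * t n)) * (LINT x|lebesgue. D x))"
        unfolding XY norm_mult using Xb[of n] tp[of n] by (simp add: norm_power mult_left_mono)
      also have "\<dots> = (1 / ?c^3) * ((?c * t n)^3 / exp (?c * t n)) * (LINT x|lebesgue. D x)"
        using \<kappa> r by (simp add: exp_minus power_mult_distrib field_simps)
      finally show ?thesis .
    qed
    then show "\<forall>\<^sub>F n in sequentially. norm (of_real ((t n)^3) * (LINT x|lborel. Y n x)) \<le> (1 / ?c^3) * ((?c * t n)^3 / exp (?c * t n)) * (LINT x|lebesgue. D x)"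
      by (rule always_eventually[OF allI])
    have "filterlim (\<lambda>n. 1 + real n) at_top sequentially"
      by (rule filterlim_tendsto_add_at_top[OF tendsto_const filterlim_real_sequentially])
    then have "filterlim t at_top sequentially" by (simp add: t_def[abs_def] add.commute)
    then have "filterlim (\<lambda>n. ?c * t n) at_top sequentially"
      by (rule filterlim_tendsto_pos_mult_at_top[OF tendsto_const c])
    then have "(\<lambda>n. (1 / ?c^3) * ((?c * t n)^3 / exp (?c * t n)) * (LINT x|lebesgue. D x)) \<longlonglongrightarrow> (1 / ?c^3) * 0 * (LINT x|lebesgue. D x)"
      by (intro tendsto_intros filterlim_compose[OF tendsto_power_div_exp_0])
    then show "(\<lambda>n. (1 / ?c^3) * ((?c * t n)^3 / exp (?c * t n)) * (LINT x|lebesgue. D x)) \<longlonglongrightarrow> 0" by simp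
  qed
  define \<rho> where "\<rho> = (\<chi> i. Complex (- (a$i)) (b$i))"
  define g where "g y = indicator (axial_cone a \<kappa>) y *\<^sub>R exp (Complex (- (a \<bullet> y)) (b \<bullet> y))" for y
  \<comment> \<open>Zooming in at the apex: the cone is invariant, the Jacobian is the factor
    \<open>t^3\<close>, and \<open>x n y\<close> tends to \<open>x0\<close>.\<close>
  define x where "x n y = x0 + (1 / t n) *\<^sub>R y" for n and y :: "real^3"
  have inv: "(\<lambda>n. 1 / t n) \<longlonglongrightarrow> 0"
    using LIMSEQ_inverse_real_of_nat by (simp add: t_def add.commute inverse_eq_divide)
  have xlim: "(\<lambda>n. x n y) \<longlonglongrightarrow> x0" for y
    using tendsto_add[OF tendsto_const tendsto_scaleR[OF inv tendsto_const], of x0 y] by (simp add: x_def)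
  have cone_x: "x n y - x0 \<in> axial_cone a \<kappa> \<longleftrightarrow> y \<in> axial_cone a \<kappa>" for n y
    using tp[of n] by (simp add: x_def axial_cone_def divide_less_cancel)
  have near: "\<forall>\<^sub>F n in sequentially. norm (x n y - x0) < e" if "e > 0" for e y
    using tendstoD[OF xlim[of y] that] by (simp add: dist_norm)
  have inS: "\<forall>\<^sub>F n in sequentially. x n y \<in> S" if "y \<in> axial_cone a \<kappa>" for y
    using near[OF \<rho>0, of y] by eventually_elim (use that cone_x in \<open>auto simp: S dist_norm norm_minus_commute\<close>)
  have "a \<in> axial_cone a \<kappa>" using a \<kappa> by (simp add: axial_cone_def dot_square_norm)
  then have x0S: "x0 \<in> closure S"
    using inS[of a] closure_subset[of S]
    by (intro Lim_in_closed_set[OF closed_closure _ _ xlim[of a]]) (auto elim: eventually_mono)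
  have bS: "\<exists>M\<ge>0. \<forall>z\<in>S. norm (g z) \<le> M" if "continuous_on (closure S) g" for g :: "real^3 \<Rightarrow> complex^3"
  proof -
    have "bounded S" by (rule bounded_subset[of "ball x0 \<rho>0"]) (auto simp: S)
    then have "compact (closure S)" by (simp add: compact_closure)
    then have "compact (g ` closure S)" by (rule compact_continuous_image[OF that])
    then have "\<exists>M. \<forall>z\<in>closure S. norm (g z) \<le> M" by (auto dest!: compact_imp_bounded simp: bounded_iff)
    then obtain M where "\<And>z. z \<in> S \<Longrightarrow> norm (g z) \<le> M" using closure_subset by blast
    then show ?thesis by (intro exI[of _ "max 0 M"]) fastforce
  qed
  obtain MJ where MJ: "MJ \<ge> 0" "\<And>z. z \<in> S \<Longrightarrow> norm (J z) \<le> MJ" using bS[OF J] by blast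
  obtain Mm where Mm: "Mm \<ge> 0" "\<And>z. z \<in> S \<Longrightarrow> norm (Jm z) \<le> Mm" using bS[OF Jm] by blast
  \<comment> \<open>A bound uniform in \<open>n\<close>, from the cutoff, the currents on
    \<open>S\<close> and the amplitudes; the factors 3 stem from \<open>norm_dot_le\<close>.\<close>
  define L where "L = B * (3 * MJ * CQ + 3 * Mm * CP)"
  have L0: "L \<ge> 0" using B0 MJ Mm CQ CP by (simp add: L_def)
  have wx: "w n (x n y) = exp (Complex (- (a \<bullet> y)) (sqrt ((t n)^2 + k^2) / t n * (b \<bullet> y)))" for n y
    using tp[of n] by (simp add: wv x_def)
  have "(\<lambda>n. LINT y|lborel. Y n (x n y)) \<longlonglongrightarrow> (LINT y|lborel. dot_complex (J x0) \<rho> * g y)"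
  proof (rule integral_dominated_convergence[where w="\<lambda>y. L * exp (- (\<kappa> * norm y))"])
    have gm: "g \<in> borel_measurable lborel"
      using borel_measurable_integrable[OF cone_laplace(1)[OF a b ab \<kappa>]] by (simp add: g_def[abs_def])
    show "(\<lambda>y. dot_complex (J x0) \<rho> * g y) \<in> borel_measurable lborel"
      by (intro borel_measurable_times borel_measurable_const gm)
    have xm: "x n \<in> borel_measurable borel" for n
      unfolding x_def by (intro borel_measurable_continuous_onI continuous_intros)
    show "(\<lambda>y. Y n (x n y)) \<in> borel_measurable lborel" for n
      using measurable_compose[OF xm Ym] by simp
    show "integrable lborel (\<lambda>y::real^3. L * exp (- (\<kappa> * norm y)))"
      by (intro integrable_mult_right integrable_exp_norm \<kappa>)
    show "AE y in lborel. (\<lambda>n. Y n (x n y)) \<longlonglongrightarrow> dot_complex (J x0) \<rho> * g y"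
    proof (rule AE_I2)
      fix y
      show "(\<lambda>n. Y n (x n y)) \<longlonglongrightarrow> dot_complex (J x0) \<rho> * g y"
      proof (cases "y \<in> axial_cone a \<kappa>")
        case False
        then have "Y n (x n y) = 0" for n
          using cone_x[of n y] by (simp add: Y_def JS_def JmS_def S dot_complex_3)
        then show ?thesis using False by (simp add: g_def)
      next
        case True
        have J': "(\<lambda>n. J (x n y)) \<longlonglongrightarrow> J x0" "(\<lambda>n. Jm (x n y)) \<longlonglongrightarrow> Jm x0"
          using inS[OF True] closure_subset[of S]
          by (auto intro!: continuous_on_tendsto_compose[OF J xlim x0S] continuous_on_tendsto_compose[OF Jm xlim x0S] elim: eventually_mono)
        have "(\<lambda>n. w n (x n y)) \<longlonglongrightarrow> exp (Complex (- (a \<bullet> y)) (1 * (b \<bullet> y)))"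
          unfolding wx by (intro tendsto_exp tendsto_Complex tendsto_intros lims(1))
        moreover have "(\<lambda>n. dot_complex (J (x n y)) (Q n) + dot_complex (Jm (x n y)) (P n)) \<longlonglongrightarrow> dot_complex (J x0) \<rho> + dot_complex (Jm x0) 0"
          unfolding dot_complex_def Q_def P_def \<rho>_def by (intro tendsto_intros J' lims(2,3))
        ultimately have "(\<lambda>n. w n (x n y) * (dot_complex (J (x n y)) (Q n) + dot_complex (Jm (x n y)) (P n)))
            \<longlonglongrightarrow> exp (Complex (- (a \<bullet> y)) (1 * (b \<bullet> y))) * (dot_complex (J x0) \<rho> + dot_complex (Jm x0) 0)"
          by (rule tendsto_mult)
        moreover have "\<forall>\<^sub>F n in sequentially. w n (x n y) * (dot_complex (J (x n y)) (Q n) + dot_complex (Jm (x n y)) (P n)) = Y n (x n y)"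
          using inS[OF True] near[OF r(1), of y]
          by eventually_elim (simp add: Y_def f_def JS_def JmS_def \<psi>(3))
        ultimately have "(\<lambda>n. Y n (x n y)) \<longlonglongrightarrow> exp (Complex (- (a \<bullet> y)) (1 * (b \<bullet> y))) * (dot_complex (J x0) \<rho> + dot_complex (Jm x0) 0)"
          by (rule Lim_transform_eventually)
        then show ?thesis using True by (simp add: g_def dot_complex_3 mult.commute)
      qed
    qed
    show "AE y in lborel. norm (Y n (x n y)) \<le> L * exp (- (\<kappa> * norm y))" for n
    proof (rule AE_I2)
      fix y
      show "norm (Y n (x n y)) \<le> L * exp (- (\<kappa> * norm y))"
      proof (cases "x n y \<in> S")
        case False
        then show ?thesis using L0 by (simp add: Y_def JS_def JmS_def dot_complex_3)
      next
        case True
        then have y: "y \<in> axial_cone a \<kappa>" using cone_x by (simp add: S)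
        have nw: "norm (w n (x n y)) \<le> exp (- (\<kappa> * norm y))"
          using y by (simp add: wx axial_cone_def inner_commute norm_exp_eq_Re)
        have "norm (dot_complex (J (x n y)) (Q n)) \<le> 3 * MJ * CQ"
          by (rule order_trans[OF norm_dot_le]) (intro mult_mono, use MJ True CQ in auto)
        moreover have "norm (dot_complex (Jm (x n y)) (P n)) \<le> 3 * Mm * CP"
          by (rule order_trans[OF norm_dot_le]) (intro mult_mono, use Mm True CP in auto)
        ultimately have d: "norm (dot_complex (J (x n y)) (Q n) + dot_complex (Jm (x n y)) (P n)) \<le> 3 * MJ * CQ + 3 * Mm * CP"
          by (rule norm_triangle_mono)
        have "norm (Y n (x n y)) = norm (\<psi> (x n y)) * norm (w n (x n y)) * norm (dot_complex (J (x n y)) (Q n) + dot_complex (Jm (x n y)) (P n))"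
          using True by (simp add: Y_def f_def JS_def JmS_def norm_mult)
        also have "\<dots> \<le> B * exp (- (\<kappa> * norm y)) * (3 * MJ * CQ + 3 * Mm * CP)"
          using nw d \<psi>(5) B0 by (intro mult_mono) auto
        finally show ?thesis by (simp add: L_def mult_ac)
      qed
    qed
  qed
  moreover have "(LINT y|lborel. Y n (x n y)) = of_real ((t n)^3) * (LINT x|lborel. Y n x)" for n
    using lborel_integral_scale[OF Ym tp(1), of n n x0] by (simp add: x_def)
  ultimately have "(\<lambda>n. of_real ((t n)^3) * (LINT x|lborel. Y n x)) \<longlonglongrightarrow> (LINT y|lborel. dot_complex (J x0) \<rho> * g y)"
    by simp
  from LIMSEQ_unique[OF this lim0] have "dot_complex (J x0) \<rho> * (LINT y|lborel. g y) = 0" by simp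
  moreover have "(LINT y|lborel. g y) \<noteq> 0" using cone_laplace(2)[OF a b ab \<kappa>] by (simp add: g_def)
  ultimately show ?thesis by (simp add: \<rho>_def)
qed

section \<open>Non-radiating sources at a conical corner\<close>

text \<open>Arccos is decreasing, so the angle condition says that the cosine of the angle exceeds
  \<open>cos \<theta>0\<close>.\<close>

lemma truncated_cone_eq:
  assumes a: "norm a = 1" and \<theta>: "0 < \<theta>0" "\<theta>0 < pi / 2"
  shows "truncated_cone x0 a \<theta>0 r0 = {x \<in> ball x0 r0. x - x0 \<in> axial_cone a (cos \<theta>0)}"
proof -
  have c: "cos \<theta>0 > 0" using \<theta> by (intro cos_gt_zero_pi) auto
  have arc: "arccos (y \<bullet> a) \<in> {0..<\<theta>0} \<longleftrightarrow> cos \<theta>0 < y \<bullet> a" if "norm y = 1" for y :: "real^3"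
  proof -
    have y: "\<bar>y \<bullet> a\<bar> \<le> 1" using Cauchy_Schwarz_ineq2[of y a] a that by simp
    then have "arccos (y \<bullet> a) < arccos (cos \<theta>0) \<longleftrightarrow> cos \<theta>0 < y \<bullet> a"
      using arccos_less_mono[of "y \<bullet> a" "cos \<theta>0"] by simp
    moreover have "arccos (cos \<theta>0) = \<theta>0" using \<theta> by (intro arccos_cos) auto
    moreover have "0 \<le> arccos (y \<bullet> a)" using y by (intro arccos_lbound) auto
    ultimately show ?thesis by simp
  qed
  have "x \<in> circular_cone x0 a \<theta>0 \<longleftrightarrow> x - x0 \<in> axial_cone a (cos \<theta>0)" for x
  proof
    assume "x \<in> circular_cone x0 a \<theta>0"
    then obtain r y where ry: "x = x0 + r *\<^sub>R y" "r > 0" "norm y = 1" "arccos (y \<bullet> a) \<in> {0..<\<theta>0}"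
      by (auto simp: circular_cone_def)
    then have "cos \<theta>0 * r < r * (y \<bullet> a)" using arc[OF ry(3)] by simp
    then show "x - x0 \<in> axial_cone a (cos \<theta>0)" using ry by (simp add: axial_cone_def)
  next
    assume x: "x - x0 \<in> axial_cone a (cos \<theta>0)"
    define y where "y = (1 / norm (x - x0)) *\<^sub>R (x - x0)"
    have nz: "x - x0 \<noteq> 0" using x by (auto simp: axial_cone_def)
    have ny: "norm y = 1" using nz by (simp add: y_def)
    have "cos \<theta>0 < y \<bullet> a" using x nz by (simp add: y_def axial_cone_def pos_less_divide_eq)
    moreover have "x = x0 + norm (x - x0) *\<^sub>R y" using nz by (simp add: y_def)
    ultimately show "x \<in> circular_cone x0 a \<theta>0"
      unfolding circular_cone_def using ny nz arc[OF ny] by (auto intro!: exI[of _ "norm (x - x0)"] exI[of _ y])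
  qed
  then show ?thesis by (auto simp: truncated_cone_def)
qed

text \<open>Serves to make the boundary of the corner negligible: the frontier of a convex set is a
  null set.\<close>

lemma convex_axial_cone:
  assumes "\<kappa> \<ge> 0" shows "convex (axial_cone a \<kappa>)"
proof (rule convexI)
  fix x y :: "real^3" and u v :: real
  assume xy: "x \<in> axial_cone a \<kappa>" "y \<in> axial_cone a \<kappa>" and uv: "0 \<le> u" "0 \<le> v" "u + v = 1"
  have "\<kappa> * norm (u *\<^sub>R x + v *\<^sub>R y) \<le> \<kappa> * (u * norm x + v * norm y)"
    using norm_triangle_ineq[of "u *\<^sub>R x" "v *\<^sub>R y"] uv assms by (intro mult_left_mono) auto
  also have "\<dots> = u * (\<kappa> * norm x) + v * (\<kappa> * norm y)" by (simp add: algebra_simps)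
  also have "\<dots> < u * (x \<bullet> a) + v * (y \<bullet> a)"
  proof (cases "u = 0")
    case True then show ?thesis using xy uv by (simp add: axial_cone_def)
  next
    case False
    then have "u * (\<kappa> * norm x) < u * (x \<bullet> a)" using xy uv by (simp add: axial_cone_def)
    moreover have "v * (\<kappa> * norm y) \<le> v * (y \<bullet> a)" using xy uv by (intro mult_left_mono) (auto simp: axial_cone_def)
    ultimately show ?thesis by linarith
  qed
  finally show "u *\<^sub>R x + v *\<^sub>R y \<in> axial_cone a \<kappa>" by (simp add: axial_cone_def inner_add_left)
qed

text \<open>Replacing \<open>b\<close> by \<open>- b\<close> splits the condition: \<open>v\<close>
  is bilinearly orthogonal to \<open>a\<close> and to every \<open>b\<close>. Then
  \<open>Re v\<close> and \<open>Im v\<close> are real vectors orthogonal to \<open>a\<close>, and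
  each, if nonzero, is after normalisation itself an admissible \<open>b\<close>.\<close>

lemma zero_if_orthogonal_to_null_vectors:
  fixes v :: "complex^3" and a :: "real^3"
  assumes orth: "\<And>b. norm b = 1 \<Longrightarrow> a \<bullet> b = 0 \<Longrightarrow> dot_complex v (\<chi> i. Complex (- (a$i)) (b$i)) = 0"
  shows "v = 0"
proof -
  define c where "c u = (\<Sum>i\<in>UNIV. v $ i * of_real (u $ i))" for u :: "real^3"
  have e: "dot_complex v (\<chi> i. Complex (- (a$i)) (b$i)) = - c a + \<i> * c b" for b
  proof -
    have "Complex (- (a$i)) (b$i) = - of_real (a$i) + \<i> * of_real (b$i)" for i by (simp add: complex_eq_iff)
    then have "dot_complex v (\<chi> i. Complex (- (a$i)) (b$i)) = dot_complex v (\<chi> i. - of_real (a$i) + \<i> * of_real (b$i))"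
      by (simp only:)
    then show ?thesis by (simp add: dot_complex_3 c_def sum_3 algebra_simps)
  qed
  have cb: "c a = 0 \<and> c b = 0" if "norm b = 1" "a \<bullet> b = 0" for b
  proof -
    have "- c a + \<i> * c b = 0" using orth[OF that] by (simp only: e)
    moreover have "- c a + \<i> * c (- b) = 0" using orth[of "- b"] that by (simp only: e) simp
    moreover have "c (- b) = - c b" by (simp add: c_def sum_negf)
    ultimately show ?thesis by (simp add: complex_eq_iff)
  qed
  obtain b0 where "b0 \<noteq> 0" "orthogonal a b0" using orthogonal_to_vector_exists[of a] by auto
  then have "norm ((1 / norm b0) *\<^sub>R b0) = 1" "a \<bullet> ((1 / norm b0) *\<^sub>R b0) = 0"
    by (auto simp: orthogonal_def)
  from cb[OF this] have ca: "c a = 0" by simp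
  have "(\<chi> i. L (v $ i)) = 0" if L: "\<And>u. L (c u) = (\<chi> i. L (v $ i)) \<bullet> u" "L 0 = 0" for L :: "complex \<Rightarrow> real"
  proof (rule ccontr)
    let ?u = "\<chi> i. L (v $ i)"
    assume nz: "?u \<noteq> 0"
    let ?b = "(1 / norm ?u) *\<^sub>R ?u"
    have "?u \<bullet> a = 0" using L(1)[of a] L(2) ca by simp
    then have "norm ?b = 1" "a \<bullet> ?b = 0" using nz by (simp_all add: inner_commute)
    from cb[OF this] have "?u \<bullet> ?b = 0" using L(1)[of ?b] L(2) by simp
    then show False using nz by simp
  qed
  from this[of Re] this[of Im] have "(\<chi> i. Re (v $ i)) = 0" "(\<chi> i. Im (v $ i)) = 0"
    by (simp_all add: c_def inner_vec_def)
  then show ?thesis by (simp add: vec_eq_iff complex_eq_iff)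
qed

lemma holder_on_continuous_on:
  assumes "holder_on \<alpha> S g" "\<alpha> > 0" shows "continuous_on S g"
  unfolding continuous_on_def
proof
  fix x assume x: "x \<in> S"
  obtain C where C: "\<And>x y. x \<in> S \<Longrightarrow> y \<in> S \<Longrightarrow> norm (g x - g y) \<le> C * dist x y powr \<alpha>"
    using assms(1) by (auto simp: holder_on_def)
  have "((\<lambda>y. C * dist y x powr \<alpha>) \<longlongrightarrow> C * 0) (at x within S)"
  proof (intro tendsto_mult tendsto_const)
    have "((\<lambda>y. dist y x) \<longlongrightarrow> dist x x) (at x within S)" by (intro tendsto_intros)
    then have "((\<lambda>y. dist y x) \<longlongrightarrow> 0) (at x within S)" by simp
    then show "((\<lambda>y. dist y x powr \<alpha>) \<longlongrightarrow> 0) (at x within S)"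
      by (rule tendsto_zero_powrI) (use assms(2) in auto)
  qed
  then have lim: "((\<lambda>y. C * dist y x powr \<alpha>) \<longlongrightarrow> 0) (at x within S)" by simp
  have "\<forall>\<^sub>F y in at x within S. norm (g y - g x) \<le> C * dist y x powr \<alpha>"
    unfolding eventually_at_filter using C x by (intro always_eventually) blast
  from Lim_null_comparison[OF this lim] have "((\<lambda>y. g y - g x) \<longlongrightarrow> 0) (at x within S)" .
  then show "(g \<longlongrightarrow> g x) (at x within S)" by (simp add: LIM_zero_iff)
qed

section \<open>Vanishing of the fields away from the sources\<close>

lemma far_field_zero_decay:
  assumes "far_field_pattern k U Uinf" "\<forall>y\<in>sphere 0 1. Uinf y = 0"
  obtains C R where "R > 0" "AE x in lebesgue. norm x > R \<longrightarrow> norm (U x) \<le> C / (norm x)^2"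
proof -
  obtain C R where ff: "AE x in lebesgue. norm x > R \<longrightarrow>
        norm (U x - (exp (\<i> * of_real (k * norm x)) / of_real (norm x)) *s Uinf (x /\<^sub>R norm x)) \<le> C / (norm x)\<^sup>2"
    using assms(1) by (auto simp: far_field_pattern_def)
  have "AE x in lebesgue. norm x > max R 1 \<longrightarrow> norm (U x) \<le> C / (norm x)^2"
    using ff
  proof eventually_elim
    case (elim x)
    show ?case
    proof
      assume x: "norm x > max R 1"
      then have "norm x \<noteq> 0" by linarith
      then have "x /\<^sub>R norm x \<in> sphere 0 1" by simp
      then have "Uinf (x /\<^sub>R norm x) = 0" using assms(2) by blast
      then show "norm (U x) \<le> C / (norm x)^2" using elim x by simp
    qed
  qed
  then show ?thesis using that[of "max R 1" C] by simp
qed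

text \<open>Rellich's lemma for each component. The symmetric form in \<open>\<alpha>\<close> and
  \<open>\<beta>\<close> makes the statement serve \<open>E\<close> and \<open>H\<close>
  alike.\<close>

lemma maxwell_far_zero:
  fixes E H :: "real^3 \<Rightarrow> complex^3" and \<alpha> \<beta> :: complex
  assumes E: "\<And>j. loc_integrable (\<lambda>x. E x $ j)" and H: "\<And>j. loc_integrable (\<lambda>x. H x $ j)"
    and mE: "\<And>f q. test_fn U f \<Longrightarrow> (LINT x|lebesgue. dot_complex (E x) (cross3_complex (\<chi> j. pd j f x) q))
        = \<alpha> * (LINT x|lebesgue. dot_complex (H x) (f x *s q))"
    and mH: "\<And>f q. test_fn U f \<Longrightarrow> (LINT x|lebesgue. dot_complex (H x) (cross3_complex (\<chi> j. pd j f x) q))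
        = \<beta> * (LINT x|lebesgue. dot_complex (E x) (f x *s q))"
    and nz: "\<alpha> \<noteq> 0" "\<beta> \<noteq> 0" and k: "\<alpha> * \<beta> = of_real (k^2)" "k \<noteq> 0"
    and U: "{x. norm x > R} \<subseteq> U" and R: "R > 0"
    and decay: "AE x in lebesgue. norm x > R \<longrightarrow> norm (E x) \<le> C / (norm x)^2"
  shows "AE x in lebesgue. norm x > R \<longrightarrow> E x = 0"
proof -
  have "AE x in lebesgue. norm x > R \<longrightarrow> E x $ j = 0" for j
  proof (rule rellich[OF E k(2) R])
    show "AE x in lebesgue. norm x > R \<longrightarrow> norm (E x $ j) \<le> C / (norm x)^2"
      using decay by eventually_elim (use Finite_Cartesian_Product.norm_nth_le order_trans in blast)
    show "(LINT x|lebesgue. E x $ j * ((\<Sum>j\<in>UNIV. pd j (pd j f) x) + of_real (k^2) * f x)) = 0"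
      if "test_fn {x. norm x > R} f" for f
      using maxwell_helmholtz[OF E H mE mH nz test_fn_subset[OF that U]] by (simp add: k(1))
  qed
  then have "AE x in lebesgue. \<forall>j\<in>UNIV. norm x > R \<longrightarrow> E x $ j = 0"
    by (intro AE_finite_allI) auto
  then show ?thesis by eventually_elim (auto simp: vec_eq_iff)
qed

lemma maxwell_ucp_ball:
  fixes E H :: "real^3 \<Rightarrow> complex^3" and \<alpha> \<beta> :: complex
  assumes E: "\<And>j. loc_integrable (\<lambda>x. E x $ j)" and H: "\<And>j. loc_integrable (\<lambda>x. H x $ j)"
    and mE: "\<And>f q. test_fn U f \<Longrightarrow> (LINT x|lebesgue. dot_complex (E x) (cross3_complex (\<chi> j. pd j f x) q))
        = \<alpha> * (LINT x|lebesgue. dot_complex (H x) (f x *s q))"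
    and mH: "\<And>f q. test_fn U f \<Longrightarrow> (LINT x|lebesgue. dot_complex (H x) (cross3_complex (\<chi> j. pd j f x) q))
        = \<beta> * (LINT x|lebesgue. dot_complex (E x) (f x *s q))"
    and nz: "\<alpha> \<noteq> 0" "\<beta> \<noteq> 0" and k: "\<alpha> * \<beta> = of_real (k^2)" "k \<noteq> 0"
    and U: "ball p R \<subseteq> U" and r: "0 < r" "r < R"
    and zero: "AE x in lebesgue. x \<in> ball p r \<longrightarrow> E x = 0"
  shows "AE x in lebesgue. x \<in> ball p R \<longrightarrow> E x = 0"
proof -
  have "AE x in lebesgue. x \<in> ball p R \<longrightarrow> E x $ j = 0" for j
  proof (rule ucp_ball[OF E k(2) r])
    show "AE x in lebesgue. x \<in> ball p r \<longrightarrow> E x $ j = 0"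
      using zero by eventually_elim auto
    show "(LINT x|lebesgue. E x $ j * ((\<Sum>j\<in>UNIV. pd j (pd j f) x) + of_real (k^2) * f x)) = 0"
      if "test_fn (ball p R) f" for f
      using maxwell_helmholtz[OF E H mE mH nz test_fn_subset[OF that U]] by (simp add: k(1))
  qed
  then have "AE x in lebesgue. \<forall>j\<in>UNIV. x \<in> ball p R \<longrightarrow> E x $ j = 0"
    by (intro AE_finite_allI) auto
  then show ?thesis by eventually_elim (auto simp: vec_eq_iff)
qed

text \<open>Test functions supported in \<open>V\<close> see the weak curl only there.\<close>

lemma weak_curl_off_support:
  assumes w: "has_weak_curl U F" and H: "\<And>j. loc_integrable (\<lambda>x. H x $ j)" and F: "\<And>j. loc_integrable (\<lambda>x. F x $ j)"
    and eq: "AE x in lebesgue. x \<in> V \<longrightarrow> F x = \<alpha> *s H x" and f: "test_fn V f"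
  shows "(LINT x|lebesgue. dot_complex (U x) (cross3_complex (\<chi> j. pd j f x) q))
        = \<alpha> * (LINT x|lebesgue. dot_complex (H x) (f x *s q))"
proof -
  have "AE x in lebesgue. dot_complex (F x) (f x *s q) = \<alpha> * dot_complex (H x) (f x *s q)"
    using eq
  proof eventually_elim
    case (elim x)
    show ?case
    proof (cases "x \<in> V")
      case True then show ?thesis using elim by (simp add: dot_complex_linear)
    next
      case False
      then have "f x = 0" using f by (auto simp: test_fn_def)
      then show ?thesis by (simp add: dot_complex_3)
    qed
  qed
  then have "(LINT x|lebesgue. dot_complex (F x) (f x *s q)) = (LINT x|lebesgue. \<alpha> * dot_complex (H x) (f x *s q))"
    by (intro integral_cong_AE borel_measurable_integrable integrable_mult_right
        integrable_dot_scale[OF F f] integrable_dot_scale[OF H f])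
  then show ?thesis using weak_curl_scale[OF w f, of q] by simp
qed

theorem theorem2p2:
  fixes \<Omega> :: "(real ^ 3) set" and x0 a :: "real ^ 3"
    and r0 \<theta>0 \<alpha> \<omega> \<epsilon>0 \<mu>0 :: real
    and J1 J2 J1h J2h E H Einf Hinf :: "real ^ 3 \<Rightarrow> complex ^ 3"
  assumes "\<omega> > 0" and "\<epsilon>0 > 0" and "\<mu>0 > 0" and "0 < \<alpha>" and "\<alpha> < 1"
    and "bounded_lipschitz_domain \<Omega>" and "connected (- \<Omega>)"
    and "x0 \<in> frontier \<Omega>"
    and "a \<in> sphere 0 1" and "0 < \<theta>0" and "\<theta>0 < pi / 2" and "r0 > 0"
    and "\<Omega> \<inter> ball x0 r0 = truncated_cone x0 a \<theta>0 r0 \<inter> ball x0 r0"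
    and "AE x in lebesgue. x \<notin> \<Omega> \<longrightarrow> J1 x = 0"
    and "AE x in lebesgue. x \<notin> \<Omega> \<longrightarrow> J2 x = 0"
    and "L2_on \<Omega> J1" and "L2_on \<Omega> J2"
    and "holder_representative \<alpha> (truncated_cone x0 a \<theta>0 r0) J1 J1h"
    and "holder_representative \<alpha> (truncated_cone x0 a \<theta>0 r0) J2 J2h"
    and "source_scattering_solution \<omega> \<epsilon>0 \<mu>0 J1 J2 E H"
    and "far_field_pattern (wave_number \<omega> \<epsilon>0 \<mu>0) E Einf"
    and "far_field_pattern (wave_number \<omega> \<epsilon>0 \<mu>0) H Hinf"
    and "\<forall>y\<in>sphere 0 1. Einf y = 0 \<and> Hinf y = 0"
  shows "J1h x0 = 0 \<and> J2h x0 = 0"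
proof -
  define k where "k = wave_number \<omega> \<epsilon>0 \<mu>0"
  have k0: "k \<noteq> 0" using assms(1-3) by (simp add: k_def wave_number_def)
  \<comment> \<open>With these constants each equation says that the curl is a constant times the
    other field plus a current, and the product of the constants is \<open>k^2\<close>.\<close>
  define A where "A = \<i> * complex_of_real (\<omega> * \<mu>0)"
  define B where "B = - (\<i> * complex_of_real (\<omega> * \<epsilon>0))"
  have AB: "A * B = of_real (k^2)" "B * A = of_real (k^2)"
  proof -
    have "k^2 = \<omega> * \<mu>0 * (\<omega> * \<epsilon>0)"
      using assms(1-3) by (simp add: k_def wave_number_def power_mult_distrib power2_eq_square)
    moreover have "A * B = of_real (\<omega> * \<mu>0 * (\<omega> * \<epsilon>0))" by (simp add: A_def B_def complex_eq_iff)
    ultimately show "A * B = of_real (k^2)" by simp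
    then show "B * A = of_real (k^2)" by (simp add: mult.commute)
  qed
  have nz: "A \<noteq> 0" "B \<noteq> 0" using assms(1-3) by (simp_all add: A_def B_def)
  obtain F G where wE: "has_weak_curl E F" and wH: "has_weak_curl H G" and L2: "L2_loc E" "L2_loc F" "L2_loc H" "L2_loc G"
    and F: "AE x in lebesgue. F x - A *s H x = J1 x"
    and G: "AE x in lebesgue. G x + (\<i> * complex_of_real (\<omega> * \<epsilon>0)) *s E x = J2 x"
    using assms(20) unfolding source_scattering_solution_def H_loc_curl_def A_def by blast
  note li = L2(1)[THEN L2_loc_nth] L2(2)[THEN L2_loc_nth] L2(3)[THEN L2_loc_nth] L2(4)[THEN L2_loc_nth]
  have F': "AE x in lebesgue. F x = A *s H x + J1 x" using F by eventually_elim (simp add: algebra_simps)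
  have G': "AE x in lebesgue. G x = B *s E x + J2 x"
    using G by eventually_elim (auto simp: B_def vec_eq_iff algebra_simps)
  have F0: "AE x in lebesgue. x \<in> - closure \<Omega> \<longrightarrow> F x = A *s H x"
    using F' assms(14) by eventually_elim (use closure_subset in auto)
  have G0: "AE x in lebesgue. x \<in> - closure \<Omega> \<longrightarrow> G x = B *s E x"
    using G' assms(15) by eventually_elim (use closure_subset in auto)
  note mE = weak_curl_off_support[OF wE li(3) li(2) F0] and mH = weak_curl_off_support[OF wH li(1) li(4) G0]
  have op: "open \<Omega>" "bounded \<Omega>" using assms(6) by (auto simp: bounded_lipschitz_domain_def)
  obtain C1 R1 where d1: "R1 > 0" "AE x in lebesgue. norm x > R1 \<longrightarrow> norm (E x) \<le> C1 / (norm x)^2"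
    using far_field_zero_decay[OF assms(21)] assms(23) by blast
  obtain C2 R2 where d2: "R2 > 0" "AE x in lebesgue. norm x > R2 \<longrightarrow> norm (H x) \<le> C2 / (norm x)^2"
    using far_field_zero_decay[OF assms(22)] assms(23) by blast
  obtain R3 where R3: "\<And>x. x \<in> closure \<Omega> \<Longrightarrow> norm x \<le> R3"
    using bounded_closure[OF op(2)] by (auto simp: bounded_iff)
  \<comment> \<open>Beyond \<open>R\<close> both decay estimates hold and
    \<open>closure \<Omega>\<close> has been left.\<close>
  define R where "R = max R1 (max R2 R3)"
  have R: "R > 0" "{x. norm x > R} \<subseteq> - closure \<Omega>" 
  proof -
    show "R > 0" using d1(1) by (simp add: R_def)
    show "{x. norm x > R} \<subseteq> - closure \<Omega>" using R3 by (force simp: R_def)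
  qed
  have decE: "AE x in lebesgue. norm x > R \<longrightarrow> norm (E x) \<le> C1 / (norm x)^2"
    using d1(2) by eventually_elim (simp add: R_def)
  have zE: "AE x in lebesgue. norm x > R \<longrightarrow> E x = 0"
    by (rule maxwell_far_zero[OF li(1) li(3) mE mH nz AB(1) k0 R(2,1) decE])
  have decH: "AE x in lebesgue. norm x > R \<longrightarrow> norm (H x) \<le> C2 / (norm x)^2"
    using d2(2) by eventually_elim (simp add: R_def)
  have zH: "AE x in lebesgue. norm x > R \<longrightarrow> H x = 0"
    by (rule maxwell_far_zero[OF li(3) li(1) mH mE nz(2,1) AB(2) k0 R(2,1) decH])
  have far: "AE x in lebesgue. norm x > R \<longrightarrow> E x = 0 \<and> H x = 0" using zE zH by eventually_elim simp
  have x0: "x0 \<notin> \<Omega>" using assms(8) op(1) by (simp add: frontier_def interior_open)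
  obtain \<eta> where \<eta>: "\<eta> > 0" "AE x in lebesgue. x \<in> ball x0 \<eta> - closure \<Omega> \<longrightarrow> E x = 0 \<and> H x = 0"
  proof (rule zero_propagation[OF assms(6,7) _ far x0])
    fix p r R' assume r: "0 < r" "r < R'" and sub: "ball p R' \<subseteq> - closure \<Omega>"
      and z: "AE x in lebesgue. x \<in> ball p r \<longrightarrow> E x = 0 \<and> H x = 0"
    have zE': "AE x in lebesgue. x \<in> ball p r \<longrightarrow> E x = 0" using z by eventually_elim simp
    have zH': "AE x in lebesgue. x \<in> ball p r \<longrightarrow> H x = 0" using z by eventually_elim simp
    have "AE x in lebesgue. x \<in> ball p R' \<longrightarrow> E x = 0"
      by (rule maxwell_ucp_ball[OF li(1) li(3) mE mH nz AB(1) k0 sub r zE'])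
    moreover have "AE x in lebesgue. x \<in> ball p R' \<longrightarrow> H x = 0"
      by (rule maxwell_ucp_ball[OF li(3) li(1) mH mE nz(2,1) AB(2) k0 sub r zH'])
    ultimately show "AE x in lebesgue. x \<in> ball p R' \<longrightarrow> E x = 0 \<and> H x = 0" by eventually_elim simp
  qed blast
  have a: "norm a = 1" using assms(9) by simp
  define \<kappa> where "\<kappa> = cos \<theta>0"
  have \<kappa>: "0 < \<kappa>" "\<kappa> < 1"
    using assms(10,11) cos_gt_zero_pi[of \<theta>0] cos_monotone_0_pi[of 0 \<theta>0] by (auto simp: \<kappa>_def)
  define K where "K = {x \<in> ball x0 r0. x - x0 \<in> axial_cone a \<kappa>}"
  have K: "truncated_cone x0 a \<theta>0 r0 = K"
    unfolding K_def \<kappa>_def by (rule truncated_cone_eq[OF a assms(10,11)])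
  have "K \<inter> ball x0 r0 = K" unfolding K_def by blast
  then have \<Omega>K: "\<Omega> \<inter> ball x0 r0 = K" using assms(13) unfolding K by simp
  have cK: "convex K"
  proof -
    have "K = ball x0 r0 \<inter> (+) x0 ` axial_cone a \<kappa>"
    proof -
      have "x \<in> (+) x0 ` axial_cone a \<kappa> \<longleftrightarrow> x - x0 \<in> axial_cone a \<kappa>" for x
        by (auto simp: image_iff intro!: bexI[of _ "x - x0"])
      then show ?thesis unfolding K_def by blast
    qed
    then show ?thesis using convex_axial_cone[of \<kappa> a] \<kappa> by (simp add: convex_Int convex_translation)
  qed
  have oK: "open K" unfolding \<Omega>K[symmetric] using op(1) by auto
  \<comment> \<open>Within \<open>\<rho>\<close> of the apex the conical description of
    \<open>\<Omega>\<close> and the vanishing of the exterior fields are both available.\<close>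
  define \<rho> where "\<rho> = min \<eta> r0"
  have \<rho>: "\<rho> > 0" "\<rho> \<le> \<eta>" "\<rho> \<le> r0" using \<eta>(1) assms(12) by (auto simp: \<rho>_def)
  define S where "S = {x \<in> ball x0 \<rho>. x - x0 \<in> axial_cone a \<kappa>}"
  have SK: "S = K \<inter> ball x0 \<rho>" using \<rho>(3) by (auto simp: S_def K_def)
  have S\<Omega>: "x \<in> S \<longleftrightarrow> x \<in> \<Omega>" if "x \<in> ball x0 \<rho>" for x
    using \<Omega>K that \<rho>(3) by (auto simp: SK)
  \<comment> \<open>The fields are known to vanish off \<open>closure \<Omega>\<close> but must
    vanish off the open cone; near the apex the gap is the frontier of the convex set
    \<open>K\<close>.\<close>
  have "AE x in lebesgue. x \<notin> frontier K"
    using negligible_convex_frontier[OF cK] by (simp add: AE_lebesgue_iff_negligible)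
  then have off: "AE x in lebesgue. x \<in> ball x0 \<rho> \<and> x \<notin> S \<longrightarrow> E x = 0 \<and> H x = 0"
    using \<eta>(2)
  proof eventually_elim
    case (elim x)
    show ?case
    proof
      assume x: "x \<in> ball x0 \<rho> \<and> x \<notin> S"
      then have xr: "x \<in> ball x0 r0" "x \<notin> K" "x \<in> ball x0 \<eta>" using \<rho> by (auto simp: SK)
      have "x \<notin> closure \<Omega>"
      proof
        assume "x \<in> closure \<Omega>"
        then have "x \<in> closure (ball x0 r0 \<inter> \<Omega>)"
          using open_Int_closure_subset[OF open_ball, of x0 r0 \<Omega>] xr(1) by blast
        then have "x \<in> closure K" by (simp add: \<Omega>K Int_commute)
        then show False using elim(1) xr(2) oK by (simp add: frontier_def interior_open)
      qed
      then show "E x = 0 \<and> H x = 0" using elim(2) xr(3) by blast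
    qed
  qed
  have rep: "continuous_on (closure K) g" "AE x in lebesgue. x \<in> K \<longrightarrow> J x = g x"
    if "holder_representative \<alpha> (truncated_cone x0 a \<theta>0 r0) J g" for J g
    using that holder_on_continuous_on[OF _ assms(4)] unfolding K holder_representative_def by auto
  have clS: "closure S \<subseteq> closure K" by (rule closure_mono) (auto simp: SK)
  note cJ = continuous_on_subset[OF rep(1)[OF assms(18)] clS] continuous_on_subset[OF rep(1)[OF assms(19)] clS]
  have FJ: "AE x in lebesgue. x \<in> ball x0 \<rho> \<longrightarrow> F x = A *s H x + (if x \<in> S then J1h x else 0)"
    using F' assms(14) rep(2)[OF assms(18)]
    by eventually_elim (use S\<Omega> in \<open>auto simp: SK\<close>)
  have GJ: "AE x in lebesgue. x \<in> ball x0 \<rho> \<longrightarrow> G x = B *s E x + (if x \<in> S then J2h x else 0)"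
    using G' assms(15) rep(2)[OF assms(19)]
    by eventually_elim (use S\<Omega> in \<open>auto simp: SK\<close>)
  have off': "AE x in lebesgue. x \<in> ball x0 \<rho> \<and> x \<notin> S \<longrightarrow> H x = 0 \<and> E x = 0"
    using off by eventually_elim blast
  \<comment> \<open>Here \<open>E\<close> is tested with the leading amplitude, so \<open>J1\<close>
    survives the limit; below, fields and constants are exchanged and \<open>J2\<close>
    survives.\<close>
  have "J1h x0 = 0"
    by (rule zero_if_orthogonal_to_null_vectors[of a])
      (rule corner_orthogonality[OF AB(1) nz(2) li(1) li(3) li(2) li(4) wE wH a _ _ \<kappa> \<rho>(1) S_def off FJ GJ cJ])
  moreover have "J2h x0 = 0"
    by (rule zero_if_orthogonal_to_null_vectors[of a])
      (rule corner_orthogonality[OF AB(2) nz(1) li(3) li(1) li(4) li(2) wH wE a _ _ \<kappa> \<rho>(1) S_def off' GJ FJ cJ(2,1)])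
  ultimately show ?thesis ..
qed

end
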